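(* Let $N\ge 2$ and let $\Omega\subset\mathbb{R}^N$ be a convex domain with $C^2$ boundary satisfying a uniform interior sphere condition with radius $\bar r>0$ (i.e. for every $x\in\partial\Omega$ there is a ball $B_{\bar r}\subset\Omega$ of radius $\bar r$ with $\overline{B_{\bar r}}\cap\overline\Omega=\{x\}$), and let $d_0=\mathrm{dist}(0,\partial\Omega)$. Then for every $u\in H^1(\Omega,d\gamma_N)$ there exists $\tilde u\in H^1(\mathbb{R}^N,d\gamma_N)$ with $\tilde u=u$ on $\Omega$ and $$\|\tilde u\|_{H^1(\mathbb{R}^N,d\gamma_N)}\le C\,\|u\|_{H^1(\Omega,d\gamma_N)},$$ where the constant $C$ depends only on $\bar r$ and $N$ if $0\in\Omega$, and only on $\bar r$, $N$ and $d_0$ if $0\notin\Omega$.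
   Context: $d\gamma_N=(2\pi)^{-N/2}e^{-|x|^2/2}\,dx$ is the standard Gaussian measure on $\mathbb{R}^N$. For an open set $U\subset\mathbb{R}^N$, $H^1(U,d\gamma_N)=\{u\in W^{1,1}_{\rm loc}(U): u\in L^2(U,d\gamma_N),\ |Du|\in L^2(U,d\gamma_N)\}$ with norm $\|u\|_{H^1(U,d\gamma_N)}=\|u\|_{L^2(U,d\gamma_N)}+\|Du\|_{L^2(U,d\gamma_N)}$. The domain $\Omega$ may be unbounded.
   Formalization: The interior sphere condition is read as: the closed ball of radius r̄ meets the boundary ∂Ω (not the closure of Ω) exactly in {x}; as written, a ball contained in Ω cannot have its closure meet the closure of Ω in a single point. *)

theory Defs
  imports "HOL-Analysis.Analysis"
begin

definition gauss_density :: "'a::euclidean_space \<Rightarrow> real" where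
  "gauss_density x = (2 * pi) powr (- real DIM('a) / 2) * exp (- (norm x)\<^sup>2 / 2)"

definition gauss_measure :: "'a::euclidean_space measure" where
  "gauss_measure = density lebesgue (\<lambda>x. ennreal (gauss_density x))"

coinductive smooth_fun :: "('a::euclidean_space \<Rightarrow> real) \<Rightarrow> bool" where
  "(\<forall>x. f differentiable (at x)) \<Longrightarrow>
   (\<forall>i\<in>Basis. smooth_fun (\<lambda>x. frechet_derivative f (at x) i)) \<Longrightarrow> smooth_fun f"

definition tsupport :: "('a::euclidean_space \<Rightarrow> real) \<Rightarrow> 'a set" where
  "tsupport f = closure {x. f x \<noteq> 0}"

definition test_fun :: "'a::euclidean_space set \<Rightarrow> ('a \<Rightarrow> real) \<Rightarrow> bool" where
  "test_fun U \<phi> \<longleftrightarrow> smooth_fun \<phi> \<and> compact (tsupport \<phi>) \<and> tsupport \<phi> \<subseteq> U"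

definition W11loc_grad :: "'a::euclidean_space set \<Rightarrow> ('a \<Rightarrow> real) \<Rightarrow> ('a \<Rightarrow> 'a) \<Rightarrow> bool" where
  "W11loc_grad U u g \<longleftrightarrow>
     (\<forall>K. compact K \<and> K \<subseteq> U \<longrightarrow> set_integrable lebesgue K u \<and> set_integrable lebesgue K g) \<and>
     (\<forall>\<phi>. test_fun U \<phi> \<longrightarrow> (\<forall>i\<in>Basis.
        (LINT x:U|lebesgue. u x * frechet_derivative \<phi> (at x) i) =
        - (LINT x:U|lebesgue. (g x \<bullet> i) * \<phi> x)))"

definition L2_gauss :: "'a::euclidean_space set \<Rightarrow> ('a \<Rightarrow> real) \<Rightarrow> bool" where
  "L2_gauss U f \<longleftrightarrow> set_borel_measurable gauss_measure U f \<and>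
      set_integrable gauss_measure U (\<lambda>x. (f x)\<^sup>2)"

definition L2_gauss_norm :: "'a::euclidean_space set \<Rightarrow> ('a \<Rightarrow> real) \<Rightarrow> real" where
  "L2_gauss_norm U f = sqrt (LINT x:U|gauss_measure. (f x)\<^sup>2)"

definition H1_gauss_grad :: "'a::euclidean_space set \<Rightarrow> ('a \<Rightarrow> real) \<Rightarrow> ('a \<Rightarrow> 'a) \<Rightarrow> bool" where
  "H1_gauss_grad U u g \<longleftrightarrow> W11loc_grad U u g \<and> L2_gauss U u \<and> L2_gauss U (\<lambda>x. norm (g x))"

definition H1_gauss_norm :: "'a::euclidean_space set \<Rightarrow> ('a \<Rightarrow> real) \<Rightarrow> ('a \<Rightarrow> 'a) \<Rightarrow> real" where
  "H1_gauss_norm U u g = L2_gauss_norm U u + L2_gauss_norm U (\<lambda>x. norm (g x))"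

definition C2_boundary :: "'a::euclidean_space set \<Rightarrow> bool" where
  "C2_boundary \<Omega> \<longleftrightarrow> (\<forall>x\<in>frontier \<Omega>. \<exists>V \<phi> G H.
      open V \<and> x \<in> V \<and>
      (\<forall>y\<in>V. (\<phi> has_derivative (\<lambda>h. G y \<bullet> h)) (at y)) \<and>
      (\<forall>y\<in>V. (G has_derivative blinfun_apply (H y)) (at y)) \<and>
      continuous_on V H \<and>
      (\<forall>y\<in>V. G y \<noteq> 0) \<and>
      \<Omega> \<inter> V = {y\<in>V. \<phi> y < 0})"

definition interior_sphere :: "'a::euclidean_space set \<Rightarrow> real \<Rightarrow> bool" where
  "interior_sphere \<Omega> r \<longleftrightarrow> (\<forall>x\<in>frontier \<Omega>. \<exists>c.
      ball c r \<subseteq> \<Omega> \<and> cball c r \<inter> frontier \<Omega> = {x})"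

end

(*
  Let p be the nearest-point projection onto the closure of the convex set \<Omega> and let R = 2 p - id
  be the reflection in it. R is Lipschitz and is the identity on \<Omega>, so no gluing across the boundary
  is needed: with a cutoff \<chi> living in the strip of width rbar/2 around \<Omega>, the extension is \<chi> (u o R).

  By the interior sphere condition the outer normal is (1/rbar)-Lipschitz along the boundary, which
  gives |x - y| <= 9 |R x - R y| on the outer strip; hence pulling back by R costs at most a
  dimensional factor in Lebesgue measure. If n is the outer normal at p(x) and
  s = |x - p(x)|, then |x|^2 - |R x|^2 = 4 s (p(x) . n), and p(x) . n >= - d0 by convexity
  (>= 0 if 0 is in \<Omega>), so the Gaussian weight at x is controlled by the weight at R x.

  The C^2 boundary gives differentiability of p off the null set \<partial>\<Omega>. The chain rule for u o R is
  proved for Lipschitz C^1 functions by difference quotients, and passes to the limit because on the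
  convex set \<Omega> \<inter> ball(0, B) such functions are W^{1,1}-dense (contract towards an interior point,
  then mollify).
*)
theory Submission
  imports Defs
begin

text \<open>The reflection is only Lipschitz and its differentiability is known only off the
  boundary, so measure and differentiation are handled separately. Measure: an inequality |x - y| <=
  L |T x - T y| alone already dominates the push-forward of Lebesgue measure, by the factor (10
  L)^N; L = 9 is the origin of 90^N in the constant. Differentiation: for a fixed test function,
  both sides of the weak gradient identity for \<open>ext u\<close> are integrals of u o R and Du o
  R against bounded coefficients living in the strip, hence continuous in (u, Du) for the L^1 norm.
  So L^1 approximation on a bounded piece of \<Omega> proves the identity, and the weighted L^2
  estimates are read off afterwards from the explicit gradient formula. The strip has width rbar/2
  rather than rbar because the variation of the normal, multiplied by a distance s <= rbar/2, must
  be at most half of |p(x) - p(y)| to be absorbed. The Gaussian weight costs exp(rbar |d0|), and the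
  cutoff, with Lipschitz constant 16/rbar, brings in the remaining dependence on rbar.\<close>

section \<open>Measure of sets expanded by a map\<close>

lemma emeasure_UN_countable_le:
  assumes C: "countable C" and B: "\<And>i. i \<in> C \<Longrightarrow> B i \<in> sets M"
  shows "emeasure M (\<Union>i\<in>C. B i) \<le> (\<integral>\<^sup>+i. emeasure M (B i) \<partial>count_space C)"
proof -
  define f where "f n = (if n \<in> to_nat_on C ` C then B (from_nat_into C n) else {})" for n
  have "(\<Union>i\<in>C. B i) = (\<Union>n. f n)"
    using C by (auto simp: f_def split: if_splits)
  also have "emeasure M \<dots> \<le> (\<Sum>n. emeasure M (f n))"
    using B C by (intro emeasure_subadditive_countably) (auto simp: f_def)
  also have "\<dots> = (\<integral>\<^sup>+n. emeasure M (f n) \<partial>count_space UNIV)"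
    by (rule nn_integral_count_space_nat[symmetric])
  also have "\<dots> = (\<integral>\<^sup>+n. emeasure M (B (from_nat_into C n)) * indicator (to_nat_on C ` C) n \<partial>count_space UNIV)"
    by (intro nn_integral_cong) (simp add: f_def)
  also have "\<dots> = (\<integral>\<^sup>+n. emeasure M (B (from_nat_into C n)) \<partial>count_space (to_nat_on C ` C))"
    by (rule nn_integral_count_space_indicator[symmetric]) simp
  also have "\<dots> = (\<integral>\<^sup>+i. emeasure M (B (from_nat_into C (to_nat_on C i))) \<partial>count_space C)"
    by (rule nn_integral_bij_count_space[symmetric]) (simp add: bij_betw_def inj_on_to_nat_on C)
  also have "\<dots> = (\<integral>\<^sup>+i. emeasure M (B i) \<partial>count_space C)"
    using C by (intro nn_integral_cong) simp
  finally show ?thesis .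
qed

text \<open>Vitali: cover an open superset of \<open>E\<close> by 5-fold enlarged disjoint balls; the preimage of each is
  contained in one ball of comparable radius.\<close>

lemma emeasure_le_of_expanding:
  fixes T :: "'a::euclidean_space \<Rightarrow> 'a"
  assumes A: "A \<in> sets borel" and E: "E \<in> sets borel" and sub: "T ` A \<subseteq> E"
    and L: "L > 0" "\<And>x y. x \<in> A \<Longrightarrow> y \<in> A \<Longrightarrow> norm (x - y) \<le> L * norm (T x - T y)"
  shows "emeasure lborel A \<le> ennreal ((10 * L) ^ DIM('a)) * emeasure lborel E"
proof -
  let ?c = "(10 * L) ^ DIM('a)"
  have c: "?c > 0" using L by simp
  \<comment> \<open>Open supersets suffice by outer regularity. The radii must be bounded for the
    covering lemma and small enough to keep the disjoint balls inside \<open>W\<close>.\<close>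
  have le: "emeasure lborel A \<le> ennreal ?c * emeasure lborel W" if W: "open W" "E \<subseteq> W" for W
  proof -
    have "\<exists>d. 0 < d \<and> d \<le> 1 \<and> cball x d \<subseteq> W" if x: "x \<in> W" for x
    proof -
      obtain d where "d > 0" "cball x d \<subseteq> W" using W(1) x by (meson open_contains_cball)
      then show ?thesis using subset_cball[of "min d 1" d x] by (intro exI[of _ "min d 1"]) auto
    qed
    then obtain d where d: "\<And>x. x \<in> W \<Longrightarrow> 0 < d x \<and> d x \<le> 1 \<and> cball x (d x) \<subseteq> W"
      by metis
    have 1: "W \<subseteq> (\<Union>i\<in>W. cball i (d i))" 
    proof
      fix x assume x: "x \<in> W"
      then have "x \<in> cball x (d x)" using d[OF x] by simp
      then show "x \<in> (\<Union>i\<in>W. cball i (d i))" using x by blast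
    qed
    have 2: "0 < d i \<and> d i \<le> 1" if "i \<in> W" for i using d that by blast
    obtain C where C: "countable C" "C \<subseteq> W"
      "pairwise (\<lambda>i j. disjnt (cball i (d i)) (cball j (d j))) C"
      "W \<subseteq> (\<Union>i\<in>C. cball i (5 * d i))"
      using Vitali_covering_lemma_cballs[OF 1 2] by blast
    define b where "b i = (SOME x. x \<in> A \<and> T x \<in> cball i (5 * d i))" for i
    have cov: "A \<subseteq> (\<Union>i\<in>C. cball (b i) (10 * L * d i))"
    proof
      fix x assume x: "x \<in> A"
      then obtain i where i: "i \<in> C" "T x \<in> cball i (5 * d i)" using C(4) sub W(2) by blast
      then have "b i \<in> A \<and> T (b i) \<in> cball i (5 * d i)"
        unfolding b_def using x by (rule_tac someI[of _ x]) auto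
      \<comment> \<open>Two points of a ball of radius \<open>5 * d i\<close> are at most
        \<open>10 * d i\<close> apart: this is the 10 in the constant.\<close>
      moreover from this i have "dist (T (b i)) (T x) \<le> 10 * d i"
        using dist_triangle3[of "T (b i)" "T x" i] by auto
      ultimately have "norm (b i - x) \<le> L * (10 * d i)"
        using L(2)[of "b i" x] x L(1) by (smt (verit) dist_norm mult_left_mono)
      then show "x \<in> (\<Union>i\<in>C. cball (b i) (10 * L * d i))"
        using i(1) by (auto simp: dist_norm mult_ac)
    qed
    have "emeasure lborel A \<le> emeasure lborel (\<Union>i\<in>C. cball (b i) (10 * L * d i))"
      using cov C(1) by (intro emeasure_mono sets.countable_UN') auto
    also have "\<dots> \<le> (\<integral>\<^sup>+i. emeasure lborel (cball (b i) (10 * L * d i)) \<partial>count_space C)"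
      using C(1) by (intro emeasure_UN_countable_le) auto
    also have "\<dots> = (\<integral>\<^sup>+i. ennreal ?c * emeasure lborel (cball i (d i)) \<partial>count_space C)"
    proof (intro nn_integral_cong)
      fix i assume "i \<in> space (count_space C)"
      then have "d i > 0" using d C by auto
      then show "emeasure lborel (cball (b i) (10 * L * d i)) = ennreal ?c * emeasure lborel (cball i (d i))"
        using L by (simp add: emeasure_cball power_mult_distrib mult_ac flip: ennreal_mult')
    qed
    also have "\<dots> = ennreal ?c * (\<integral>\<^sup>+i. emeasure lborel (cball i (d i)) \<partial>count_space C)"
      by (rule nn_integral_cmult) simp
    also have "(\<integral>\<^sup>+i. emeasure lborel (cball i (d i)) \<partial>count_space C) = emeasure lborel (\<Union>i\<in>C. cball i (d i))"
      using C by (intro emeasure_UN_countable[symmetric]) (auto simp: disjoint_family_on_def pairwise_def disjnt_def)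
    also have "\<dots> \<le> emeasure lborel W"
      using d C W by (intro emeasure_mono) auto
    finally show ?thesis by (simp add: mult_left_mono)
  qed
  show ?thesis
  proof (rule ennreal_le_epsilon)
    fix e :: real assume e: "0 < e"
    \<comment> \<open>The excess measure is divided by \<open>?c\<close> so that it costs only
      \<open>e\<close> after multiplication.\<close>
    obtain W where W: "open W" "E \<subseteq> W" "emeasure lborel (W - E) < e / ?c"
      using outer_regular_lborel[OF E, of "e / ?c"] e c by auto
    have "emeasure lborel W \<le> emeasure lborel E + emeasure lborel (W - E)"
      using W E by (subst plus_emeasure) (auto intro!: emeasure_mono)
    also have "\<dots> \<le> emeasure lborel E + ennreal (e / ?c)" using W(3) by (intro add_mono) auto
    finally have "ennreal ?c * emeasure lborel W \<le> ennreal ?c * emeasure lborel E + ennreal ?c * ennreal (e / ?c)"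
      by (metis mult_left_mono distrib_left zero_le)
    also have "ennreal ?c * ennreal (e / ?c) = ennreal e" using e c L(1) by (simp flip: ennreal_mult')
    finally show "emeasure lborel A \<le> ennreal ?c * emeasure lborel E + ennreal e"
      using le[OF W(1,2)] by (rule order_trans[rotated])
  qed
qed

text \<open>The set estimate, applied to the part of \<open>A\<close> sent into \<open>X\<close>,
  says that the push-forward of Lebesgue measure on \<open>A\<close> is at most a multiple of
  Lebesgue measure; it remains to integrate \<open>F\<close> against both.\<close>

lemma nn_integral_expanding_le:
  fixes T :: "'a::euclidean_space \<Rightarrow> 'a"
  assumes T: "T \<in> borel_measurable borel" and A: "A \<in> sets borel"
    and L: "L > 0" "\<And>x y. x \<in> A \<Longrightarrow> y \<in> A \<Longrightarrow> norm (x - y) \<le> L * norm (T x - T y)"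
    and F: "F \<in> borel_measurable borel"
  shows "(\<integral>\<^sup>+x\<in>A. F (T x) \<partial>lborel) \<le> ennreal ((10 * L) ^ DIM('a)) * (\<integral>\<^sup>+y. F y \<partial>lborel)"
proof -
  let ?c = "ennreal ((10 * L) ^ DIM('a))"
  let ?M = "distr (restrict_space lborel A) borel T"
  have TM: "T \<in> measurable (restrict_space lborel A) borel"
    using T by (intro measurable_restrict_space1) auto
  have "(\<integral>\<^sup>+x\<in>A. F (T x) \<partial>lborel) = (\<integral>\<^sup>+x. F (T x) \<partial>restrict_space lborel A)"
    using A by (simp add: nn_integral_restrict_space)
  also have "\<dots> = (\<integral>\<^sup>+y. F y \<partial>?M)" using TM F by (simp add: nn_integral_distr)
  also have "\<dots> \<le> (\<integral>\<^sup>+y. F y \<partial>scale_measure ?c lborel)"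
  proof (rule nn_integral_mono_measure)
    show "?M \<le> scale_measure ?c lborel"
    proof (subst le_measure)
      show "\<forall>X\<in>sets ?M. emeasure ?M X \<le> emeasure (scale_measure ?c lborel) X"
      proof
        fix X :: "'a set" assume "X \<in> sets ?M"
        then have X: "X \<in> sets borel" by simp
        have "T -` X \<inter> A \<in> sets borel" using measurable_sets[OF T X] A by auto
        then have "emeasure lborel (T -` X \<inter> A) \<le> ?c * emeasure lborel X"
          using X L by (intro emeasure_le_of_expanding[where T=T]) auto
        then show "emeasure ?M X \<le> emeasure (scale_measure ?c lborel) X"
          using X A TM by (simp add: emeasure_distr emeasure_restrict_space space_restrict_space)
      qed
    qed simp
  qed simp
  also have "\<dots> = ?c * (\<integral>\<^sup>+y. F y \<partial>lborel)" using F by (simp add: nn_integral_scale_measure)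
  finally show ?thesis .
qed

section \<open>Integration by parts for Lipschitz functions\<close>

lemma smooth_funD:
  assumes "smooth_fun f"
  shows "(f has_derivative frechet_derivative f (at x)) (at x)" "continuous_on S f"
    "i \<in> Basis \<Longrightarrow> smooth_fun (\<lambda>x. frechet_derivative f (at x) i)"
    "i \<in> Basis \<Longrightarrow> continuous_on S (\<lambda>x. frechet_derivative f (at x) i)"
proof -
  have diff: "f differentiable (at x)" and sm: "\<And>i. i \<in> Basis \<Longrightarrow> smooth_fun (\<lambda>x. frechet_derivative f (at x) i)"
    if "smooth_fun f" for f :: "'a \<Rightarrow> real" and x
    using that by (auto elim: smooth_fun.cases)
  have cont: "continuous_on S f" if "smooth_fun f" for f :: "'a \<Rightarrow> real"
    using diff[OF that] by (meson continuous_at_imp_continuous_on differentiable_imp_continuous_within)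
  show "(f has_derivative frechet_derivative f (at x)) (at x)"
    using diff[OF assms] by (simp add: frechet_derivative_works)
  show "continuous_on S f" by (rule cont[OF assms])
  show "i \<in> Basis \<Longrightarrow> smooth_fun (\<lambda>x. frechet_derivative f (at x) i)" by (rule sm[OF assms])
  then show "i \<in> Basis \<Longrightarrow> continuous_on S (\<lambda>x. frechet_derivative f (at x) i)" by (rule cont)
qed

lemma zero_off_tsupport:
  fixes f :: "'a::euclidean_space \<Rightarrow> real"
  assumes "x \<notin> tsupport f"
  shows "f x = 0" "frechet_derivative f (at x) i = 0"
proof -
  have z: "f y = 0" if "y \<notin> tsupport f" for y
    using that closure_subset[of "{x. f x \<noteq> 0}"] by (auto simp: tsupport_def)
  then show "f x = 0" using assms .
  have "(f has_derivative (\<lambda>h. 0)) (at x)"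
  proof (rule has_derivative_transform_within_open[OF has_derivative_const])
    show "open (- tsupport f)" "x \<in> - tsupport f" using assms by (auto simp: tsupport_def)
    show "0 = f y" if "y \<in> - tsupport f" for y using z that by simp
  qed
  then show "frechet_derivative f (at x) i = 0"
    using frechet_derivative_at by metis
qed

lemma test_fun_support:
  fixes \<phi> :: "'a::euclidean_space \<Rightarrow> real"
  assumes "test_fun U \<phi>"
  shows "\<exists>B>0. \<forall>x. norm x \<ge> B \<longrightarrow> \<phi> x = 0 \<and> (\<forall>i. frechet_derivative \<phi> (at x) i = 0)"
proof -
  have "bounded (tsupport \<phi>)" using assms by (simp add: test_fun_def compact_imp_bounded)
  then obtain B where "B > 0" "\<And>x. x \<in> tsupport \<phi> \<Longrightarrow> norm x < B"
    unfolding bounded_pos_less by blast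
  then show ?thesis using zero_off_tsupport by (metis not_le)
qed

lemma test_fun_bounds:
  fixes \<phi> :: "'a::euclidean_space \<Rightarrow> real"
  assumes "test_fun U \<phi>"
  shows "\<exists>M>0. \<forall>x. \<bar>\<phi> x\<bar> \<le> M \<and> (\<forall>i\<in>Basis. \<bar>frechet_derivative \<phi> (at x) i\<bar> \<le> M)"
proof -
  obtain B where B: "B > 0" "\<And>x. norm x \<ge> B \<Longrightarrow> \<phi> x = 0"
    "\<And>x i. norm x \<ge> B \<Longrightarrow> frechet_derivative \<phi> (at x) i = 0"
    using test_fun_support[OF assms] by blast
  have sm: "smooth_fun \<phi>" using assms by (simp add: test_fun_def)
  have bnd: "\<exists>M. \<forall>x. \<bar>f x\<bar> \<le> M" if "continuous_on UNIV f" "\<And>x. norm x \<ge> B \<Longrightarrow> f x = 0" for f :: "'a \<Rightarrow> real"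
  proof -
    have "bounded (f ` cball 0 B)"
      by (intro compact_imp_bounded compact_continuous_image) (auto intro: continuous_on_subset[OF that(1)])
    then obtain M where M: "M > 0" "\<forall>x\<in>cball 0 B. \<bar>f x\<bar> \<le> M"
      unfolding bounded_pos by auto
    then have "\<bar>f x\<bar> \<le> M" for x using that(2)[of x] by (cases "norm x \<le> B") auto
    then show ?thesis by blast
  qed
  obtain M0 where M0: "\<And>x. \<bar>\<phi> x\<bar> \<le> M0" using bnd[of \<phi>] smooth_funD(2)[OF sm] B(2) by blast
  have "\<forall>i. \<exists>M. i \<in> Basis \<longrightarrow> (\<forall>x. \<bar>frechet_derivative \<phi> (at x) i\<bar> \<le> M)"
    using bnd[of "\<lambda>x. frechet_derivative \<phi> (at x) i" for i] smooth_funD(4)[OF sm] B(3) by blast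
  then obtain M where M: "\<And>i x. i \<in> Basis \<Longrightarrow> \<bar>frechet_derivative \<phi> (at x) i\<bar> \<le> M i" by metis
  show ?thesis
  proof (intro exI[of _ "\<bar>M0\<bar> + (\<Sum>i\<in>Basis. \<bar>M i\<bar>) + 1"] conjI allI ballI)
    show "\<bar>M0\<bar> + (\<Sum>i\<in>Basis. \<bar>M i\<bar>) + 1 > 0" by (intro add_nonneg_pos add_nonneg_nonneg sum_nonneg) auto
    fix x
    show "\<bar>\<phi> x\<bar> \<le> \<bar>M0\<bar> + (\<Sum>i\<in>Basis. \<bar>M i\<bar>) + 1"
      using M0[of x] sum_nonneg[of Basis "\<lambda>i. \<bar>M i\<bar>"] by (smt (verit) abs_ge_zero)
    fix i :: 'a assume i: "i \<in> Basis"
    show "\<bar>frechet_derivative \<phi> (at x) i\<bar> \<le> \<bar>M0\<bar> + (\<Sum>i\<in>Basis. \<bar>M i\<bar>) + 1"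
      using M[OF i, of x] member_le_sum[OF i, of "\<lambda>i. \<bar>M i\<bar>"] by simp
  qed
qed

lemma test_fun_difference_bound:
  fixes \<phi> :: "'a::euclidean_space \<Rightarrow> real"
  assumes sm: "smooth_fun \<phi>" and i: "i \<in> Basis"
    and M: "\<And>x. \<bar>frechet_derivative \<phi> (at x) i\<bar> \<le> M"
  shows "\<bar>\<phi> (x + t *\<^sub>R i) - \<phi> x\<bar> \<le> M * \<bar>t\<bar>"
proof -
  have d: "((\<lambda>s. \<phi> (x + s *\<^sub>R i)) has_derivative (\<lambda>s. s * frechet_derivative \<phi> (at (x + s0 *\<^sub>R i)) i)) (at s0)" for s0
  proof -
    have "((\<lambda>s. x + s *\<^sub>R i) has_derivative (\<lambda>s. s *\<^sub>R i)) (at s0)"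
      by (auto intro!: derivative_eq_intros)
    from has_derivative_compose[OF this smooth_funD(1)[OF sm]]
    show ?thesis
      by (simp add: linear_scale[OF has_derivative_linear[OF smooth_funD(1)[OF sm]]])
  qed
  have "norm (\<phi> (x + t *\<^sub>R i) - \<phi> (x + 0 *\<^sub>R i)) \<le> M * norm (t - 0)"
  proof (rule differentiable_bound[of UNIV])
    show "onorm (\<lambda>s. s * frechet_derivative \<phi> (at (x + s0 *\<^sub>R i)) i) \<le> M" for s0
      by (rule onorm_le) (use mult_right_mono[OF M[of "x + s0 *\<^sub>R i"] abs_ge_zero] in \<open>auto simp: abs_mult mult.commute\<close>)
  qed (use d in \<open>auto intro: has_derivative_at_withinI\<close>)
  then show ?thesis by simp
qed

lemma lborel_integral_translate:
  fixes f :: "'a::euclidean_space \<Rightarrow> real"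
  assumes [measurable]: "f \<in> borel_measurable borel"
  shows "(\<integral>x. f (c + x) \<partial>lborel) = (\<integral>x. f x \<partial>lborel)"
  by (subst (2) lborel_distr_plus[of c, symmetric]) (simp add: integral_distr)

lemma has_derivative_difference_quotient:
  fixes f :: "'a::real_normed_vector \<Rightarrow> 'b::real_normed_vector"
  assumes "(f has_derivative f') (at x)"
  shows "((\<lambda>t. (f (x + t *\<^sub>R i) - f x) /\<^sub>R t) \<longlongrightarrow> f' i) (at 0)"
proof -
  have "((\<lambda>t. x + t *\<^sub>R i) has_derivative (\<lambda>t. t *\<^sub>R i)) (at 0)"
    by (auto intro!: derivative_eq_intros)
  from has_derivative_compose[OF this, of f f'] assms
  have "((\<lambda>t. f (x + t *\<^sub>R i)) has_derivative (\<lambda>t. t *\<^sub>R f' i)) (at 0)"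
    by (simp add: linear_scale[OF has_derivative_linear[OF assms]])
  then have "((\<lambda>t. norm (f (x + t *\<^sub>R i) - f x - t *\<^sub>R f' i) / norm t) \<longlongrightarrow> 0) (at 0)"
    by (simp add: has_derivative_at)
  moreover have "\<forall>\<^sub>F t in at 0. norm (f (x + t *\<^sub>R i) - f x - t *\<^sub>R f' i) / norm t =
      norm ((f (x + t *\<^sub>R i) - f x) /\<^sub>R t - f' i)"
    unfolding eventually_at_filter
  proof (intro always_eventually allI impI)
    fix t :: real assume t: "t \<noteq> 0"
    have "f (x + t *\<^sub>R i) - f x - t *\<^sub>R f' i = t *\<^sub>R ((f (x + t *\<^sub>R i) - f x) /\<^sub>R t - f' i)"
      using t by (simp add: scaleR_right_diff_distrib)
    then show "norm (f (x + t *\<^sub>R i) - f x - t *\<^sub>R f' i) / norm t =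
      norm ((f (x + t *\<^sub>R i) - f x) /\<^sub>R t - f' i)" using t by simp
  qed
  ultimately have "((\<lambda>t. norm ((f (x + t *\<^sub>R i) - f x) /\<^sub>R t - f' i)) \<longlongrightarrow> 0) (at 0)"
    by (rule Lim_transform_eventually)
  then show ?thesis by (simp add: tendsto_norm_zero_iff flip: LIM_zero_iff[of _ "f' i"])
qed

text \<open>Discrete integration by parts: translation invariance moves the difference quotient from
  the test function to \<open>f\<close>, and dominated convergence passes to the limit on both
  sides. The local Lipschitz bound dominates the quotients of \<open>f\<close>, so their limit has
  to exist only almost everywhere.\<close>

lemma integral_by_parts_lipschitz:
  fixes f f' :: "'a::euclidean_space \<Rightarrow> real"
  assumes lip: "\<And>B. \<exists>L\<ge>0. \<forall>x\<in>cball 0 B. \<forall>y\<in>cball 0 B. \<bar>f x - f y\<bar> \<le> L * norm (x - y)"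
    and i: "i \<in> Basis" and [measurable]: "f' \<in> borel_measurable borel"
    and N: "N \<in> null_sets lborel"
    and f': "\<And>x. x \<notin> N \<Longrightarrow> ((\<lambda>t. (f (x + t *\<^sub>R i) - f x) / t) \<longlongrightarrow> f' x) (at 0)"
    and test: "test_fun UNIV \<phi>"
  shows "(\<integral>x. f x * frechet_derivative \<phi> (at x) i \<partial>lborel) = - (\<integral>x. f' x * \<phi> x \<partial>lborel)"
proof -
  have sm: "smooth_fun \<phi>" using test by (simp add: test_fun_def)
  obtain B where B: "B > 0" "\<And>x. norm x \<ge> B \<Longrightarrow> \<phi> x = 0"
    "\<And>x i. norm x \<ge> B \<Longrightarrow> frechet_derivative \<phi> (at x) i = 0"
    using test_fun_support[OF test] by blast
  obtain M where M: "M > 0" "\<And>x. \<bar>\<phi> x\<bar> \<le> M"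
    "\<And>x i. i \<in> Basis \<Longrightarrow> \<bar>frechet_derivative \<phi> (at x) i\<bar> \<le> M"
    using test_fun_bounds[OF test] by blast
  let ?\<phi>' = "\<lambda>x. frechet_derivative \<phi> (at x) i"
  have cont: "continuous_on UNIV f"
  proof (rule continuous_at_imp_continuous_on, rule ballI)
    fix x :: 'a
    obtain L where "L \<ge> 0" "\<forall>y\<in>cball 0 (norm x + 1). \<forall>z\<in>cball 0 (norm x + 1). \<bar>f y - f z\<bar> \<le> L * norm (y - z)"
      using lip by blast
    then have "continuous_on (cball 0 (norm x + 1)) f"
      by (intro lipschitz_on_continuous_on[of L]) (auto simp: lipschitz_on_def dist_norm)
    then have "continuous_on (ball 0 (norm x + 1)) f" by (rule continuous_on_subset) auto
    then show "isCont f x" by (simp add: continuous_on_eq_continuous_at)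
  qed
  have [measurable]: "f \<in> borel_measurable borel" "\<phi> \<in> borel_measurable borel" "?\<phi>' \<in> borel_measurable borel"
    using cont smooth_funD(2,4)[OF sm] i by (auto intro: borel_measurable_continuous_onI)
  define t where "t n = 1 / real (Suc n)" for n
  have t: "t n > 0" "t n \<le> 1" for n by (auto simp: t_def)
  have t0: "t \<longlonglongrightarrow> 0" unfolding t_def using LIMSEQ_inverse_real_of_nat by (simp add: inverse_eq_divide)
  have t0': "filterlim t (at 0) sequentially"
    using t0 t(1) by (auto simp: filterlim_at less_imp_neq[symmetric])
  have tm: "filterlim (\<lambda>n. - t n) (at 0) sequentially"
    using tendsto_minus[OF t0] t(1) by (auto simp: filterlim_at less_imp_neq[symmetric])
  \<comment> \<open>The steps \<open>t n\<close> are at most 1, so shifting a point of the ball of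
    radius \<open>B\<close> keeps it within radius \<open>B + 1\<close>.\<close>
  obtain L where L: "L \<ge> 0" "\<And>x y. norm x \<le> B + 1 \<Longrightarrow> norm y \<le> B + 1 \<Longrightarrow> \<bar>f x - f y\<bar> \<le> L * norm (x - y)"
    using lip[of "B + 1"] by auto
  define C0 where "C0 = \<bar>f 0\<bar> + L * (B + 1)"
  have nn: "0 \<le> C0" using L B by (simp add: C0_def)
  have fb: "\<bar>f x\<bar> \<le> C0" if "norm x \<le> B + 1" for x
  proof -
    have "\<bar>f x - f 0\<bar> \<le> L * norm (x - 0)" using L(2)[of x 0] that B(1) by simp
    also have "\<dots> \<le> L * (B + 1)" using that L by (intro mult_left_mono) auto
    finally show ?thesis by (simp add: C0_def)
  qed
  have ni: "norm i = 1" using i by simp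
  have shift: "norm x \<le> B + 1" if "norm y \<le> B" "norm (x - y) \<le> 1" for x y :: 'a
    using norm_triangle_sub[of x y] that by linarith
  have zero: "\<phi> (x + t n *\<^sub>R i) = 0" "\<phi> x = 0" if "norm x > B + 1" for x n
  proof -
    show "\<phi> (x + t n *\<^sub>R i) = 0"
      using shift[of "x + t n *\<^sub>R i" x] that t[of n] ni by (intro B(2)) force
    show "\<phi> x = 0" using that by (intro B(2)) auto
  qed
  have int: "integrable lborel (\<lambda>x. C * indicator (cball 0 (B + 1)) x)" for C :: real
    by (intro integrable_mult_right integrable_real_indicator emeasure_bounded_finite) auto
  have 1: "(\<lambda>n. \<integral>x. f x * ((\<phi> (x + t n *\<^sub>R i) - \<phi> x) / t n) \<partial>lborel) \<longlonglongrightarrow> (\<integral>x. f x * ?\<phi>' x \<partial>lborel)"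
  proof (rule integral_dominated_convergence[OF _ _ int[of "C0 * M"]])
    show "AE x in lborel. (\<lambda>n. f x * ((\<phi> (x + t n *\<^sub>R i) - \<phi> x) / t n)) \<longlonglongrightarrow> f x * ?\<phi>' x"
    proof (intro AE_I2 tendsto_mult tendsto_const)
      fix x
      have "((\<lambda>s. (\<phi> (x + s *\<^sub>R i) - \<phi> x) / s) \<longlongrightarrow> ?\<phi>' x) (at 0)"
        using has_derivative_difference_quotient[OF smooth_funD(1)[OF sm], of x i]
        by (simp add: divide_inverse mult.commute)
      then show "(\<lambda>n. (\<phi> (x + t n *\<^sub>R i) - \<phi> x) / t n) \<longlonglongrightarrow> ?\<phi>' x"
        by (rule filterlim_compose[OF _ t0'])
    qed
    show "AE x in lborel. norm (f x * ((\<phi> (x + t n *\<^sub>R i) - \<phi> x) / t n))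
        \<le> C0 * M * indicator (cball 0 (B + 1)) x" for n
    proof (intro AE_I2)
      fix x
      show "norm (f x * ((\<phi> (x + t n *\<^sub>R i) - \<phi> x) / t n))
        \<le> C0 * M * indicator (cball 0 (B + 1)) x"
      proof (cases "norm x \<le> B + 1")
        case True
        have "\<bar>\<phi> (x + t n *\<^sub>R i) - \<phi> x\<bar> / t n \<le> M"
          using test_fun_difference_bound[OF sm i M(3)[OF i], of x "t n"] t[of n] by (simp add: divide_le_eq)
        then have "\<bar>f x\<bar> * (\<bar>\<phi> (x + t n *\<^sub>R i) - \<phi> x\<bar> / t n) \<le> C0 * M"
          using fb[OF True] t[of n] nn by (intro mult_mono) auto
        then show ?thesis using True t[of n] by (simp add: abs_mult)
      next
        case False
        then show ?thesis using zero(1)[of x n] zero(2)[of x] by simp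
      qed
    qed
  qed measurable
  \<comment> \<open>The quotient of \<open>f\<close> takes its increment at x - t i but is divided
    by + t; hence the limit \<open>- f'\<close> and the sequence \<open>- t n\<close> in the filter
    argument.\<close>
  have 2: "(\<lambda>n. \<integral>x. (f (x + (- t n) *\<^sub>R i) - f x) / t n * \<phi> x \<partial>lborel) \<longlonglongrightarrow> (\<integral>x. - f' x * \<phi> x \<partial>lborel)"
  proof (rule integral_dominated_convergence[OF _ _ int[of "L * M"]])
    have "AE x in lborel. x \<notin> N" using N by (rule AE_not_in)
    then show "AE x in lborel. (\<lambda>n. (f (x + (- t n) *\<^sub>R i) - f x) / t n * \<phi> x) \<longlonglongrightarrow> - f' x * \<phi> x"
    proof eventually_elim
      case (elim x)
      have "(\<lambda>n. - ((f (x + (- t n) *\<^sub>R i) - f x) / (- t n))) \<longlonglongrightarrow> - f' x"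
        by (intro tendsto_minus filterlim_compose[OF f'[OF elim] tm])
      then show ?case by (intro tendsto_mult tendsto_const) simp
    qed
    show "AE x in lborel. norm ((f (x + (- t n) *\<^sub>R i) - f x) / t n * \<phi> x)
        \<le> L * M * indicator (cball 0 (B + 1)) x" for n
    proof (intro AE_I2)
      fix x
      show "norm ((f (x + (- t n) *\<^sub>R i) - f x) / t n * \<phi> x) \<le> L * M * indicator (cball 0 (B + 1)) x"
      proof (cases "norm x \<le> B")
        case True
        then have "norm (x + (- t n) *\<^sub>R i) \<le> B + 1" using shift[OF True] t[of n] ni by simp
        then have "\<bar>f (x + (- t n) *\<^sub>R i) - f x\<bar> \<le> L * norm (x + (- t n) *\<^sub>R i - x)"
          using True by (intro L) auto
        also have "\<dots> = L * t n" using ni t[of n] by simp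
        finally have "\<bar>f (x + (- t n) *\<^sub>R i) - f x\<bar> / t n \<le> L" using t[of n] by (simp add: divide_le_eq)
        then have "\<bar>f (x + (- t n) *\<^sub>R i) - f x\<bar> / t n * \<bar>\<phi> x\<bar> \<le> L * M"
          using M L by (intro mult_mono) auto
        then show ?thesis using True t[of n] by (simp add: abs_mult)
      next
        case False
        then show ?thesis using B(2)[of x] L M by simp
      qed
    qed
  qed measurable
  have 3: "(\<integral>x. f x * ((\<phi> (x + t n *\<^sub>R i) - \<phi> x) / t n) \<partial>lborel) =
      (\<integral>x. (f (x + (- t n) *\<^sub>R i) - f x) / t n * \<phi> x \<partial>lborel)" for n
  proof -
    have bd: "integrable lborel h" if [measurable]: "h \<in> borel_measurable borel"
      and "\<And>x. norm x > B + 1 \<Longrightarrow> h x = 0" and "\<And>x. norm x \<le> B + 1 \<Longrightarrow> \<bar>h x\<bar> \<le> C" for h :: "'a \<Rightarrow> real" and C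
    proof (rule Bochner_Integration.integrable_bound[OF int[of C]])
      show "AE x in lborel. norm (h x) \<le> norm (C * indicator (cball 0 (B + 1)) x)"
        using that(2,3) by (intro AE_I2) (auto simp: indicator_def dist_norm not_le intro: order_trans[OF _ abs_ge_self])
    qed measurable
    let ?C = "C0 * M"
    have i1: "integrable lborel (\<lambda>x. f x * \<phi> (x + t n *\<^sub>R i))"
      by (rule bd[of _ ?C]) (use zero fb M nn in \<open>auto simp: abs_mult intro!: mult_mono\<close>)
    have i2: "integrable lborel (\<lambda>x. f x * \<phi> x)"
      by (rule bd[of _ ?C]) (use zero fb M nn in \<open>auto simp: abs_mult intro!: mult_mono\<close>)
    have fb': "\<bar>f (x + (- t n) *\<^sub>R i) * \<phi> x\<bar> \<le> ?C" for x
    proof (cases "norm x \<le> B")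
      case True
      then have "norm (x + (- t n) *\<^sub>R i) \<le> B + 1" using shift[OF True] t[of n] ni by simp
      then show ?thesis using fb[of "x + (- t n) *\<^sub>R i"] M unfolding abs_mult by (intro mult_mono) auto
    next
      case False
      then show ?thesis using B M nn by simp
    qed
    have i3: "integrable lborel (\<lambda>x. f (x + (- t n) *\<^sub>R i) * \<phi> x)"
      by (rule bd[of _ ?C]) (use zero fb' in auto)
    have "(\<integral>x. f x * ((\<phi> (x + t n *\<^sub>R i) - \<phi> x) / t n) \<partial>lborel) =
      (\<integral>x. (f x * \<phi> (x + t n *\<^sub>R i) - f x * \<phi> x) / t n \<partial>lborel)"
      by (simp add: algebra_simps diff_divide_distrib)
    also have "\<dots> = ((\<integral>x. f x * \<phi> (x + t n *\<^sub>R i) \<partial>lborel) - (\<integral>x. f x * \<phi> x \<partial>lborel)) / t n"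
      using i1 i2 by simp
    \<comment> \<open>Substituting x - t i for x is the summation by parts.\<close>
    also have "(\<integral>x. f x * \<phi> (x + t n *\<^sub>R i) \<partial>lborel) = (\<integral>x. f (x + (- t n) *\<^sub>R i) * \<phi> x \<partial>lborel)"
      using lborel_integral_translate[of "\<lambda>x. f x * \<phi> (x + t n *\<^sub>R i)" "- t n *\<^sub>R i"] by (simp add: add.commute)
    also have "(\<dots> - (\<integral>x. f x * \<phi> x \<partial>lborel)) / t n =
       (\<integral>x. (f (x + (- t n) *\<^sub>R i) * \<phi> x - f x * \<phi> x) / t n \<partial>lborel)"
      using i2 i3 by simp
    also have "\<dots> = (\<integral>x. (f (x + (- t n) *\<^sub>R i) - f x) / t n * \<phi> x \<partial>lborel)"
      by (simp add: algebra_simps diff_divide_distrib)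
    finally show ?thesis .
  qed
  have "(\<integral>x. f x * ?\<phi>' x \<partial>lborel) = (\<integral>x. - f' x * \<phi> x \<partial>lborel)"
    by (rule LIMSEQ_unique[OF 1[unfolded 3] 2])
  then show ?thesis by simp
qed

section \<open>Mollification\<close>

text \<open>The flat function exp(-1/t), multiplied by a polynomial in 1/t. The polynomial is a
  parameter because all derivatives then stay in the same family, also at t = 0.\<close>

definition exp_bump :: "real poly \<Rightarrow> real \<Rightarrow> real" where
  "exp_bump q t = (if t > 0 then poly q (1 / t) * exp (- (1 / t)) else 0)"

lemma poly_times_exp_tendsto_0: "((\<lambda>s::real. poly q s * exp (- s)) \<longlongrightarrow> 0) at_top"
proof -
  have "((\<lambda>s::real. \<Sum>i\<le>degree q. coeff q i * (s ^ i / exp s)) \<longlongrightarrow> (\<Sum>i\<le>degree q. coeff q i * 0)) at_top"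
    by (intro tendsto_intros tendsto_power_div_exp_0)
  then show ?thesis
    by (simp add: poly_altdef exp_minus sum_distrib_right divide_inverse mult.assoc)
qed

text \<open>The factor \<open>[:0, 0, 1:]\<close> is the polynomial X^2: differentiating 1/t gives
  -1/t^2, which acts on \<open>q\<close> and on the exponential with opposite signs. At 0 the
  exponential beats every power of 1/t.\<close>

lemma DERIV_exp_bump:
  "(exp_bump q has_real_derivative exp_bump ([:0, 0, 1:] * (q - pderiv q)) t) (at t)"
proof -
  consider "t > 0" | "t < 0" | "t = 0" by linarith
  then show ?thesis
  proof cases
    case 1
    have "((\<lambda>t. poly q (1 / t) * exp (- (1 / t))) has_real_derivative
        exp_bump ([:0, 0, 1:] * (q - pderiv q)) t) (at t)"
      using 1 by (auto intro!: derivative_eq_intros DERIV_chain'[OF _ poly_DERIV]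
          simp: exp_bump_def algebra_simps power2_eq_square)
    then show ?thesis
      by (rule has_field_derivative_transform_within_open[of _ _ _ "{0<..}"])
        (use 1 in \<open>auto simp: exp_bump_def\<close>)
  next
    case 2
    have "((\<lambda>t. 0) has_real_derivative exp_bump ([:0, 0, 1:] * (q - pderiv q)) t) (at t)"
      using 2 by (simp add: exp_bump_def)
    then show ?thesis
      by (rule has_field_derivative_transform_within_open[of _ _ _ "{..<0}"])
        (use 2 in \<open>auto simp: exp_bump_def\<close>)
  next
    case 3
    \<comment> \<open>\<open>pCons 0 q\<close> is X q: dividing by h contributes one more power of
      1/h.\<close>
    have "((\<lambda>h. poly (pCons 0 q) (inverse h) * exp (- inverse h)) \<longlongrightarrow> 0) (at_right 0)"
      by (rule filterlim_compose[OF poly_times_exp_tendsto_0 filterlim_inverse_at_top_right])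
    then have "((\<lambda>h. exp_bump q h / h) \<longlongrightarrow> 0) (at_right 0)"
      by (rule Lim_transform_eventually)
        (auto simp: eventually_at_right_field exp_bump_def divide_inverse mult_ac intro!: exI[of _ 1])
    moreover have "((\<lambda>h. exp_bump q h / h) \<longlongrightarrow> 0) (at_left 0)"
      by (rule Lim_transform_eventually[OF tendsto_const])
        (auto simp: eventually_at_left_field exp_bump_def intro!: exI[of _ "-1"])
    ultimately have "((\<lambda>h. exp_bump q h / h) \<longlongrightarrow> 0) (at 0)"
      by (intro filterlim_split_at)
    then show ?thesis using 3 by (simp add: DERIV_def exp_bump_def)
  qed
qed

text \<open>An invariant for coinduction on \<open>smooth_fun\<close>: the class is closed under
  partial derivatives, because the gradient of a radial bump is another radial bump times a multiple
  of x - a. Here \<open>e\<close> plays the role of the squared radius.\<close>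

inductive bump_algebra :: "'a::euclidean_space \<Rightarrow> real \<Rightarrow> ('a \<Rightarrow> real) \<Rightarrow> bool" for a e where
  const: "bump_algebra a e (\<lambda>x. c)"
| lin: "bump_algebra a e (\<lambda>x. (x - a) \<bullet> i)"
| bump: "bump_algebra a e (\<lambda>x. exp_bump q (e - (x - a) \<bullet> (x - a)))"
| add: "bump_algebra a e f \<Longrightarrow> bump_algebra a e g \<Longrightarrow> bump_algebra a e (\<lambda>x. f x + g x)"
| mult: "bump_algebra a e f \<Longrightarrow> bump_algebra a e g \<Longrightarrow> bump_algebra a e (\<lambda>x. f x * g x)"

lemma exp_bump_radial_derivative:
  "((\<lambda>x. exp_bump q (e - (x - a) \<bullet> (x - a))) has_derivative
     (\<lambda>h. exp_bump ([:0, 0, 1:] * (q - pderiv q)) (e - (x - a) \<bullet> (x - a)) * (-2 * ((x - a) \<bullet> h)))) (at x)"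
proof -
  have "((\<lambda>x. e - (x - a) \<bullet> (x - a)) has_derivative (\<lambda>h. -2 * ((x - a) \<bullet> h))) (at x)"
    by (auto intro!: derivative_eq_intros simp: inner_commute)
  from has_derivative_compose[OF this DERIV_exp_bump[unfolded has_field_derivative_def]]
  show ?thesis .
qed

lemma bump_algebra_derivative:
  assumes "bump_algebra a e f"
  shows "\<exists>f'. (\<forall>x. (f has_derivative f' x) (at x)) \<and> (\<forall>i. bump_algebra a e (\<lambda>x. f' x i))"
  using assms
proof induction
  case (const c)
  show ?case by (rule exI[of _ "\<lambda>x h. 0"]) (auto intro: bump_algebra.const)
next
  case (lin i)
  show ?case by (rule exI[of _ "\<lambda>x h. h \<bullet> i"]) (auto intro!: bump_algebra.const derivative_eq_intros)
next
  case (bump q)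
  show ?case
    by (rule exI[of _ "\<lambda>x h. exp_bump ([:0, 0, 1:] * (q - pderiv q)) (e - (x - a) \<bullet> (x - a)) * (-2 * ((x - a) \<bullet> h))"])
      (intro conjI allI exp_bump_radial_derivative bump_algebra.intros)
next
  case (add f g)
  then obtain f' g' where "\<And>x. (f has_derivative f' x) (at x)" "\<And>i. bump_algebra a e (\<lambda>x. f' x i)"
    "\<And>x. (g has_derivative g' x) (at x)" "\<And>i. bump_algebra a e (\<lambda>x. g' x i)" by blast
  then show ?case
    by (intro exI[of _ "\<lambda>x h. f' x h + g' x h"]) (simp add: has_derivative_add bump_algebra.add)
next
  case (mult f g)
  then obtain f' g' where "\<And>x. (f has_derivative f' x) (at x)" "\<And>i. bump_algebra a e (\<lambda>x. f' x i)"
    "\<And>x. (g has_derivative g' x) (at x)" "\<And>i. bump_algebra a e (\<lambda>x. g' x i)" by blast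
  with mult.hyps show ?case
    by (intro exI[of _ "\<lambda>x h. f x * g' x h + f' x h * g x"])
      (simp add: has_derivative_mult bump_algebra.add bump_algebra.mult)
qed

lemma smooth_fun_bump_algebra:
  assumes "bump_algebra a e f" shows "smooth_fun f"
  using assms
proof (coinduction arbitrary: f)
  case smooth_fun
  then obtain f' where f': "\<And>x. (f has_derivative f' x) (at x)" "\<And>i. bump_algebra a e (\<lambda>x. f' x i)"
    using bump_algebra_derivative by blast
  have "frechet_derivative f (at x) = f' x" for x
    using frechet_derivative_at[OF f'(1)] by simp
  then show ?case using f' by (auto simp: differentiable_def)
qed

text \<open>\<open>Gk\<close> is the gradient of the kernel, kept as a vector field so that it can
  be integrated. Smoothness is asked for the reflected translate because that function of
  \<open>z\<close> serves as a test function.\<close>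

locale mollifier =
  fixes e :: real and k :: "'a::euclidean_space \<Rightarrow> real" and Gk :: "'a \<Rightarrow> 'a"
  assumes e_pos: "e > 0" and k_nonneg: "k x \<ge> 0" and k_zero: "norm x \<ge> e \<Longrightarrow> k x = 0"
    and k_cont: "continuous_on UNIV k"
    and k_int: "integrable lborel k" "(\<integral>x. k x \<partial>lborel) = 1"
    and k_deriv: "(k has_derivative (\<lambda>h. Gk x \<bullet> h)) (at x)"
    and Gk_cont: "continuous_on UNIV Gk" and Gk_zero: "norm x \<ge> e \<Longrightarrow> Gk x = 0"
    and k_smooth: "smooth_fun (\<lambda>z. k (a - z))"

lemma mollifier_exists:
  assumes e: "e > 0" shows "\<exists>k G. mollifier e k (G :: 'a::euclidean_space \<Rightarrow> 'a)"
proof -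
  define b where "b x = exp_bump 1 (e\<^sup>2 - x \<bullet> x)" for x :: 'a
  define B where "B x = (exp_bump [:0, 0, 1:] (e\<^sup>2 - x \<bullet> x) * (-2)) *\<^sub>R x" for x :: 'a
  have zero: "e\<^sup>2 - x \<bullet> x \<le> 0" if "norm x \<ge> e" for x :: 'a
    using power_mono[OF that, of 2] e by (simp add: power2_norm_eq_inner)
  have b0: "b x = 0" "B x = 0" if "norm x \<ge> e" for x
    using zero[OF that] by (auto simp: b_def B_def exp_bump_def)
  have bpos: "b x > 0" if "norm x < e" for x
    using power_strict_mono[OF that, of 2] e by (simp add: b_def exp_bump_def power2_norm_eq_inner)
  have bnn: "b x \<ge> 0" for x using b0 bpos by (metis less_eq_real_def not_le)
  have b': "(b has_derivative (\<lambda>h. B x \<bullet> h)) (at x)" for x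
    using exp_bump_radial_derivative[of 1 "e\<^sup>2" 0 x]
    by (simp add: b_def[abs_def] B_def pderiv_1 mult.assoc)
  have contb: "continuous_on UNIV b"
    by (rule continuous_at_imp_continuous_on) (auto intro: has_derivative_continuous[OF b'])
  have "continuous_on UNIV (exp_bump q)" for q
    by (rule continuous_at_imp_continuous_on) (auto intro: DERIV_isCont[OF DERIV_exp_bump])
  then have "continuous_on UNIV (\<lambda>x::'a. exp_bump q (e\<^sup>2 - x \<bullet> x))" for q
    by (rule continuous_on_compose2) (auto intro!: continuous_intros)
  from this[of "[:0, 0, 1:]"] have contB: "continuous_on UNIV B" unfolding B_def
    by (intro continuous_intros)
  have intb: "integrable lborel b"
  proof -
    have "integrable lborel (\<lambda>x. indicator (cball 0 e) x *\<^sub>R b x)"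
      by (rule borel_integrable_compact) (auto intro: continuous_on_subset[OF contb])
    also have "(\<lambda>x. indicator (cball 0 e) x *\<^sub>R b x) = b"
      using b0 by (fastforce simp: indicator_def)
    finally show ?thesis .
  qed
  define I where "I = (\<integral>x. b x \<partial>lborel)"
  \<comment> \<open>A zero integral would make the nonnegative bump vanish almost everywhere, but it
    is positive on a ball of positive measure.\<close>
  have "I \<noteq> 0"
  proof
    assume "I = 0"
    then have "AE x in lborel. b x = 0"
      using integral_nonneg_eq_0_iff_AE[OF intb] bnn by (simp add: I_def)
    then have "AE x in lborel. x \<notin> ball (0::'a) e"
    proof eventually_elim
      case (elim x)
      then show ?case using bpos[of x] by auto
    qed
    then have "emeasure lborel (ball (0::'a) e) = 0"
      by (subst (asm) AE_iff_measurable[of "ball 0 e"]) auto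
    then show False using e unit_ball_vol_pos[of "real DIM('a)"] by (simp add: emeasure_ball)
  qed
  moreover have "I \<ge> 0" unfolding I_def using bnn by simp
  ultimately have I: "I > 0" by simp
  have "mollifier e (\<lambda>x. b x / I) (\<lambda>x. B x /\<^sub>R I)"
  proof
    show "smooth_fun (\<lambda>z. b (a - z) / I)" for a
    proof (rule smooth_fun_bump_algebra)
      \<comment> \<open>The squared distance is symmetric, so the reflected translate is again a
        bump, now centred at \<open>a\<close>.\<close>
      have "(\<lambda>z. b (a - z) / I) = (\<lambda>z. (1 / I) * exp_bump 1 (e\<^sup>2 - (z - a) \<bullet> (z - a)))"
        by (auto simp: b_def inner_diff inner_commute algebra_simps)
      then show "bump_algebra a (e\<^sup>2) (\<lambda>z. b (a - z) / I)"
        by (simp only:) (intro bump_algebra.mult bump_algebra.const bump_algebra.bump)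
    qed
    show "((\<lambda>x. b x / I) has_derivative (\<lambda>h. (B x /\<^sub>R I) \<bullet> h)) (at x)" for x
      using I by (auto intro!: derivative_eq_intros b' simp: divide_inverse)
  qed (use e I b0 bnn contb contB intb in \<open>auto intro!: continuous_intros simp: I_def\<close>)
  then show ?thesis by blast
qed

text \<open>An indicator is reached through an open superset of nearly the same measure, whose
  indicator is the limit of truncated multiples of the distance to the complement; sums and
  dominated limits follow. A global Lipschitz constant is kept because the mollification error is
  measured by it.\<close>

lemma integrable_approx_lipschitz:
  fixes f :: "'a::euclidean_space \<Rightarrow> real"
  assumes "integrable lborel f"
  shows "\<forall>e>0. \<exists>h L. integrable lborel h \<and> L \<ge> 0 \<and> (\<forall>x y. \<bar>h x - h y\<bar> \<le> L * norm (x - y)) \<and>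
    (\<integral>x. \<bar>f x - h x\<bar> \<partial>lborel) < e"
  using assms
proof (induction rule: integrable_induct)
  case (base A c)
  show ?case
  proof (intro allI impI)
    fix e :: real assume e: "e > 0"
    \<comment> \<open>Two errors of size at most |c| e' are incurred; the added 1 covers c =
      0.\<close>
    define e' where "e' = e / (2 * (\<bar>c\<bar> + 1))"
    have e': "e' > 0" "2 * (\<bar>c\<bar> * e') < e" using e by (auto simp: e'_def field_simps)
    have A: "A \<in> sets borel" using base by simp
    obtain W where W: "open W" "A \<subseteq> W" "emeasure lborel (W - A) < ennreal e'"
      using outer_regular_lborel[OF A e'(1)] by auto
    have Ws: "W \<in> sets borel" using W by simp
    have fW: "emeasure lborel W < \<infinity>"
    proof -
      have "emeasure lborel W \<le> emeasure lborel A + emeasure lborel (W - A)"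
        using W A by (subst plus_emeasure) (auto intro!: emeasure_mono)
      also have "\<dots> < \<infinity>" using base(2) less_trans[OF W(3) ennreal_less_top] by simp
      finally show ?thesis .
    qed
    \<comment> \<open>\<open>infdist\<close> to the empty set is 0, so the whole space is treated
      separately.\<close>
    define h where "h n x = (if W = UNIV then 1 else min 1 (real n * infdist x (- W)))" for n x
    have h01: "0 \<le> h n x" "h n x \<le> 1" for n x by (auto simp: h_def infdist_nonneg)
    have hL: "\<bar>h n x - h n y\<bar> \<le> real n * norm (x - y)" for n x y
    proof (cases "W = UNIV")
      case False
      have "\<bar>infdist x (- W) - infdist y (- W)\<bar> \<le> dist x y"
        using infdist_triangle[of x "- W" y] infdist_triangle[of y "- W" x] by (simp add: dist_commute)
      then have "real n * \<bar>infdist x (- W) - infdist y (- W)\<bar> \<le> real n * norm (x - y)"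
        by (intro mult_left_mono) (auto simp: dist_norm)
      then have "\<bar>real n * infdist x (- W) - real n * infdist y (- W)\<bar> \<le> real n * norm (x - y)"
        by (simp add: abs_mult flip: right_diff_distrib)
      then show ?thesis using False unfolding h_def by (simp add: min_def; linarith)
    qed (simp add: h_def)
    have hout: "h n x = 0" if "x \<notin> W" for n x
      using that by (auto simp: h_def)
    have hlim: "(\<lambda>n. h n x) \<longlonglongrightarrow> indicator W x" for x
    proof (cases "x \<in> W \<and> W \<noteq> UNIV")
      case True
      then have "infdist x (- W) > 0"
        using W(1) in_closed_iff_infdist_zero[of "- W" x] infdist_nonneg[of x "- W"] by (auto simp: closed_def less_le)
      then obtain m where m: "real m * infdist x (- W) \<ge> 1"
        using reals_Archimedean3[of "infdist x (- W)"] less_imp_le by blast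
      have "h n x = 1" if "n \<ge> m" for n
      proof -
        have "real m * infdist x (- W) \<le> real n * infdist x (- W)"
          using that by (intro mult_right_mono) (auto simp: infdist_nonneg)
        then show ?thesis using m True by (simp add: h_def)
      qed
      then show ?thesis using True
        by (intro tendsto_eventually) (auto simp: eventually_sequentially)
    next
      case False
      then have "h n x = indicator W x" for n using hout[of x n] by (auto simp: h_def)
      then show ?thesis by simp
    qed
    have hm[measurable]: "h n \<in> borel_measurable borel" for n
      by (intro borel_measurable_continuous_onI lipschitz_on_continuous_on[of "real n"])
        (auto simp: lipschitz_on_def dist_norm hL)
    have indW: "integrable lborel (indicator W :: 'a \<Rightarrow> real)"
      using Ws fW by simp
    have "(\<lambda>n. \<integral>x. \<bar>indicator W x - h n x\<bar> \<partial>lborel) \<longlonglongrightarrow> (\<integral>x. 0 \<partial>(lborel :: 'a measure))"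
    proof (rule integral_dominated_convergence[OF _ _ indW])
      show "AE x in lborel. (\<lambda>n. \<bar>indicator W x - h n x\<bar>) \<longlonglongrightarrow> 0"
      proof (intro AE_I2)
        fix x
        show "(\<lambda>n. \<bar>indicator W x - h n x\<bar>) \<longlonglongrightarrow> 0"
          using tendsto_rabs[OF tendsto_diff[OF tendsto_const[of "indicator W x"] hlim[of x]]] by simp
      qed
      show "AE x in lborel. norm (\<bar>indicator W x - h n x\<bar>) \<le> indicator W x" for n
        using h01 hout by (intro AE_I2) (auto simp: indicator_def)
    qed (use Ws in measurable)
    then have "eventually (\<lambda>n. (\<integral>x. \<bar>indicator W x - h n x\<bar> \<partial>lborel) < e') sequentially"
      using e' by (auto intro: order_tendstoD)
    then obtain n where n: "(\<integral>x. \<bar>indicator W x - h n x\<bar> \<partial>lborel) < e'"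
      by (auto simp: eventually_sequentially)
    have hi: "integrable lborel (h n)"
      by (rule Bochner_Integration.integrable_bound[OF indW]) (use h01 hout in \<open>auto intro!: AE_I2 simp: indicator_def\<close>)
    have indA: "integrable lborel (indicator A :: 'a \<Rightarrow> real)" using base by simp
    have "(\<integral>x. \<bar>indicator A x *\<^sub>R c - h n x * c\<bar> \<partial>lborel) \<le>
      (\<integral>x. \<bar>c\<bar> * (indicator W x - indicator A x) + \<bar>c\<bar> * \<bar>indicator W x - h n x\<bar> \<partial>lborel)"
    proof (rule integral_mono)
      fix x :: 'a
      have "\<bar>indicator A x *\<^sub>R c - h n x * c\<bar> = \<bar>c\<bar> * \<bar>indicator A x - h n x\<bar>"
        by (simp add: abs_mult[symmetric] algebra_simps)
      also have "\<dots> \<le> \<bar>c\<bar> * ((indicator W x - indicator A x) + \<bar>indicator W x - h n x\<bar>)"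
        using W(2) by (intro mult_left_mono) (auto simp: indicator_def)
      finally show "\<bar>indicator A x *\<^sub>R c - h n x * c\<bar> \<le>
        \<bar>c\<bar> * (indicator W x - indicator A x) + \<bar>c\<bar> * \<bar>indicator W x - h n x\<bar>" by (simp add: algebra_simps)
    qed (use indA indW hi in \<open>auto intro!: integrable_diff integrable_abs\<close>)
    also have "\<dots> = \<bar>c\<bar> * ((\<integral>x. indicator W x - indicator A x \<partial>lborel) + (\<integral>x. \<bar>indicator W x - h n x\<bar> \<partial>lborel))"
      using indA indW hi by (simp add: algebra_simps)
    also have "\<dots> \<le> \<bar>c\<bar> * (e' + e')"
    proof (intro mult_left_mono add_mono)
      have "(\<integral>x. indicator W x - indicator A x \<partial>lborel) = (\<integral>x. indicator (W - A) x \<partial>(lborel :: 'a measure))"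
        using W(2) by (intro Bochner_Integration.integral_cong) (auto simp: indicator_def)
      also have "\<dots> = measure lborel (W - A)" by simp
      also have "\<dots> \<le> e'" using W(3) e' by (simp add: measure_def enn2real_leI)
      finally show "(\<integral>x. indicator W x - indicator A x \<partial>(lborel :: 'a measure)) \<le> e'" .
    qed (use n in auto)
    also have "\<dots> < e" using e' by simp
    finally show "\<exists>h L. integrable lborel h \<and> L \<ge> 0 \<and> (\<forall>x y. \<bar>h x - h y\<bar> \<le> L * norm (x - y)) \<and>
        (\<integral>x. \<bar>indicator A x *\<^sub>R c - h x\<bar> \<partial>lborel) < e"
    proof (intro exI[of _ "\<lambda>x. h n x * c"] exI[of _ "real n * \<bar>c\<bar>"] conjI allI)
      show "\<bar>h n x * c - h n y * c\<bar> \<le> real n * \<bar>c\<bar> * norm (x - y)" for x y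
        using mult_right_mono[OF hL[of n x y], of "\<bar>c\<bar>"] by (simp add: abs_mult[symmetric] algebra_simps)
    qed (use hi in auto)
  qed
next
  case (add f g)
  show ?case
  proof (intro allI impI)
    fix e :: real assume "e > 0"
    then obtain h L h' L' where h: "integrable lborel h" "L \<ge> 0" "\<And>x y. \<bar>h x - h y\<bar> \<le> L * norm (x - y)"
        "(\<integral>x. \<bar>f x - h x\<bar> \<partial>lborel) < e / 2"
      and h': "integrable lborel h'" "L' \<ge> 0" "\<And>x y. \<bar>h' x - h' y\<bar> \<le> L' * norm (x - y)"
        "(\<integral>x. \<bar>g x - h' x\<bar> \<partial>lborel) < e / 2"
      using add.IH by (meson half_gt_zero)
    have "(\<integral>x. \<bar>f x + g x - (h x + h' x)\<bar> \<partial>lborel) \<le> (\<integral>x. \<bar>f x - h x\<bar> + \<bar>g x - h' x\<bar> \<partial>lborel)"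
      using h h' add.hyps by (intro integral_mono) auto
    also have "\<dots> = (\<integral>x. \<bar>f x - h x\<bar> \<partial>lborel) + (\<integral>x. \<bar>g x - h' x\<bar> \<partial>lborel)"
      using h h' add.hyps by (intro Bochner_Integration.integral_add) auto
    also have "\<dots> < e" using h h' by simp
    finally show "\<exists>h L. integrable lborel h \<and> L \<ge> 0 \<and> (\<forall>x y. \<bar>h x - h y\<bar> \<le> L * norm (x - y)) \<and>
        (\<integral>x. \<bar>f x + g x - h x\<bar> \<partial>lborel) < e"
    proof (intro exI[of _ "\<lambda>x. h x + h' x"] exI[of _ "L + L'"] conjI allI)
      show "\<bar>h x + h' x - (h y + h' y)\<bar> \<le> (L + L') * norm (x - y)" for x y
        using h(3)[of x y] h'(3)[of x y] by (simp add: algebra_simps)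
    qed (use h h' in auto)
  qed
next
  case (lim f s)
  show ?case
  proof (intro allI impI)
    fix e :: real assume e: "e > 0"
    \<comment> \<open>The approximants satisfy |s i x| <= 2 |f x|, whence the dominating function 3
      |f|.\<close>
    have "(\<lambda>i. \<integral>x. \<bar>f x - s i x\<bar> \<partial>lborel) \<longlonglongrightarrow> (\<integral>x. 0 \<partial>(lborel :: 'a measure))"
    proof (rule integral_dominated_convergence[where w="\<lambda>x. 3 * norm (f x)"])
      have "(\<lambda>i. \<bar>f x - s i x\<bar>) \<longlonglongrightarrow> 0" for x
        using tendsto_rabs[OF tendsto_diff[OF tendsto_const[of "f x"] lim(2)[of x]]] by simp
      then show "AE x in lborel. (\<lambda>i. \<bar>f x - s i x\<bar>) \<longlonglongrightarrow> 0" by simp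
      show "AE x in lborel. norm \<bar>f x - s i x\<bar> \<le> 3 * norm (f x)" for i
        using lim(3)[of _ i] by (intro AE_I2) (smt (verit) real_norm_def space_lborel UNIV_I)
    qed (use lim in auto)
    then have "eventually (\<lambda>i. (\<integral>x. \<bar>f x - s i x\<bar> \<partial>lborel) < e / 2) sequentially"
      by (rule order_tendstoD) (use e in simp)
    then obtain i where i: "(\<integral>x. \<bar>f x - s i x\<bar> \<partial>lborel) < e / 2"
      by (auto simp: eventually_sequentially)
    obtain h L where h: "integrable lborel h" "L \<ge> 0" "\<And>x y. \<bar>h x - h y\<bar> \<le> L * norm (x - y)"
        "(\<integral>x. \<bar>s i x - h x\<bar> \<partial>lborel) < e / 2"
      using lim.IH e by (meson half_gt_zero)
    have "(\<integral>x. \<bar>f x - h x\<bar> \<partial>lborel) \<le> (\<integral>x. \<bar>f x - s i x\<bar> + \<bar>s i x - h x\<bar> \<partial>lborel)"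
      using h lim by (intro integral_mono) auto
    also have "\<dots> = (\<integral>x. \<bar>f x - s i x\<bar> \<partial>lborel) + (\<integral>x. \<bar>s i x - h x\<bar> \<partial>lborel)"
      using h lim by (intro Bochner_Integration.integral_add) auto
    also have "\<dots> < e" using h i by simp
    finally show "\<exists>h L. integrable lborel h \<and> L \<ge> 0 \<and> (\<forall>x y. \<bar>h x - h y\<bar> \<le> L * norm (x - y)) \<and>
        (\<integral>x. \<bar>f x - h x\<bar> \<partial>lborel) < e"
      using h by blast
  qed
qed

section \<open>Convolution with the kernel\<close>

context mollifier
begin

definition mollify :: "('a \<Rightarrow> real) \<Rightarrow> 'a \<Rightarrow> real" where
  "mollify f a = (\<integral>z. k (a - z) * f z \<partial>lborel)"

definition mollify_grad :: "('a \<Rightarrow> real) \<Rightarrow> 'a \<Rightarrow> 'a" where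
  "mollify_grad f a = (\<integral>z. f z *\<^sub>R Gk (a - z) \<partial>lborel)"

lemma k_measurable[measurable]: "k \<in> borel_measurable borel"
  and Gk_measurable[measurable]: "Gk \<in> borel_measurable borel"
  using k_cont Gk_cont by (auto intro: borel_measurable_continuous_onI)

lemma Gk_bounded: "\<exists>M>0. \<forall>x. norm (Gk x) \<le> M"
proof -
  have "bounded (Gk ` cball 0 e)"
    by (intro compact_imp_bounded compact_continuous_image) (auto intro: continuous_on_subset[OF Gk_cont])
  then obtain M where M: "M > 0" "\<forall>x\<in>cball 0 e. norm (Gk x) \<le> M"
    unfolding bounded_pos by auto
  have "norm (Gk x) \<le> M" for x using M Gk_zero[of x] by (cases "norm x \<le> e") auto
  then show ?thesis using M(1) by blast
qed

lemma k_lipschitz: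
  assumes M: "\<And>x. norm (Gk x) \<le> M" shows "\<bar>k x - k y\<bar> \<le> M * norm (x - y)"
proof -
  have "norm (k x - k y) \<le> M * norm (x - y)"
  proof (rule differentiable_bound[of UNIV])
    show "onorm (\<lambda>h. Gk z \<bullet> h) \<le> M" for z
    proof (rule onorm_le)
      fix h
      have "norm (Gk z \<bullet> h) \<le> norm (Gk z) * norm h" using Cauchy_Schwarz_ineq2 by auto
      also have "\<dots> \<le> M * norm h" by (intro mult_right_mono M) auto
      finally show "norm (Gk z \<bullet> h) \<le> M * norm h" .
    qed
  qed (use k_deriv in \<open>auto intro: has_derivative_at_withinI\<close>)
  then show ?thesis by simp
qed

lemma k_bounded: "\<exists>M>0. \<forall>x. k x \<le> M"
proof -
  obtain M where M: "M > 0" "\<And>x. norm (Gk x) \<le> M" using Gk_bounded by blast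
  define c where "c = k 0 + M * e"
  have "k x \<le> c" for x
  proof (cases "norm x \<le> e")
    case True
    have "\<bar>k x - k 0\<bar> \<le> M * norm (x - 0)" by (rule k_lipschitz[OF M(2)])
    also have "\<dots> \<le> M * e" using True M(1) by simp
    finally show ?thesis by (simp add: c_def)
  next
    case False
    then have "k x = 0" by (intro k_zero) simp
    then show ?thesis using k_nonneg[of 0] M(1) e_pos by (simp add: c_def)
  qed
  moreover have "c > 0" using k_nonneg[of 0] M(1) e_pos by (simp add: c_def add_nonneg_pos)
  ultimately show ?thesis by blast
qed

text \<open>Uniform continuity on a slightly larger ball extends to the whole space: when one point
  leaves that ball, a neighbour within distance 1 is already where \<open>Gk\<close>
  vanishes.\<close>

lemma Gk_uniform:
  assumes "c > 0" shows "\<exists>d>0. \<forall>x y. norm (x - y) < d \<longrightarrow> norm (Gk x - Gk y) \<le> c"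
proof -
  have "uniformly_continuous_on (cball 0 (e + 1)) Gk"
    by (intro compact_uniformly_continuous continuous_on_subset[OF Gk_cont]) auto
  then obtain d where d: "d > 0" "\<And>x y. x \<in> cball 0 (e + 1) \<Longrightarrow> y \<in> cball 0 (e + 1) \<Longrightarrow>
     dist y x < d \<Longrightarrow> dist (Gk y) (Gk x) < c"
    unfolding uniformly_continuous_on_def using assms by metis
  have "norm (Gk x - Gk y) \<le> c" if xy: "norm (x - y) < min d 1" for x y
  proof (cases "norm x \<le> e + 1 \<and> norm y \<le> e + 1")
    case True
    then show ?thesis using d(2)[of y x] xy by (auto simp: dist_norm)
  next
    case False
    then have "norm x \<ge> e" "norm y \<ge> e"
      using xy norm_triangle_sub[of x y] norm_triangle_sub[of y x] by (auto simp: norm_minus_commute)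
    then show ?thesis using Gk_zero[of x] Gk_zero[of y] assms by simp
  qed
  then show ?thesis using d(1) by (intro exI[of _ "min d 1"]) auto
qed

lemma k_linearization:
  assumes d: "\<And>x y. norm (x - y) < d \<Longrightarrow> norm (Gk x - Gk y) \<le> c" and h: "norm h < d"
  shows "\<bar>k (x + h) - k x - Gk x \<bullet> h\<bar> \<le> norm h * c"
proof -
  have d0: "d > 0" using h norm_ge_zero[of h] by linarith
  have "norm (k (x + h) - k x - Gk x \<bullet> (x + h - x)) \<le> norm (x + h - x) * c"
  proof (rule differentiable_bound_linearization[where S="ball x d" and f'="\<lambda>y h. Gk y \<bullet> h"])
    fix t :: real assume t: "t \<in> {0..1}"
    have "\<bar>t\<bar> * norm h \<le> 1 * norm h" using t by (intro mult_right_mono) auto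
    then show "x + t *\<^sub>R (x + h - x) \<in> ball x d" using h by (simp add: dist_norm)
  next
    fix y assume "y \<in> ball x d"
    then have le: "norm (Gk y - Gk x) \<le> c" by (intro d) (auto simp: dist_norm norm_minus_commute)
    show "onorm ((\<lambda>h. Gk y \<bullet> h) - (\<lambda>h. Gk x \<bullet> h)) \<le> c"
      unfolding fun_diff_def
    proof (rule onorm_le)
      fix h
      have "norm (Gk y \<bullet> h - Gk x \<bullet> h) = \<bar>(Gk y - Gk x) \<bullet> h\<bar>" by (simp add: inner_diff_left)
      also have "\<dots> \<le> norm (Gk y - Gk x) * norm h" by (rule Cauchy_Schwarz_ineq2)
      also have "\<dots> \<le> c * norm h" by (intro mult_right_mono le) auto
      finally show "norm (Gk y \<bullet> h - Gk x \<bullet> h) \<le> c * norm h" .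
    qed
  qed (use k_deriv d0 in \<open>auto intro: has_derivative_at_withinI\<close>)
  then show ?thesis by simp
qed

lemma mollify_integrable:
  assumes f: "integrable lborel f"
  shows "integrable lborel (\<lambda>z. k (a - z) * f z)"
proof -
  have [measurable]: "f \<in> borel_measurable borel" using f by simp
  obtain M where M: "M > 0" "\<And>x. k x \<le> M" using k_bounded by blast
  show ?thesis
  proof (rule Bochner_Integration.integrable_bound)
    show "integrable lborel (\<lambda>z. M * f z)" using f by simp
    show "AE z in lborel. norm (k (a - z) * f z) \<le> norm (M * f z)"
      using M k_nonneg by (intro AE_I2) (auto simp: abs_mult intro!: mult_right_mono)
  qed measurable
qed

lemma mollify_grad_integrable:
  assumes f: "integrable lborel f"
  shows "integrable lborel (\<lambda>z. f z *\<^sub>R Gk (a - z))"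
proof -
  have [measurable]: "f \<in> borel_measurable borel" using f by simp
  obtain M where M: "M > 0" "\<And>x. norm (Gk x) \<le> M" using Gk_bounded by blast
  show ?thesis
  proof (rule Bochner_Integration.integrable_bound)
    show "integrable lborel (\<lambda>z. M * f z)" using f by simp
    show "AE z in lborel. norm (f z *\<^sub>R Gk (a - z)) \<le> norm (M * f z)"
      using M by (intro AE_I2) (auto simp: abs_mult mult.commute[of M] intro!: mult_left_mono)
  qed measurable
qed

lemma mollify_lipschitz:
  assumes f: "integrable lborel f" and M: "\<And>x. norm (Gk x) \<le> M"
  shows "\<bar>mollify f a - mollify f b\<bar> \<le> (M * (\<integral>z. \<bar>f z\<bar> \<partial>lborel)) * norm (a - b)"
proof -
  note i = mollify_integrable[OF f]
  have "mollify f a - mollify f b = (\<integral>z. k (a - z) * f z - k (b - z) * f z \<partial>lborel)"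
    unfolding mollify_def using i by simp
  also have "\<bar>\<dots>\<bar> \<le> (\<integral>z. \<bar>k (a - z) * f z - k (b - z) * f z\<bar> \<partial>lborel)"
    by (rule integral_abs_bound)
  also have "\<dots> \<le> (\<integral>z. (M * norm (a - b)) * \<bar>f z\<bar> \<partial>lborel)"
  proof (rule integral_mono)
    fix z
    have "\<bar>k (a - z) * f z - k (b - z) * f z\<bar> = \<bar>k (a - z) - k (b - z)\<bar> * \<bar>f z\<bar>"
      by (simp add: abs_mult flip: left_diff_distrib)
    also have "\<dots> \<le> (M * norm (a - b)) * \<bar>f z\<bar>"
      using k_lipschitz[OF M, of "a - z" "b - z"] by (intro mult_right_mono) auto
    finally show "\<bar>k (a - z) * f z - k (b - z) * f z\<bar> \<le> (M * norm (a - b)) * \<bar>f z\<bar>" .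
  qed (use i f in auto)
  also have "\<dots> = (M * (\<integral>z. \<bar>f z\<bar> \<partial>lborel)) * norm (a - b)" by simp
  finally show ?thesis .
qed

text \<open>Differentiation under the integral sign: by \<open>k_linearization\<close> the
  first-order error of the kernel is small uniformly in its argument, so it may be integrated
  against |f|.\<close>

lemma mollify_has_derivative:
  assumes f: "integrable lborel f"
  shows "(mollify f has_derivative (\<lambda>h. mollify_grad f a \<bullet> h)) (at a)"
  unfolding has_derivative_at_alt
proof (intro conjI allI impI)
  show "bounded_linear (\<lambda>h. mollify_grad f a \<bullet> h)" by (rule bounded_linear_inner_right)
  fix c :: real assume c: "c > 0"
  define I where "I = (\<integral>z. \<bar>f z\<bar> \<partial>lborel)"
  have I: "I \<ge> 0" by (simp add: I_def)
  \<comment> \<open>Division by the L^1 norm of \<open>f\<close>, with 1 added to include f =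
    0.\<close>
  define c' where "c' = c / (I + 1)"
  have c': "c' > 0" "c' * I \<le> c" using c I by (auto simp: c'_def field_simps)
  obtain d where d: "d > 0" "\<And>x y. norm (x - y) < d \<Longrightarrow> norm (Gk x - Gk y) \<le> c'"
    using Gk_uniform[OF c'(1)] by blast
  show "\<exists>d>0. \<forall>b. norm (b - a) < d \<longrightarrow>
     norm (mollify f b - mollify f a - mollify_grad f a \<bullet> (b - a)) \<le> c * norm (b - a)"
  proof (intro exI[of _ d] conjI allI impI d(1))
    fix b assume b: "norm (b - a) < d"
    note i = mollify_integrable[OF f] mollify_grad_integrable[OF f]
    let ?F = "\<lambda>z. k (b - z) * f z - k (a - z) * f z - (f z *\<^sub>R Gk (a - z)) \<bullet> (b - a)"
    have i3: "integrable lborel (\<lambda>z. (f z *\<^sub>R Gk (a - z)) \<bullet> (b - a))"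
      by (rule integrable_inner_left) (rule i(2))
    have intF: "integrable lborel ?F"
      by (rule Bochner_Integration.integrable_diff[OF Bochner_Integration.integrable_diff[OF i(1) i(1)] i3])
    have eq: "mollify f b - mollify f a - mollify_grad f a \<bullet> (b - a) = (\<integral>z. ?F z \<partial>lborel)"
    proof -
      have "(\<integral>z. f z *\<^sub>R Gk (a - z) \<partial>lborel) \<bullet> (b - a) = (\<integral>z. (f z *\<^sub>R Gk (a - z)) \<bullet> (b - a) \<partial>lborel)"
        by (rule integral_inner_left[symmetric]) (rule i(2))
      then have "mollify f b - mollify f a - mollify_grad f a \<bullet> (b - a) =
        (\<integral>z. k (b - z) * f z \<partial>lborel) - (\<integral>z. k (a - z) * f z \<partial>lborel)
          - (\<integral>z. (f z *\<^sub>R Gk (a - z)) \<bullet> (b - a) \<partial>lborel)"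
        unfolding mollify_def mollify_grad_def by (rule arg_cong)
      also have "\<dots> = (\<integral>z. k (b - z) * f z - k (a - z) * f z \<partial>lborel)
          - (\<integral>z. (f z *\<^sub>R Gk (a - z)) \<bullet> (b - a) \<partial>lborel)"
        by (subst Bochner_Integration.integral_diff[OF i(1) i(1)]) (rule refl)
      also have "\<dots> = (\<integral>z. ?F z \<partial>lborel)"
        by (rule Bochner_Integration.integral_diff[OF Bochner_Integration.integrable_diff[OF i(1) i(1)] i3, symmetric])
      finally show ?thesis .
    qed
    have "norm (mollify f b - mollify f a - mollify_grad f a \<bullet> (b - a)) \<le> (\<integral>z. norm (?F z) \<partial>lborel)"
      unfolding eq by (rule integral_norm_bound)
    also have "\<dots> \<le> (\<integral>z. (norm (b - a) * c') * \<bar>f z\<bar> \<partial>lborel)"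
    proof (rule integral_mono)
      fix z
      have "?F z = (k ((a - z) + (b - a)) - k (a - z) - Gk (a - z) \<bullet> (b - a)) * f z"
        by (simp add: algebra_simps)
      then have "norm (?F z) = \<bar>k ((a - z) + (b - a)) - k (a - z) - Gk (a - z) \<bullet> (b - a)\<bar> * \<bar>f z\<bar>"
        by (simp add: abs_mult)
      also have "\<dots> \<le> (norm (b - a) * c') * \<bar>f z\<bar>"
        by (intro mult_right_mono k_linearization[OF d(2) b]) auto
      finally show "norm (?F z) \<le> (norm (b - a) * c') * \<bar>f z\<bar>" .
      show "integrable lborel (\<lambda>z. norm (?F z))" by (rule integrable_norm[OF intF])
    qed (use f in auto)
    also have "\<dots> = (c' * I) * norm (b - a)" by (simp add: I_def)
    also have "\<dots> \<le> c * norm (b - a)" by (intro mult_right_mono c') auto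
    finally show "norm (mollify f b - mollify f a - mollify_grad f a \<bullet> (b - a)) \<le> c * norm (b - a)" .
  qed
qed

lemma mollify_measurable[measurable]:
  assumes [measurable]: "f \<in> borel_measurable borel"
  shows "mollify f \<in> borel_measurable borel" "mollify_grad f \<in> borel_measurable borel"
  unfolding mollify_def mollify_grad_def by measurable

lemma test_fun_kernel:
  assumes "cball a e \<subseteq> U" shows "test_fun U (\<lambda>z. k (a - z))"
proof -
  have "{z. k (a - z) \<noteq> 0} \<subseteq> cball a e"
    using k_zero by (auto simp: dist_norm) (meson linear)
  then have sub: "tsupport (\<lambda>z. k (a - z)) \<subseteq> cball a e"
    unfolding tsupport_def by (intro closure_minimal) auto
  then have "compact (tsupport (\<lambda>z. k (a - z)))"
    by (metis closed_Int_compact closed_closure compact_cball inf.absorb1 tsupport_def)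
  then show ?thesis using sub assms k_smooth by (auto simp: test_fun_def)
qed

lemma frechet_derivative_kernel: "frechet_derivative (\<lambda>z. k (a - z)) (at z) i = - (Gk (a - z) \<bullet> i)"
proof -
  have "((\<lambda>z. a - z) has_derivative (\<lambda>h. - h)) (at z)" by (auto intro!: derivative_eq_intros)
  from has_derivative_compose[OF this k_deriv]
  have "((\<lambda>z. k (a - z)) has_derivative (\<lambda>h. Gk (a - z) \<bullet> (- h))) (at z)" .
  from frechet_derivative_at[OF this, symmetric] show ?thesis by simp
qed

text \<open>As long as its support fits into \<open>U\<close>, the reflected translate of the kernel
  is a test function; the reflection reverses the sign of its derivative, which cancels the minus
  sign in the definition of the weak derivative.\<close>

lemma mollify_grad_weak:
  assumes f: "integrable lborel f" and a: "cball a e \<subseteq> U" and i: "i \<in> Basis"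
    and weak: "\<And>\<phi>. test_fun U \<phi> \<Longrightarrow>
      (\<integral>x. f x * frechet_derivative \<phi> (at x) i \<partial>lborel) = - (\<integral>x. (g x \<bullet> i) * \<phi> x \<partial>lborel)"
  shows "mollify_grad f a \<bullet> i = mollify (\<lambda>x. g x \<bullet> i) a"
proof -
  have "mollify_grad f a \<bullet> i = (\<integral>z. (f z *\<^sub>R Gk (a - z)) \<bullet> i \<partial>lborel)"
    unfolding mollify_grad_def by (rule integral_inner_left[symmetric]) (rule mollify_grad_integrable[OF f])
  also have "\<dots> = - (\<integral>z. f z * frechet_derivative (\<lambda>z. k (a - z)) (at z) i \<partial>lborel)"
    by (simp add: frechet_derivative_kernel)
  also have "\<dots> = (\<integral>z. (g z \<bullet> i) * k (a - z) \<partial>lborel)"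
    using weak[OF test_fun_kernel[OF a]] by simp
  finally show ?thesis by (simp add: mollify_def mult.commute)
qed

lemma k_nn_integral: "(\<integral>\<^sup>+a. ennreal (k (a - z)) \<partial>lborel) = 1" "(\<integral>\<^sup>+z. ennreal (k (a - z)) \<partial>lborel) = 1"
proof -
  have 1: "(\<integral>\<^sup>+x. ennreal (k x) \<partial>lborel) = 1"
    using nn_integral_eq_integral[OF k_int(1)] k_nonneg k_int(2) by simp
  show "(\<integral>\<^sup>+a. ennreal (k (a - z)) \<partial>lborel) = 1"
    using 1 by (subst (asm) lborel_distr_plus[of "- z", symmetric]) (simp add: nn_integral_distr)
  have "(\<integral>\<^sup>+x. ennreal (k x) \<partial>lborel) = (\<integral>\<^sup>+z. ennreal (k (a - z)) \<partial>lborel)"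
    by (subst lborel_affine[of "-1" a]) (simp_all add: nn_integral_density nn_integral_distr)
  then show "(\<integral>\<^sup>+z. ennreal (k (a - z)) \<partial>lborel) = 1" using 1 by simp
qed

lemma k_shift: "integrable lborel (\<lambda>z. k (a - z))" "(\<integral>z. k (a - z) \<partial>lborel) = 1"
proof -
  show "integrable lborel (\<lambda>z. k (a - z))"
    by (rule integrableI_nonneg) (auto simp: k_nonneg k_nn_integral)
  then show "(\<integral>z. k (a - z) \<partial>lborel) = 1"
    using k_nn_integral(2)[of a] by (simp add: integral_eq_nn_integral k_nonneg)
qed

text \<open>Tonelli, together with the kernel having mass one in the variable
  \<open>a\<close>.\<close>

lemma mollify_L1:
  assumes f: "integrable lborel f"
  shows "(\<integral>\<^sup>+a. ennreal \<bar>mollify f a\<bar> \<partial>lborel) \<le> (\<integral>\<^sup>+z. ennreal \<bar>f z\<bar> \<partial>lborel)"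
proof -
  have [measurable]: "f \<in> borel_measurable borel" using f by simp
  have "(\<integral>\<^sup>+a. ennreal \<bar>mollify f a\<bar> \<partial>lborel) \<le> (\<integral>\<^sup>+a. (\<integral>\<^sup>+z. ennreal (k (a - z)) * ennreal \<bar>f z\<bar> \<partial>lborel) \<partial>lborel)"
  proof (rule nn_integral_mono)
    fix a
    have "ennreal \<bar>mollify f a\<bar> \<le> (\<integral>\<^sup>+z. ennreal (norm (k (a - z) * f z)) \<partial>lborel)"
      unfolding mollify_def using integral_norm_bound_ennreal[OF mollify_integrable[OF f, of a]] by simp
    then show "ennreal \<bar>mollify f a\<bar> \<le> (\<integral>\<^sup>+z. ennreal (k (a - z)) * ennreal \<bar>f z\<bar> \<partial>lborel)"
      by (simp add: abs_mult k_nonneg ennreal_mult)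
  qed
  also have "\<dots> = (\<integral>\<^sup>+z. (\<integral>\<^sup>+a. ennreal (k (a - z)) * ennreal \<bar>f z\<bar> \<partial>lborel) \<partial>lborel)"
    by (rule lborel_pair.Fubini') measurable
  also have "\<dots> = (\<integral>\<^sup>+z. ennreal \<bar>f z\<bar> \<partial>lborel)"
    by (simp add: nn_integral_multc k_nn_integral)
  finally show ?thesis .
qed

text \<open>Two different points \<open>a\<close> and \<open>y\<close> are compared because the
  mollification is later evaluated at contracted points. Every \<open>z\<close> that contributes
  lies within |a - y| + e of \<open>y\<close>.\<close>

lemma mollify_lipschitz_error:
  assumes h: "integrable lborel h" and L: "\<And>x y. \<bar>h x - h y\<bar> \<le> L * norm (x - y)" "L \<ge> 0"
  shows "\<bar>mollify h a - h y\<bar> \<le> L * (norm (a - y) + e)"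
proof -
  have "mollify h a - h y = (\<integral>z. k (a - z) * h z - k (a - z) * h y \<partial>lborel)"
    unfolding mollify_def using mollify_integrable[OF h] k_shift[of a] by simp
  also have "\<bar>\<dots>\<bar> \<le> (\<integral>z. \<bar>k (a - z) * h z - k (a - z) * h y\<bar> \<partial>lborel)" by (rule integral_abs_bound)
  also have "\<dots> \<le> (\<integral>z. k (a - z) * (L * (norm (a - y) + e)) \<partial>lborel)"
  proof (rule integral_mono)
    fix z
    have eq: "\<bar>k (a - z) * h z - k (a - z) * h y\<bar> = k (a - z) * \<bar>h z - h y\<bar>"
      by (simp add: abs_mult k_nonneg flip: right_diff_distrib)
    show "\<bar>k (a - z) * h z - k (a - z) * h y\<bar> \<le> k (a - z) * (L * (norm (a - y) + e))"
    proof (cases "norm (a - z) \<ge> e")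
      case True
      then show ?thesis by (simp add: k_zero)
    next
      case False
      have "norm (z - y) \<le> norm (a - y) + e"
        using norm_triangle_ineq[of "z - a" "a - y"] False by (simp add: norm_minus_commute)
      then have "\<bar>h z - h y\<bar> \<le> L * (norm (a - y) + e)"
        using L(1)[of z y] mult_left_mono[OF _ L(2)] by (meson order_trans)
      then show ?thesis unfolding eq by (intro mult_left_mono k_nonneg)
    qed
  qed (use mollify_integrable[OF h] k_shift[of a] in auto)
  also have "\<dots> = L * (norm (a - y) + e)" using k_shift[of a] by simp
  finally show ?thesis .
qed

end

section \<open>Density of Lipschitz functions in W11 of a bounded convex set\<close>

text \<open>Insert a Lipschitz \<open>h\<close> close to \<open>f\<close> in L^1. The mollification
  of f - h stays small because mollifying and contracting are bounded on L^1; for \<open>h\<close>,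
  the contraction and the kernel radius both move points by a multiple of \<delta>. Stating the
  estimate eventually in \<delta> and for all kernels lets a single \<delta> serve several functions
  at once.\<close>

lemma dilated_mollify_L1:
  fixes f :: "'a::euclidean_space \<Rightarrow> real" and z0 :: 'a
  assumes f: "integrable lborel f" and \<Omega>: "bounded \<Omega>" "\<Omega> \<in> sets borel"
    and r0: "r0 > 0" and c: "c > 0"
  shows "\<forall>\<^sub>F \<delta> in at_right 0. \<forall>k G. mollifier (\<delta> * r0) k G \<longrightarrow>
    (\<integral>\<^sup>+y\<in>\<Omega>. ennreal \<bar>mollifier.mollify k f (z0 + (1 - \<delta>) *\<^sub>R (y - z0)) - f y\<bar> \<partial>lborel) \<le> ennreal c"
proof -
  \<comment> \<open>Contraction by 1 - \<delta> >= 1/2 is undone with expansion at most 2, so this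
    is \<open>(10 * 2) ^ DIM('a)\<close> from the expanding estimate.\<close>
  define K :: real where "K = 20 ^ DIM('a)"
  have K: "K > 0" by (simp add: K_def)
  define \<eta> where "\<eta> = c / 2 / (K + 1)"
  have "K * \<eta> + \<eta> = (K + 1) * \<eta>" by (simp add: algebra_simps)
  also have "\<dots> = c / 2" using K unfolding \<eta>_def by (metis add_pos_pos less_irrefl nonzero_mult_div_cancel_left times_divide_eq_right zero_less_one)
  finally have \<eta>: "\<eta> > 0" "K * \<eta> + \<eta> = c / 2" using c K by (simp_all add: \<eta>_def)
  obtain h L where h: "integrable lborel h" "L \<ge> 0" "\<And>x y. \<bar>h x - h y\<bar> \<le> L * norm (x - y)"
    "(\<integral>x. \<bar>f x - h x\<bar> \<partial>lborel) < \<eta>"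
    using integrable_approx_lipschitz[OF f] \<eta>(1) by blast
  have [measurable]: "f \<in> borel_measurable borel" "h \<in> borel_measurable borel" "\<Omega> \<in> sets borel"
    using f h \<Omega> by auto
  obtain D where D: "D > 0" "\<And>y. y \<in> \<Omega> \<Longrightarrow> norm (y - z0) \<le> D"
    using bounded_subset_ballD[OF \<Omega>(1), of z0] by (auto simp: subset_eq dist_norm norm_minus_commute less_imp_le)
  define m where "m = measure lborel \<Omega>"
  have m: "emeasure lborel \<Omega> = ennreal m" "m \<ge> 0"
    using emeasure_bounded_finite[OF \<Omega>(1)] by (auto simp: m_def emeasure_eq_ennreal_measure)
  \<comment> \<open>\<delta> Q bounds the total error on \<open>h\<close>: points move by at most
    \<delta> D under the contraction and \<delta> r0 under the kernel, over a set of measure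
    \<open>m\<close>.\<close>
  define Q where "Q = L * (D + r0) * m"
  have Q: "Q \<ge> 0" using h(2) D(1) r0 m(2) by (simp add: Q_def)
  have fh: "(\<integral>\<^sup>+x. ennreal \<bar>f x - h x\<bar> \<partial>lborel) \<le> ennreal \<eta>"
    using f h by (subst nn_integral_eq_integral) (auto intro!: ennreal_leI)
  have main: "(\<integral>\<^sup>+y\<in>\<Omega>. ennreal \<bar>mollifier.mollify k f (z0 + (1 - \<delta>) *\<^sub>R (y - z0)) - f y\<bar> \<partial>lborel) \<le> ennreal c"
    if \<delta>: "0 < \<delta>" "\<delta> \<le> 1 / 2" "\<delta> * Q \<le> c / 2" and mol: "mollifier (\<delta> * r0) k G" for \<delta> and k :: "'a \<Rightarrow> real" and G
  proof -
    interpret mollifier "\<delta> * r0" k G by (rule mol)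
    define S where "S y = z0 + (1 - \<delta>) *\<^sub>R (y - z0)" for y
    have Sm[measurable]: "S \<in> borel_measurable borel" unfolding S_def by measurable
    have fh_int: "integrable lborel (\<lambda>z. f z - h z)" using f h by simp
    have diff: "mollify (\<lambda>z. f z - h z) a = mollify f a - mollify h a" for a
      unfolding mollify_def using mollify_integrable[OF f] mollify_integrable[OF h(1)]
      by (simp add: right_diff_distrib)
    have "(\<integral>\<^sup>+y\<in>\<Omega>. ennreal \<bar>mollify f (S y) - f y\<bar> \<partial>lborel) \<le>
      (\<integral>\<^sup>+y. (ennreal \<bar>mollify (\<lambda>z. f z - h z) (S y)\<bar> * indicator \<Omega> y + ennreal \<bar>f y - h y\<bar>) + ennreal (L * (\<delta> * (D + r0))) * indicator \<Omega> y \<partial>lborel)"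
    proof (rule nn_integral_mono)
      fix y :: 'a
      show "ennreal \<bar>mollify f (S y) - f y\<bar> * indicator \<Omega> y \<le>
        (ennreal \<bar>mollify (\<lambda>z. f z - h z) (S y)\<bar> * indicator \<Omega> y + ennreal \<bar>f y - h y\<bar>) + ennreal (L * (\<delta> * (D + r0))) * indicator \<Omega> y"
      proof (cases "y \<in> \<Omega>")
        case True
        have "norm (S y - y) = \<delta> * norm (y - z0)"
        proof -
          have "S y - y = - \<delta> *\<^sub>R (y - z0)" by (simp add: S_def algebra_simps)
          then show ?thesis using \<delta> by simp
        qed
        also have "\<dots> \<le> \<delta> * D" using \<delta> D(2)[OF True] by simp
        finally have "\<bar>mollify h (S y) - h y\<bar> \<le> L * (\<delta> * (D + r0))"
          using mollify_lipschitz_error[OF h(1) h(3) h(2), of "S y" y] h(2)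
            mult_left_mono[of "norm (S y - y) + \<delta> * r0" "\<delta> * (D + r0)" L]
          by (simp add: algebra_simps)
        then have "\<bar>mollify f (S y) - f y\<bar> \<le> \<bar>mollify (\<lambda>z. f z - h z) (S y)\<bar> + \<bar>f y - h y\<bar> + L * (\<delta> * (D + r0))"
          unfolding diff by linarith
        moreover have "0 \<le> L * (\<delta> * (D + r0))" using h(2) \<delta>(1) D(1) r0 by simp
        ultimately show ?thesis using True by (simp add: ennreal_leI flip: ennreal_plus)
      qed simp
    qed
    also have "\<dots> = (\<integral>\<^sup>+y\<in>\<Omega>. ennreal \<bar>mollify (\<lambda>z. f z - h z) (S y)\<bar> \<partial>lborel) + (\<integral>\<^sup>+y. ennreal \<bar>f y - h y\<bar> \<partial>lborel)
        + (\<integral>\<^sup>+y. ennreal (L * (\<delta> * (D + r0))) * indicator \<Omega> y \<partial>lborel)"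
      by (simp add: nn_integral_add)
    also have "\<dots> \<le> ennreal (K * \<eta>) + ennreal \<eta> + ennreal (\<delta> * Q)"
    proof (intro add_mono fh)
      have "(\<integral>\<^sup>+y\<in>\<Omega>. ennreal \<bar>mollify (\<lambda>z. f z - h z) (S y)\<bar> \<partial>lborel)
          \<le> ennreal ((10 * 2) ^ DIM('a)) * (\<integral>\<^sup>+a. ennreal \<bar>mollify (\<lambda>z. f z - h z) a\<bar> \<partial>lborel)"
      proof (rule nn_integral_expanding_le[OF Sm \<Omega>(2)])
        fix x y :: 'a
        have "S x - S y = (1 - \<delta>) *\<^sub>R (x - y)" by (simp add: S_def algebra_simps)
        then have "norm (S x - S y) = (1 - \<delta>) * norm (x - y)" using \<delta> by simp
        moreover have "1 / 2 * norm (x - y) \<le> (1 - \<delta>) * norm (x - y)" using \<delta> by (intro mult_right_mono) auto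
        ultimately show "norm (x - y) \<le> 2 * norm (S x - S y)" by simp
      qed auto
      also have "\<dots> = ennreal K * (\<integral>\<^sup>+a. ennreal \<bar>mollify (\<lambda>z. f z - h z) a\<bar> \<partial>lborel)"
        by (simp add: K_def)
      also have "\<dots> \<le> ennreal K * ennreal \<eta>"
        using order_trans[OF mollify_L1[OF fh_int] fh] by (intro mult_left_mono) auto
      also have "\<dots> = ennreal (K * \<eta>)" using K \<eta> by (simp add: ennreal_mult)
      finally show "(\<integral>\<^sup>+y\<in>\<Omega>. ennreal \<bar>mollify (\<lambda>z. f z - h z) (S y)\<bar> \<partial>lborel) \<le> ennreal (K * \<eta>)" .
      have "(\<integral>\<^sup>+y. ennreal (L * (\<delta> * (D + r0))) * indicator \<Omega> y \<partial>lborel) = ennreal (L * (\<delta> * (D + r0))) * ennreal m"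
        by (simp add: nn_integral_cmult_indicator m)
      also have "\<dots> = ennreal (\<delta> * Q)"
        using h(2) \<delta>(1) D(1) r0 m(2) by (simp add: Q_def mult_ac flip: ennreal_mult)
      finally show "(\<integral>\<^sup>+y. ennreal (L * (\<delta> * (D + r0))) * indicator \<Omega> y \<partial>lborel) \<le> ennreal (\<delta> * Q)" by simp
    qed
    also have "\<dots> = ennreal (K * \<eta> + \<eta> + \<delta> * Q)"
      using K \<eta>(1) Q \<delta>(1) by (simp flip: ennreal_plus)
    also have "\<dots> \<le> ennreal c" using \<eta> \<delta>(3) by (intro ennreal_leI) linarith
    finally show ?thesis by (simp add: S_def)
  qed
  define d where "d = min (1 / 2) (c / (2 * (Q + 1)))"
  have d: "d > 0" using c Q by (simp add: d_def)
  have "\<delta> * Q \<le> c / 2" if "0 < \<delta>" "\<delta> < d" for \<delta>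
  proof -
    have "\<delta> * Q \<le> \<delta> * (Q + 1)" using that by simp
    also have "\<dots> \<le> c / (2 * (Q + 1)) * (Q + 1)" using that Q by (intro mult_right_mono) (auto simp: d_def)
    also have "\<dots> = c / 2" using Q by (simp add: field_simps)
    finally show ?thesis .
  qed
  then show ?thesis
    unfolding eventually_at_right_field using d main
    by (intro exI[of _ d]) (auto simp: d_def)
qed

text \<open>The contraction towards \<open>z0\<close> makes room for the kernel: around each
  contracted point a ball of radius \<delta> r0 still lies in \<Omega>, so
  \<open>mollify_grad_weak\<close> is available at every point of \<Omega>, up to the boundary.
  Outside \<Omega>, \<open>g\<close> is not related to \<open>u\<close>, and closeness is claimed
  only on \<Omega>.\<close>

theorem convex_W11_approx:
  fixes \<Omega> :: "'a::euclidean_space set" and u :: "'a \<Rightarrow> real" and g :: "'a \<Rightarrow> 'a"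
  assumes \<Omega>: "open \<Omega>" "convex \<Omega>" "bounded \<Omega>" "\<Omega> \<noteq> {}"
    and u: "integrable lborel u" and g: "integrable lborel g"
    and weak: "\<And>\<phi> i. test_fun \<Omega> \<phi> \<Longrightarrow> i \<in> Basis \<Longrightarrow>
      (\<integral>x. u x * frechet_derivative \<phi> (at x) i \<partial>lborel) = - (\<integral>x. (g x \<bullet> i) * \<phi> x \<partial>lborel)"
    and c: "c > 0"
  shows "\<exists>U G L. G \<in> borel_measurable borel \<and> (\<forall>x. (U has_derivative (\<lambda>h. G x \<bullet> h)) (at x)) \<and>
    L \<ge> 0 \<and> (\<forall>x y. \<bar>U x - U y\<bar> \<le> L * norm (x - y)) \<and>
    (\<integral>\<^sup>+y\<in>\<Omega>. ennreal \<bar>U y - u y\<bar> \<partial>lborel) \<le> ennreal c \<and>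
    (\<integral>\<^sup>+y\<in>\<Omega>. ennreal (norm (G y - g y)) \<partial>lborel) \<le> ennreal c"
proof -
  obtain z0 where z0: "z0 \<in> \<Omega>" using \<Omega>(4) by blast
  obtain r0 where r0: "r0 > 0" "cball z0 r0 \<subseteq> \<Omega>" using \<Omega>(1) z0 open_contains_cball by blast
  have \<Omega>b[measurable]: "\<Omega> \<in> sets borel" using \<Omega>(1) by simp
  have [measurable]: "u \<in> borel_measurable borel" "g \<in> borel_measurable borel" using u g by auto
  define N where "N = real DIM('a)"
  have N: "N > 0" by (simp add: N_def)
  \<comment> \<open>Each of the N coordinates of the gradient error is charged twice: for the
    mollification and for the chain rule factor 1 - \<delta>.\<close>
  define c' where "c' = c / (2 * N)"
  have c': "c' > 0" "N * (c' + c') = c" using c N by (auto simp: c'_def field_simps)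
  have gi: "integrable lborel (\<lambda>x. g x \<bullet> i)" for i using g by simp
  let ?close = "\<lambda>f c \<delta>. \<forall>k G. mollifier (\<delta> * r0) k G \<longrightarrow>
      (\<integral>\<^sup>+y\<in>\<Omega>. ennreal \<bar>mollifier.mollify k f (z0 + (1 - \<delta>) *\<^sub>R (y - z0)) - f y\<bar> \<partial>lborel) \<le> ennreal c"
  have "\<forall>\<^sub>F \<delta> in at_right 0. ?close u c \<delta>"
    by (rule dilated_mollify_L1[OF u \<Omega>(3) \<Omega>b r0(1) c])
  moreover have "\<forall>\<^sub>F \<delta> in at_right 0. \<forall>i\<in>Basis. ?close (\<lambda>x. g x \<bullet> i) c' \<delta>"
    by (intro eventually_ball_finite ballI dilated_mollify_L1[OF gi \<Omega>(3) \<Omega>b r0(1) c'(1)]) simp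
  moreover have "\<forall>\<^sub>F \<delta> in at_right 0. \<forall>i\<in>Basis. \<delta> * (\<integral>x. \<bar>g x \<bullet> i\<bar> \<partial>lborel) < c'"
  proof (intro eventually_ball_finite ballI finite_Basis)
    fix i :: 'a
    have "((\<lambda>\<delta>. \<delta> * (\<integral>x. \<bar>g x \<bullet> i\<bar> \<partial>lborel)) \<longlongrightarrow> 0 * (\<integral>x. \<bar>g x \<bullet> i\<bar> \<partial>lborel)) (at_right 0)"
      by (intro tendsto_intros)
    then show "\<forall>\<^sub>F \<delta> in at_right 0. \<delta> * (\<integral>x. \<bar>g x \<bullet> i\<bar> \<partial>lborel) < c'"
      by (rule order_tendstoD) (use c' in simp)
  qed
  moreover have "\<forall>\<^sub>F \<delta> in at_right 0. 0 < \<delta> \<and> \<delta> < (1::real)"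
    by (auto simp: eventually_at_right_field intro!: exI[of _ 1])
  ultimately have "\<forall>\<^sub>F \<delta> in at_right 0. 0 < \<delta> \<and> \<delta> < 1 \<and> (\<forall>i\<in>Basis. \<delta> * (\<integral>x. \<bar>g x \<bullet> i\<bar> \<partial>lborel) < c') \<and>
      ?close u c \<delta> \<and>
      (\<forall>i\<in>Basis. ?close (\<lambda>x. g x \<bullet> i) c' \<delta>)"
    by eventually_elim blast
  from eventually_happens'[OF trivial_limit_at_right_real this]
  obtain \<delta> where \<delta>: "0 < \<delta>" "\<delta> < 1" "\<And>i. i \<in> Basis \<Longrightarrow> \<delta> * (\<integral>x. \<bar>g x \<bullet> i\<bar> \<partial>lborel) < c'"
    and app_u: "\<And>k G. mollifier (\<delta> * r0) k G \<Longrightarrow>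
      (\<integral>\<^sup>+y\<in>\<Omega>. ennreal \<bar>mollifier.mollify k u (z0 + (1 - \<delta>) *\<^sub>R (y - z0)) - u y\<bar> \<partial>lborel) \<le> ennreal c"
    and app_g: "\<And>i k G. i \<in> Basis \<Longrightarrow> mollifier (\<delta> * r0) k G \<Longrightarrow>
      (\<integral>\<^sup>+y\<in>\<Omega>. ennreal \<bar>mollifier.mollify k (\<lambda>x. g x \<bullet> i) (z0 + (1 - \<delta>) *\<^sub>R (y - z0)) - g y \<bullet> i\<bar> \<partial>lborel) \<le> ennreal c'"
    by blast
  obtain k and Gk :: "'a \<Rightarrow> 'a" where mol: "mollifier (\<delta> * r0) k Gk"
    using mollifier_exists[of "\<delta> * r0"] \<delta>(1) r0(1) by auto
  interpret mollifier "\<delta> * r0" k Gk by (rule mol)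
  define S where "S y = z0 + (1 - \<delta>) *\<^sub>R (y - z0)" for y
  have Sm[measurable]: "S \<in> borel_measurable borel" unfolding S_def by measurable
  \<comment> \<open>By convexity: this ball is the image of the ball of radius \<open>r0\<close>
    around \<open>z0\<close> under z |-> (1 - \<delta>) y + \<delta> z.\<close>
  have Sball: "cball (S y) (\<delta> * r0) \<subseteq> \<Omega>" if y: "y \<in> \<Omega>" for y
  proof
    fix x assume x: "x \<in> cball (S y) (\<delta> * r0)"
    define w where "w = (x - S y) /\<^sub>R \<delta>"
    have "norm w = norm (x - S y) / \<delta>" using \<delta>(1) by (simp add: w_def divide_inverse_commute)
    also have "\<dots> \<le> r0" using x \<delta>(1) by (simp add: dist_norm norm_minus_commute divide_le_eq mult.commute)
    finally have "z0 + w \<in> \<Omega>" using r0(2) by (auto simp: dist_norm)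
    then have "(1 - \<delta>) *\<^sub>R y + \<delta> *\<^sub>R (z0 + w) \<in> \<Omega>"
      using convexD[OF \<Omega>(2) y, of "z0 + w" "1 - \<delta>" \<delta>] \<delta> by simp
    also have "(1 - \<delta>) *\<^sub>R y + \<delta> *\<^sub>R (z0 + w) = x"
      using \<delta>(1) by (simp add: w_def S_def algebra_simps)
    finally show "x \<in> \<Omega>" .
  qed
  define U where "U y = mollify u (S y)" for y
  define G where "G y = (1 - \<delta>) *\<^sub>R mollify_grad u (S y)" for y
  obtain M where M: "M > 0" "\<And>x. norm (Gk x) \<le> M" using Gk_bounded by blast
  define L where "L = M * (\<integral>z. \<bar>u z\<bar> \<partial>lborel)"
  have L: "L \<ge> 0" using M(1) by (simp add: L_def)
  have Gi: "G y \<bullet> i = (1 - \<delta>) * mollify (\<lambda>x. g x \<bullet> i) (S y)" if "y \<in> \<Omega>" "i \<in> Basis" for y i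
    using mollify_grad_weak[OF u Sball[OF that(1)] that(2), of g] weak that(2) by (simp add: G_def)
  have "(U has_derivative (\<lambda>h. G x \<bullet> h)) (at x)" for x
  proof -
    have "(S has_derivative (\<lambda>h. (1 - \<delta>) *\<^sub>R h)) (at x)"
      unfolding S_def by (auto intro!: derivative_eq_intros)
    from has_derivative_compose[OF this mollify_has_derivative[OF u]]
    show ?thesis by (simp add: U_def[abs_def] G_def)
  qed
  moreover have "\<bar>U x - U y\<bar> \<le> L * norm (x - y)" for x y
  proof -
    have "S x - S y = (1 - \<delta>) *\<^sub>R (x - y)" by (simp add: S_def algebra_simps)
    then have "norm (S x - S y) \<le> norm (x - y)" using \<delta> by (simp add: mult_left_le_one_le)
    then have "L * norm (S x - S y) \<le> L * norm (x - y)" using L by (rule mult_left_mono)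
    then show ?thesis using mollify_lipschitz[OF u M(2), of "S x" "S y"] by (simp add: U_def L_def)
  qed
  moreover have "(\<integral>\<^sup>+y\<in>\<Omega>. ennreal \<bar>U y - u y\<bar> \<partial>lborel) \<le> ennreal c"
    using app_u[OF mol] by (simp add: U_def S_def)
  moreover have "(\<integral>\<^sup>+y\<in>\<Omega>. ennreal (norm (G y - g y)) \<partial>lborel) \<le> ennreal c"
  proof -
    let ?m = "\<lambda>i y. \<bar>mollify (\<lambda>x. g x \<bullet> i) (S y) - g y \<bullet> i\<bar>"
    have "(\<integral>\<^sup>+y\<in>\<Omega>. ennreal (norm (G y - g y)) \<partial>lborel) \<le>
      (\<integral>\<^sup>+y. (\<Sum>i\<in>Basis. ennreal (?m i y) * indicator \<Omega> y + ennreal (\<delta> * \<bar>g y \<bullet> i\<bar>)) \<partial>lborel)"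
    proof (rule nn_integral_mono)
      fix y :: 'a
      show "ennreal (norm (G y - g y)) * indicator \<Omega> y \<le>
        (\<Sum>i\<in>Basis. ennreal (?m i y) * indicator \<Omega> y + ennreal (\<delta> * \<bar>g y \<bullet> i\<bar>))"
      proof (cases "y \<in> \<Omega>")
        case True
        have "norm (G y - g y) \<le> (\<Sum>i\<in>Basis. \<bar>(G y - g y) \<bullet> i\<bar>)" by (rule norm_le_l1)
        also have "\<dots> \<le> (\<Sum>i\<in>Basis. ?m i y + \<delta> * \<bar>g y \<bullet> i\<bar>)"
        proof (rule sum_mono)
          fix i :: 'a assume i: "i \<in> Basis"
          have "(G y - g y) \<bullet> i = (1 - \<delta>) * (mollify (\<lambda>x. g x \<bullet> i) (S y) - g y \<bullet> i) - \<delta> * (g y \<bullet> i)"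
            by (simp add: inner_diff_left Gi[OF True i] algebra_simps)
          also have "\<bar>\<dots>\<bar> \<le> (1 - \<delta>) * ?m i y + \<delta> * \<bar>g y \<bullet> i\<bar>"
            using \<delta> by (intro order_trans[OF abs_triangle_ineq4]) (simp add: abs_mult)
          also have "(1 - \<delta>) * ?m i y \<le> ?m i y" using \<delta> by (simp add: mult_left_le_one_le)
          finally show "\<bar>(G y - g y) \<bullet> i\<bar> \<le> ?m i y + \<delta> * \<bar>g y \<bullet> i\<bar>" by simp
        qed
        finally have "ennreal (norm (G y - g y)) \<le> ennreal (\<Sum>i\<in>Basis. ?m i y + \<delta> * \<bar>g y \<bullet> i\<bar>)"
          by (rule ennreal_leI)
        also have "\<dots> = (\<Sum>i\<in>Basis. ennreal (?m i y + \<delta> * \<bar>g y \<bullet> i\<bar>))"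
          using \<delta> by (intro sum_ennreal[symmetric]) simp
        finally show ?thesis using True \<delta> by simp
      qed simp
    qed
    also have "\<dots> = (\<Sum>i\<in>Basis. (\<integral>\<^sup>+y\<in>\<Omega>. ennreal (?m i y) \<partial>lborel) + (\<integral>\<^sup>+y. ennreal (\<delta> * \<bar>g y \<bullet> i\<bar>) \<partial>lborel))"
      by (simp add: nn_integral_sum nn_integral_add)
    also have "\<dots> \<le> (\<Sum>i\<in>(Basis::'a set). ennreal c' + ennreal c')"
    proof (intro sum_mono add_mono)
      fix i :: 'a assume i: "i \<in> Basis"
      show "(\<integral>\<^sup>+y\<in>\<Omega>. ennreal (?m i y) \<partial>lborel) \<le> ennreal c'"
        using app_g[OF i mol] by (simp add: S_def)
      have "(\<integral>\<^sup>+y. ennreal (\<delta> * \<bar>g y \<bullet> i\<bar>) \<partial>lborel) = ennreal (\<integral>y. \<delta> * \<bar>g y \<bullet> i\<bar> \<partial>lborel)"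
        using gi[of i] \<delta> by (intro nn_integral_eq_integral) auto
      also have "\<dots> \<le> ennreal c'" using \<delta>(3)[OF i] by (intro ennreal_leI) simp
      finally show "(\<integral>\<^sup>+y. ennreal (\<delta> * \<bar>g y \<bullet> i\<bar>) \<partial>lborel) \<le> ennreal c'" .
    qed
    also have "\<dots> = (\<Sum>i\<in>(Basis::'a set). ennreal (c' + c'))"
      using c'(1) by (simp only: ennreal_plus[symmetric] less_imp_le)
    also have "\<dots> = ennreal (\<Sum>i\<in>(Basis::'a set). c' + c')"
      using c'(1) by (intro sum_ennreal) simp
    also have "\<dots> = ennreal (N * (c' + c'))" by (simp add: N_def)
    finally show ?thesis using c'(2) by simp
  qed
  moreover have "G \<in> borel_measurable borel" unfolding G_def by measurable
  ultimately show ?thesis using L by blast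
qed

section \<open>Reflection in a convex domain with interior spheres\<close>

locale convex_sphere_domain =
  fixes \<Omega> :: "'a::euclidean_space set" and r :: real
  assumes open_dom: "open \<Omega>" and convex_dom: "convex \<Omega>" and nonempty_dom: "\<Omega> \<noteq> {}"
    and r_pos: "0 < r" and sphere: "interior_sphere \<Omega> r"
begin

definition proj :: "'a \<Rightarrow> 'a" where "proj = closest_point (closure \<Omega>)"

definition reflect :: "'a \<Rightarrow> 'a" where "reflect x = 2 *\<^sub>R proj x - x"

text \<open>A supporting half-space instead of the gradient of a defining function: normals then
  come directly from the projection, and their regularity from the inner balls.\<close>

definition outnormal :: "'a \<Rightarrow> 'a \<Rightarrow> bool" where
  "outnormal p n \<longleftrightarrow> p \<in> frontier \<Omega> \<and> norm n = 1 \<and> (\<forall>y\<in>closure \<Omega>. (y - p) \<bullet> n \<le> 0)"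

lemma closure_props: "closed (closure \<Omega>)" "convex (closure \<Omega>)" "closure \<Omega> \<noteq> {}"
  using convex_closure[OF convex_dom] nonempty_dom by auto

lemma dom_subset_closure: "x \<in> \<Omega> \<Longrightarrow> x \<in> closure \<Omega>"
  using closure_subset by auto

lemma frontier_dom: "frontier \<Omega> = closure \<Omega> - \<Omega>"
  by (simp add: frontier_def interior_open open_dom)

lemma proj_in_closure: "proj x \<in> closure \<Omega>"
  unfolding proj_def using closest_point_in_set closure_props by blast

lemma proj_self: "x \<in> closure \<Omega> \<Longrightarrow> proj x = x"
  unfolding proj_def by (simp add: closest_point_self)

lemma reflect_self: "x \<in> closure \<Omega> \<Longrightarrow> reflect x = x"
  by (simp add: reflect_def proj_self scaleR_2)

lemma proj_eq_iff: "proj x = x \<longleftrightarrow> x \<in> closure \<Omega>"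
  using proj_in_closure proj_self by metis

lemma proj_lipschitz: "norm (proj x - proj y) \<le> norm (x - y)"
  using closest_point_lipschitz[OF closure_props(2,1,3), of x y]
  by (simp add: proj_def dist_norm)

lemma reflect_lipschitz: "norm (reflect x - reflect y) \<le> 3 * norm (x - y)"
proof -
  have "norm (reflect x - reflect y) = norm (2 *\<^sub>R (proj x - proj y) - (x - y))"
    by (simp add: reflect_def algebra_simps)
  also have "\<dots> \<le> 2 * norm (proj x - proj y) + norm (x - y)"
    by (rule order_trans[OF norm_triangle_ineq4]) simp
  finally show ?thesis using proj_lipschitz[of x y] by linarith
qed

lemma continuous_proj: "continuous_on S proj"
  by (rule lipschitz_on_continuous_on[of 1])
     (auto simp: lipschitz_on_def dist_norm proj_lipschitz)

lemma continuous_reflect: "continuous_on S reflect"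
  unfolding reflect_def by (intro continuous_intros continuous_proj)

lemma proj_dot:
  assumes "y \<in> closure \<Omega>" shows "(y - proj x) \<bullet> (x - proj x) \<le> 0"
  using closest_point_dot[OF closure_props(2,1) assms, of x]
  by (simp add: proj_def inner_commute)

lemma proj_in_frontier:
  assumes "x \<notin> closure \<Omega>" shows "proj x \<in> frontier \<Omega>"
proof -
  let ?e = "x - proj x"
  have e: "?e \<noteq> 0" using assms proj_eq_iff by fastforce
  have False if in_dom: "proj x \<in> \<Omega>"
  proof -
    obtain d where d: "d > 0" "ball (proj x) d \<subseteq> \<Omega>"
      using open_dom in_dom open_contains_ball by blast
    define y where "y = proj x + (d / 2 / norm ?e) *\<^sub>R ?e"
    have "dist (proj x) y < d" using e d by (simp add: y_def dist_norm)
    then have "y \<in> closure \<Omega>" using d dom_subset_closure by auto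
    from proj_dot[OF this, of x] have "(d / 2 / norm ?e) * (?e \<bullet> ?e) \<le> 0"
      by (simp add: y_def)
    moreover have "(d / 2 / norm ?e) * (?e \<bullet> ?e) > 0" using e d by simp
    ultimately show False by linarith
  qed
  then show ?thesis using frontier_dom proj_in_closure by auto
qed

lemma outnormal_proj:
  assumes "x \<notin> closure \<Omega>"
  shows "outnormal (proj x) ((x - proj x) /\<^sub>R norm (x - proj x))"
proof -
  have "x - proj x \<noteq> 0" using assms proj_eq_iff by fastforce
  then show ?thesis
    using proj_in_frontier[OF assms] proj_dot[of _ x]
    by (auto simp: outnormal_def inverse_eq_divide intro!: divide_nonpos_nonneg)
qed

text \<open>The centre \<open>c\<close> of the sphere touching at \<open>p\<close> is unknown, but
  the point \<open>c + r *\<^sub>R n\<close> of its closed ball lies behind the supporting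
  hyperplane. So p - c, of length at most r, has component at least r along \<open>n\<close>, which
  forces p - c = r n.\<close>

lemma outnormal_ball:
  assumes "outnormal p n" shows "ball (p - r *\<^sub>R n) r \<subseteq> \<Omega>"
proof -
  have pf: "p \<in> frontier \<Omega>" and n: "norm n = 1" and le: "\<And>y. y \<in> closure \<Omega> \<Longrightarrow> (y - p) \<bullet> n \<le> 0"
    using assms by (auto simp: outnormal_def)
  obtain c where c: "ball c r \<subseteq> \<Omega>" "cball c r \<inter> frontier \<Omega> = {p}"
    using sphere pf unfolding interior_sphere_def by blast
  have cp: "norm (p - c) \<le> r"
    using c(2) by (auto simp: dist_norm norm_minus_commute)
  have "cball c r \<subseteq> closure \<Omega>"
    using closure_mono[OF c(1)] r_pos by simp
  moreover have "c + r *\<^sub>R n \<in> cball c r" using n r_pos by (simp add: dist_norm)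
  ultimately have "(c + r *\<^sub>R n - p) \<bullet> n \<le> 0" using le by blast
  then have "r \<le> (p - c) \<bullet> n" using n by (simp add: inner_diff_left inner_add_left dot_square_norm)
  have "(norm (p - c - r *\<^sub>R n))\<^sup>2 = (norm (p - c))\<^sup>2 - 2 * r * ((p - c) \<bullet> n) + r\<^sup>2"
    unfolding power2_norm_eq_inner using n
    by (simp add: inner_diff_left inner_diff_right inner_commute norm_eq_1 power2_eq_square algebra_simps)
  also have "\<dots> \<le> r\<^sup>2 - 2 * r * r + r\<^sup>2"
    using mult_left_mono[OF \<open>r \<le> (p - c) \<bullet> n\<close>, of "2 * r"] power_mono[OF cp, of 2] r_pos
    by (smt (verit) norm_ge_zero)
  finally have "(norm (p - c - r *\<^sub>R n))\<^sup>2 \<le> 0" by (simp add: power2_eq_square)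
  then have "p - c - r *\<^sub>R n = 0" by simp
  then have "c = p - r *\<^sub>R n" by (simp add: algebra_simps)
  then show ?thesis using c by simp
qed

text \<open>The closed inner ball at \<open>p\<close> contains
  \<open>p - r *\<^sub>R n + r *\<^sub>R m\<close>, which must lie behind the hyperplane at
  \<open>q\<close>. Adding the inequality with the roles exchanged gives r |n - m|^2 <= (p - q) . (n
  - m).\<close>

lemma outnormal_lipschitz:
  assumes "outnormal p n" "outnormal q m"
  shows "r * norm (n - m) \<le> norm (p - q)"
proof -
  have *: "(p - q) \<bullet> m + r * (1 - n \<bullet> m) \<le> 0" if "outnormal p n" "outnormal q m" for p n q m
  proof -
    have nm: "norm n = 1" "norm m = 1" using that by (auto simp: outnormal_def)
    have "cball (p - r *\<^sub>R n) r \<subseteq> closure \<Omega>"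
      using closure_mono[OF outnormal_ball[OF that(1)]] r_pos by simp
    moreover have "p - r *\<^sub>R n + r *\<^sub>R m \<in> cball (p - r *\<^sub>R n) r"
      using nm r_pos by (simp add: dist_norm)
    ultimately have "(p - r *\<^sub>R n + r *\<^sub>R m - q) \<bullet> m \<le> 0"
      using that(2) by (auto simp: outnormal_def)
    then show ?thesis using nm by (simp add: inner_diff_left inner_add_left algebra_simps norm_eq_1)
  qed
  have nm: "norm n = 1" "norm m = 1" using assms by (auto simp: outnormal_def)
  have "(norm (n - m))\<^sup>2 = 2 * (1 - n \<bullet> m)"
    using nm by (simp add: power2_norm_eq_inner inner_diff_left inner_diff_right inner_commute norm_eq_1)
  then have "r * (norm (n - m))\<^sup>2 = 2 * (r * (1 - n \<bullet> m))" by simp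
  also have "\<dots> \<le> (p - q) \<bullet> (n - m)"
    using *[OF assms] *[OF assms(2,1)]
    by (simp add: inner_diff_left inner_diff_right inner_commute algebra_simps)
  also have "\<dots> \<le> norm (p - q) * norm (n - m)" by (rule norm_cauchy_schwarz)
  finally have "(r * norm (n - m)) * norm (n - m) \<le> norm (p - q) * norm (n - m)"
    by (simp add: power2_eq_square)
  then show ?thesis
    by (cases "n = m") (auto simp: mult_le_cancel_right)
qed

text \<open>The ball of radius \<open>s\<close> about \<open>p - s *\<^sub>R n\<close> is internally
  tangent at \<open>p\<close> to the inner ball and so lies in \<Omega>. Since \<open>p\<close> is
  at distance \<open>s\<close>, the depth of a reflected point is exactly \<open>s\<close>.\<close>

lemma outnormal_depth:
  assumes "outnormal p n" "0 \<le> s" "s \<le> r" "z \<notin> \<Omega>"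
  shows "s \<le> norm (z - (p - s *\<^sub>R n))"
proof (rule ccontr)
  assume *: "\<not> ?thesis"
  have n: "norm n = 1" using assms by (auto simp: outnormal_def)
  have "norm (z - (p - r *\<^sub>R n)) \<le> norm (z - (p - s *\<^sub>R n)) + norm ((r - s) *\<^sub>R n)"
    by (rule order_trans[OF _ norm_triangle_ineq]) (simp add: algebra_simps)
  also have "\<dots> < r" using * n assms by simp
  finally have "z \<in> ball (p - r *\<^sub>R n) r" by (simp add: dist_norm norm_minus_commute)
  then show False using outnormal_ball[OF assms(1)] assms(4) by auto
qed

lemma reflect_outer_eq:
  assumes "x \<notin> closure \<Omega>"
  obtains n where "outnormal (proj x) n" "x = proj x + norm (x - proj x) *\<^sub>R n"
    "reflect x = proj x - norm (x - proj x) *\<^sub>R n" "0 < norm (x - proj x)"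
proof
  have "x - proj x \<noteq> 0" using assms proj_eq_iff by fastforce
  then show "0 < norm (x - proj x)" by simp
  then show eq: "x = proj x + norm (x - proj x) *\<^sub>R ((x - proj x) /\<^sub>R norm (x - proj x))"
    by simp
  have "norm (x - proj x) *\<^sub>R ((x - proj x) /\<^sub>R norm (x - proj x)) = x - proj x"
    using eq by (metis add_diff_cancel_left')
  then show "reflect x = proj x - norm (x - proj x) *\<^sub>R ((x - proj x) /\<^sub>R norm (x - proj x))"
    by (simp only: reflect_def) (simp add: algebra_simps scaleR_2)
qed (rule outnormal_proj[OF assms])

lemma reflect_in_dom:
  assumes "x \<notin> closure \<Omega>" "norm (x - proj x) < r" shows "reflect x \<in> \<Omega>"
proof -
  obtain n where n: "outnormal (proj x) n" "reflect x = proj x - norm (x - proj x) *\<^sub>R n" "0 < norm (x - proj x)"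
    using reflect_outer_eq[OF assms(1)] by metis
  have "norm n = 1" using n by (auto simp: outnormal_def)
  have "reflect x - (proj x - r *\<^sub>R n) = (r - norm (x - proj x)) *\<^sub>R n"
    using n by (simp add: algebra_simps)
  then have "norm (reflect x - (proj x - r *\<^sub>R n)) < r"
    using assms n \<open>norm n = 1\<close> by simp
  then show ?thesis using outnormal_ball[OF n(1)] by (auto simp: dist_norm norm_minus_commute)
qed

text \<open>Write D = |R x - R y|. Comparing depths gives |s - t| <= D. In the expansion of p - q
  the term with n - m is at most |p - q| / 2, because s <= r/2, and is absorbed, leaving |p - q| <=
  4 D. Finally x - y = 2 (p - q) - (R x - R y), so 9 = 2 * 4 + 1.\<close>

lemma reflect_inverse_lipschitz:
  assumes x: "x \<notin> closure \<Omega>" "norm (x - proj x) \<le> r / 2"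
    and y: "y \<notin> closure \<Omega>" "norm (y - proj y) \<le> r / 2"
  shows "norm (x - y) \<le> 9 * norm (reflect x - reflect y)"
proof -
  define s t p q where "s = norm (x - proj x)" "t = norm (y - proj y)" "p = proj x" "q = proj y"
  note d = this
  obtain n where n: "outnormal p n" "reflect x = p - s *\<^sub>R n" "0 < s"
    using reflect_outer_eq[OF x(1)] d by metis
  obtain m where m: "outnormal q m" "reflect y = q - t *\<^sub>R m" "0 < t"
    using reflect_outer_eq[OF y(1)] d by metis
  have nm: "norm n = 1" "norm m = 1" using n m by (auto simp: outnormal_def)
  let ?D = "norm (reflect x - reflect y)"
  have pq: "p \<notin> \<Omega>" "q \<notin> \<Omega>" using n m by (auto simp: outnormal_def frontier_dom)
  \<comment> \<open>\<open>p\<close> lies outside \<Omega>, so its distance to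
    \<open>reflect y\<close> is at least the depth \<open>t\<close> of that point; likewise for
    \<open>q\<close> and \<open>s\<close>.\<close>
  have "t \<le> norm (p - reflect y)" "s \<le> norm (q - reflect x)"
    using outnormal_depth[OF m(1), of t p] outnormal_depth[OF n(1), of s q] pq x y m n r_pos d by auto
  moreover have "norm (p - reflect y) \<le> norm (p - reflect x) + ?D"
    "norm (q - reflect x) \<le> norm (q - reflect y) + ?D"
    using norm_triangle_ineq[of "p - reflect x" "reflect x - reflect y"]
      norm_triangle_ineq[of "q - reflect y" "reflect y - reflect x"] by (auto simp: norm_minus_commute)
  moreover have "norm (p - reflect x) = s" "norm (q - reflect y) = t"
    using nm n m by auto
  ultimately have st: "\<bar>s - t\<bar> \<le> ?D" by linarith
  have "p - q = (reflect x - reflect y) + (s - t) *\<^sub>R m + s *\<^sub>R (n - m)"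
    using n m by (simp add: algebra_simps)
  then have "norm (p - q) \<le> ?D + \<bar>s - t\<bar> * norm m + s * norm (n - m)"
    using n(3) norm_triangle_ineq[of "reflect x - reflect y + (s - t) *\<^sub>R m" "s *\<^sub>R (n - m)"]
      norm_triangle_ineq[of "reflect x - reflect y" "(s - t) *\<^sub>R m"] by simp
  moreover have "s * norm (n - m) \<le> norm (p - q) / 2"
  proof -
    have "s * norm (n - m) \<le> r / 2 * norm (n - m)"
      using x d by (intro mult_right_mono) auto
    then show ?thesis using outnormal_lipschitz[OF n(1) m(1)] by linarith
  qed
  ultimately have "norm (p - q) \<le> 4 * ?D" using st nm by simp
  moreover have "x - y = 2 *\<^sub>R (p - q) - (reflect x - reflect y)"
    by (simp add: reflect_def d algebra_simps)
  then have "norm (x - y) \<le> 2 * norm (p - q) + ?D"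
    by (metis norm_triangle_ineq4 norm_scaleR abs_numeral)
  ultimately show ?thesis by linarith
qed

text \<open>If 0 is in \<Omega> it lies behind every supporting hyperplane, so p . n >= 0. Otherwise
  a nearest boundary point \<open>q\<close> has norm \<open>d0\<close> and lies behind the
  hyperplane at \<open>p\<close>. The absolute value keeps the bound true for any real
  \<open>d0\<close> in the first case.\<close>

lemma outnormal_lower:
  assumes "outnormal p n" "0 \<in> \<Omega> \<or> infdist 0 (frontier \<Omega>) = d0"
  shows "- \<bar>d0\<bar> \<le> p \<bullet> n"
proof (cases "0 \<in> \<Omega>")
  case True
  then show ?thesis using assms(1) dom_subset_closure by (fastforce simp: outnormal_def)
next
  case False
  have n: "norm n = 1" "\<And>y. y \<in> closure \<Omega> \<Longrightarrow> (y - p) \<bullet> n \<le> 0" "frontier \<Omega> \<noteq> {}"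
    using assms(1) by (auto simp: outnormal_def)
  then obtain q where q: "q \<in> frontier \<Omega>" "infdist 0 (frontier \<Omega>) = dist 0 q"
    using infdist_attains_inf[of "frontier \<Omega>" 0] by auto
  then have "norm q = d0" using False assms(2) by simp
  moreover have "(q - p) \<bullet> n \<le> 0" using q n frontier_dom by auto
  moreover have "\<bar>q \<bullet> n\<bar> \<le> norm q" using Cauchy_Schwarz_ineq2[of q n] n by simp
  ultimately show ?thesis by (simp add: inner_diff_left)
qed

lemma norm_reflect_le:
  assumes "0 \<in> \<Omega> \<or> infdist 0 (frontier \<Omega>) = d0" "norm (x - proj x) \<le> r / 2"
  shows "(norm (reflect x))\<^sup>2 \<le> (norm x)\<^sup>2 + 2 * r * \<bar>d0\<bar>"
proof (cases "x \<in> closure \<Omega>")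
  case True
  then show ?thesis using r_pos by (simp add: reflect_self)
next
  case False
  define s p where "s = norm (x - proj x)" "p = proj x"
  obtain n where n: "outnormal p n" "x = p + s *\<^sub>R n" "reflect x = p - s *\<^sub>R n" "0 < s"
    using reflect_outer_eq[OF False] s_p_def by metis
  have "(norm (reflect x))\<^sup>2 - (norm x)\<^sup>2 = 4 * s * (- (p \<bullet> n))"
    unfolding n(3) power2_norm_eq_inner by (subst (1 2) n(2)) (simp add: inner_diff inner_add inner_commute algebra_simps)
  also have "\<dots> \<le> 4 * s * \<bar>d0\<bar>"
    using outnormal_lower[OF n(1) assms(1)] n(4) by (intro mult_left_mono) auto
  also have "\<dots> \<le> 4 * (r / 2) * \<bar>d0\<bar>"
    using assms(2) s_p_def by (intro mult_right_mono mult_left_mono) auto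
  finally show ?thesis by simp
qed

end

text \<open>Unlike in the inverse function theorem, \<open>F (Z y)\<close> only has to move affinely, inside a subspace.\<close>

lemma has_derivative_right_inverse:
  fixes F :: "'b::real_normed_vector \<Rightarrow> 'c::real_normed_vector" and Z :: "'a::real_normed_vector \<Rightarrow> 'b"
  assumes F: "(F has_derivative D) (at (Z x))" and D': "bounded_linear D'" "\<And>z. D' (D z) = z"
    and Z: "isCont Z x" and J: "bounded_linear J"
    and ev: "eventually (\<lambda>y. F (Z y) - F (Z x) = J (y - x)) (nhds x)"
  shows "(Z has_derivative (\<lambda>h. D' (J h))) (at x)"
  unfolding has_derivative_at_alt
proof (intro conjI allI impI)
  show bl: "bounded_linear (\<lambda>h. D' (J h))" by (rule bounded_linear_compose[OF D'(1) J])
  fix e :: real assume e: "e > 0"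
  obtain B where B: "B > 0" "\<And>z. norm (D' z) \<le> norm z * B"
    using bounded_linear.pos_bounded[OF D'(1)] by blast
  obtain M where M: "M > 0" "\<And>h. norm (D' (J h)) \<le> norm h * M"
    using bounded_linear.pos_bounded[OF bl] by blast
  \<comment> \<open>The first bound makes the error at most half of |Z y - Z x|, so the increment of
    \<open>Z\<close> is controlled by that of \<open>y\<close>; the second then makes the error at
    most e |y - x|.\<close>
  define e' where "e' = min (1 / (2 * B)) (e / (2 * M * B))"
  have e': "e' > 0" "B * e' \<le> 1 / 2" "B * e' * (2 * M) \<le> e"
    using B M e by (auto simp: e'_def min_def field_simps)
  obtain d where d: "d > 0" "\<And>z. norm (z - Z x) < d \<Longrightarrow> norm (F z - F (Z x) - D (z - Z x)) \<le> e' * norm (z - Z x)"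
    using F e'(1) unfolding has_derivative_at_alt by blast
  have "eventually (\<lambda>y. norm (Z y - Z x) < d) (nhds x)"
    using Z d(1) unfolding isCont_def tendsto_at_iff_tendsto_nhds
    by (auto dest!: tendstoD simp: dist_norm)
  with ev have "eventually (\<lambda>y. F (Z y) - F (Z x) = J (y - x) \<and> norm (Z y - Z x) < d) (nhds x)"
    by (rule eventually_conj)
  then obtain d' where d': "d' > 0" "\<And>y. norm (y - x) < d' \<Longrightarrow> F (Z y) - F (Z x) = J (y - x) \<and> norm (Z y - Z x) < d"
    unfolding eventually_nhds_metric by (auto simp: dist_norm)
  show "\<exists>d>0. \<forall>y. norm (y - x) < d \<longrightarrow> norm (Z y - Z x - D' (J (y - x))) \<le> e * norm (y - x)"
  proof (intro exI[of _ d'] conjI allI impI d')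
    fix y assume y: "norm (y - x) < d'"
    define w where "w = Z y - Z x"
    \<comment> \<open>\<open>D'\<close> undoes \<open>D\<close>, so the error of \<open>Z\<close> is
      \<open>D'\<close> applied to the first-order remainder of \<open>F\<close>. Its size involves
      |Z y - Z x|, which is still to be bounded.\<close>
    have "D' (J (y - x)) - w = D' (F (Z y) - F (Z x) - D w)"
      using d'(2)[OF y] D'(2) by (simp add: linear_diff bounded_linear.linear[OF D'(1)])
    then have "norm (w - D' (J (y - x))) \<le> norm (F (Z y) - F (Z x) - D w) * B"
      by (metis B(2) norm_minus_commute)
    also have "\<dots> \<le> (e' * norm w) * B"
      using d(2)[of "Z y"] d'(2)[OF y] B(1) unfolding w_def by (intro mult_right_mono) auto
    finally have 1: "norm (w - D' (J (y - x))) \<le> B * e' * norm w" by (simp add: mult_ac)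
    also have "\<dots> \<le> 1 / 2 * norm w" by (rule mult_right_mono[OF e'(2)]) simp
    finally have "norm w \<le> 2 * norm (D' (J (y - x)))"
      using norm_triangle_ineq2[of w "D' (J (y - x))"] by linarith
    then have "norm w \<le> (2 * M) * norm (y - x)" using M(2)[of "y - x"] by (simp add: mult_ac)
    then have "B * e' * norm w \<le> B * e' * ((2 * M) * norm (y - x))"
      using B e' by (intro mult_left_mono) auto
    also have "\<dots> = (B * e' * (2 * M)) * norm (y - x)" by simp
    also have "\<dots> \<le> e * norm (y - x)" by (rule mult_right_mono[OF e'(3)]) simp
    finally show "norm (Z y - Z x - D' (J (y - x))) \<le> e * norm (y - x)"
      using 1 by (simp add: w_def)
  qed
qed

section \<open>The C^2 boundary and differentiability of the projection\<close>

context convex_sphere_domain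
begin

text \<open>A positive value would separate \<open>q\<close> from \<Omega> by a neighbourhood, a
  negative one would put \<open>q\<close> into the open set \<Omega>.\<close>

lemma defining_function_zero:
  assumes V: "open V" "\<Omega> \<inter> V = {y\<in>V. \<phi> y < (0::real)}"
    and \<phi>: "\<And>y. y \<in> V \<Longrightarrow> (\<phi> has_derivative (\<lambda>h. G y \<bullet> h)) (at y)"
    and q: "q \<in> V" "q \<in> frontier \<Omega>"
  shows "\<phi> q = 0"
proof (rule antisym)
  show "\<phi> q \<le> 0"
  proof (rule ccontr)
    assume "\<not> ?thesis"
    moreover have "isCont \<phi> q" using \<phi>[OF q(1)] has_derivative_continuous by blast
    ultimately have "eventually (\<lambda>y. \<phi> y > 0) (nhds q)"
      unfolding isCont_def tendsto_at_iff_tendsto_nhds by (auto intro: order_tendstoD)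
    moreover have "eventually (\<lambda>y. y \<in> V) (nhds q)" using V q by (simp add: eventually_nhds_in_open)
    ultimately have "eventually (\<lambda>y. y \<notin> \<Omega>) (nhds q)"
      by eventually_elim (metis (mono_tags, lifting) IntI V(2) mem_Collect_eq not_less_iff_gr_or_eq)
    then obtain W where "open W" "q \<in> W" "W \<inter> \<Omega> = {}"
      unfolding eventually_nhds by blast
    then show False using q(2) frontier_dom open_Int_closure_eq_empty by blast
  qed
  show "\<phi> q \<ge> 0" using q V(2) frontier_dom by fastforce
qed

text \<open>Every direction \<open>h\<close> in which \<phi> decreases enters \<Omega>, hence does
  not point beyond the supporting hyperplane. One half-space inside another with the same boundary
  point leaves only one unit normal.\<close>

lemma outnormal_unique_gradient:
  assumes V: "open V" "\<Omega> \<inter> V = {y\<in>V. \<phi> y < (0::real)}"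
    and \<phi>: "\<And>y. y \<in> V \<Longrightarrow> (\<phi> has_derivative (\<lambda>h. G y \<bullet> h)) (at y)"
    and q: "q \<in> V" "G q \<noteq> 0" "outnormal q m"
  shows "G q = norm (G q) *\<^sub>R m"
proof -
  have m: "norm m = 1" "\<And>y. y \<in> closure \<Omega> \<Longrightarrow> (y - q) \<bullet> m \<le> 0" "q \<in> frontier \<Omega>"
    using q(3) by (auto simp: outnormal_def)
  have le: "h \<bullet> m \<le> 0" if h: "G q \<bullet> h < 0" for h
  proof -
    have "((\<lambda>t. \<phi> (q + t *\<^sub>R h)) has_derivative (\<lambda>t. G q \<bullet> (t *\<^sub>R h))) (at 0)"
      by (rule has_derivative_compose[of "\<lambda>t. q + t *\<^sub>R h" "\<lambda>t. t *\<^sub>R h" 0 UNIV \<phi>, simplified])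
        (use \<phi>[OF q(1)] in \<open>auto intro!: derivative_eq_intros\<close>)
    then have "((\<lambda>t. \<phi> (q + t *\<^sub>R h)) has_real_derivative (G q \<bullet> h)) (at 0)"
      by (rule has_derivative_imp_has_field_derivative) simp
    from DERIV_neg_dec_right[OF this h] obtain d where d: "d > 0"
      "\<And>t. t > 0 \<Longrightarrow> t < d \<Longrightarrow> \<phi> (q + t *\<^sub>R h) < 0"
      using defining_function_zero[OF V \<phi> q(1) m(3)] by auto
    have "((\<lambda>t. q + t *\<^sub>R h) \<longlongrightarrow> q + 0 *\<^sub>R h) (at_right 0)"
      by (intro tendsto_intros)
    then have "eventually (\<lambda>t. q + t *\<^sub>R h \<in> V) (at_right 0)"
      using V(1) q(1) by (simp add: topological_tendstoD)
    moreover have "eventually (\<lambda>t. t > 0 \<and> t < d) (at_right (0::real))"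
      using d(1) by (auto simp: eventually_at_right_field)
    ultimately have "eventually (\<lambda>t. t > 0 \<and> q + t *\<^sub>R h \<in> \<Omega>) (at_right 0)"
      by eventually_elim (use d V(2) in auto)
    then obtain t where t: "t > 0" "q + t *\<^sub>R h \<in> \<Omega>"
      using eventually_happens'[OF trivial_limit_at_right_real] by blast
    then have "t * (h \<bullet> m) \<le> 0" using m(2)[OF dom_subset_closure[OF t(2)]] by simp
    then show ?thesis using t by (simp add: mult_le_0_iff)
  qed
  define k where "k = G q /\<^sub>R norm (G q)"
  have k: "norm k = 1" "G q = norm (G q) *\<^sub>R k" using q(2) by (auto simp: k_def)
  \<comment> \<open>The direction m - k is decisive: if k . m < 1 it decreases \<phi> to first
    order, yet points to the outer side of the hyperplane.\<close>
  have "m \<bullet> k \<ge> 1"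
  proof (rule ccontr)
    assume *: "\<not> ?thesis"
    have "k \<bullet> (m - k) < 0" using * k(1) by (simp add: inner_diff inner_commute norm_eq_1)
    then have "G q \<bullet> (m - k) < 0" using q(2)
      by (subst k(2)) (simp add: mult_pos_neg)
    from le[OF this] show False using m(1) * by (simp add: inner_diff inner_commute norm_eq_1)
  qed
  then have "(norm (m - k))\<^sup>2 \<le> 0"
    using k(1) m(1) by (simp add: power2_norm_eq_inner inner_diff inner_commute norm_eq_1)
  then have "m = k" by simp
  then show ?thesis using k(2) by simp
qed

text \<open>Otherwise the boundary would bend so that points of the open set \<open>\<Omega>\<close> lie on its supporting hyperplane.\<close>

lemma tangential_hessian_nonneg:
  assumes V: "open V" "\<Omega> \<inter> V = {y\<in>V. \<phi> y < (0::real)}"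
    and \<phi>: "\<And>y. y \<in> V \<Longrightarrow> (\<phi> has_derivative (\<lambda>h. G y \<bullet> h)) (at y)"
    and G: "(G has_derivative H) (at q)"
    and q: "q \<in> V" "G q \<noteq> 0" "outnormal q m" and h: "G q \<bullet> h = 0"
  shows "H h \<bullet> h \<ge> 0"
proof (rule ccontr)
  assume neg: "\<not> ?thesis"
  have m: "norm m = 1" "\<And>y. y \<in> closure \<Omega> \<Longrightarrow> (y - q) \<bullet> m \<le> 0" "q \<in> frontier \<Omega>"
    using q(3) by (auto simp: outnormal_def)
  have hm: "h \<bullet> m = 0"
    using h outnormal_unique_gradient[OF V \<phi> q] q(2)
    by (metis inner_commute inner_scaleR_left mult_eq_0_iff norm_eq_zero)
  let ?c = "\<lambda>t. q + t *\<^sub>R h"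
  have c': "(?c has_derivative (\<lambda>t. t *\<^sub>R h)) (at t)" for t
    by (auto intro!: derivative_eq_intros)
  have d1: "((\<lambda>t. \<phi> (?c t)) has_real_derivative (G (?c t) \<bullet> h)) (at t)" if "?c t \<in> V" for t
    by (rule has_derivative_imp_has_field_derivative[OF has_derivative_compose[OF c' \<phi>[OF that]]]) simp
  have "((\<lambda>t. G (?c t)) has_derivative (\<lambda>t. H (t *\<^sub>R h))) (at 0)"
    by (rule has_derivative_compose[OF c']) (use G in simp)
  then have "((\<lambda>t. G (?c t) \<bullet> h) has_derivative (\<lambda>t. H (t *\<^sub>R h) \<bullet> h)) (at 0)"
    by (rule has_derivative_inner_left)
  moreover have "H (t *\<^sub>R h) = t *\<^sub>R H h" for t
    using has_derivative_bounded_linear[OF G] by (simp add: linear_simps)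
  ultimately have "((\<lambda>t. G (?c t) \<bullet> h) has_real_derivative (H h \<bullet> h)) (at 0)"
    by (intro has_derivative_imp_has_field_derivative) simp_all
  \<comment> \<open>Along the tangent line \<phi> starts at 0 with slope 0, and a negative second
    derivative makes the slope negative immediately afterwards.\<close>
  from DERIV_neg_dec_right[OF this] neg h obtain d where d: "d > 0"
    "\<And>t. t > 0 \<Longrightarrow> t < d \<Longrightarrow> G (?c t) \<bullet> h < 0"
    by auto
  have "(?c \<longlongrightarrow> q + 0 *\<^sub>R h) (nhds 0)"
    by (intro tendsto_intros filterlim_ident)
  then have "eventually (\<lambda>t. ?c t \<in> V) (nhds 0)"
    using V(1) q(1) by (simp add: topological_tendstoD)
  then obtain d' where d': "d' > 0" "\<And>t. \<bar>t\<bar> < d' \<Longrightarrow> ?c t \<in> V"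
    unfolding eventually_nhds_metric by (auto simp: dist_norm)
  define t where "t = min d d' / 2"
  have t: "t > 0" "t < d" "t < d'" using d d' by (auto simp: t_def)
  have "\<exists>z>0. z < t \<and> \<phi> (?c t) - \<phi> (?c 0) = (t - 0) * (G (?c z) \<bullet> h)"
    by (rule MVT2[OF t(1)]) (use d' t in \<open>auto intro!: d1\<close>)
  then obtain z where z: "z > 0" "z < t" "\<phi> (?c t) - \<phi> (?c 0) = t * (G (?c z) \<bullet> h)" by auto
  have "\<phi> (?c t) < 0"
    using z d(2)[of z] t defining_function_zero[OF V \<phi> q(1) m(3)]
    by (simp add: mult_pos_neg)
  then have "?c t \<in> \<Omega>" using V(2) d'(2)[of t] t by auto
  then obtain e where e: "e > 0" "ball (?c t) e \<subseteq> \<Omega>"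
    using open_dom open_contains_ball by blast
  have "?c t + (e / 2) *\<^sub>R m \<in> ball (?c t) e" using e m by (simp add: dist_norm)
  then have "(?c t + (e / 2) *\<^sub>R m - q) \<bullet> m \<le> 0"
    using e m(2) dom_subset_closure by blast
  then show False using hm m(1) e by (simp add: inner_add_left norm_eq_1)
qed

text \<open>With the multiplier as an additional unknown, continuity of \<open>proj\<close> and
  injectivity of the derivative \<open>D\<close> are what
  \<open>has_derivative_right_inverse\<close> asks for. The multiplier \<open>\<Lambda> y\<close> is
  the distance from \<open>y\<close> to the set, divided by the length of the gradient.\<close>

lemma proj_differentiable:
  assumes C2: "C2_boundary \<Omega>" and x: "x \<notin> closure \<Omega>"
  shows "proj differentiable (at x)"
proof -
  define p where "p = proj x"
  have pf: "p \<in> frontier \<Omega>" using proj_in_frontier[OF x] by (simp add: p_def)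
  from C2[unfolded C2_boundary_def, rule_format, OF pf]
  obtain V \<phi> G H where *: "open V \<and> p \<in> V \<and>
      (\<forall>y\<in>V. (\<phi> has_derivative (\<lambda>h. G y \<bullet> h)) (at y)) \<and>
      (\<forall>y\<in>V. (G has_derivative blinfun_apply (H y)) (at y)) \<and>
      continuous_on V H \<and> (\<forall>y\<in>V. G y \<noteq> 0) \<and> \<Omega> \<inter> V = {y\<in>V. \<phi> y < 0}"
    by (elim exE)
  then have V: "open V" "p \<in> V"
    and \<phi>: "\<And>y. y \<in> V \<Longrightarrow> (\<phi> has_derivative (\<lambda>h. G y \<bullet> h)) (at y)"
    and G: "\<And>y. y \<in> V \<Longrightarrow> (G has_derivative blinfun_apply (H y)) (at y)"
    and G0: "\<And>y. y \<in> V \<Longrightarrow> G y \<noteq> (0::'a)" and \<Omega>V: "\<Omega> \<inter> V = {y\<in>V. \<phi> y < (0::real)}"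
    by auto
  define \<Lambda> where "\<Lambda> y = norm (y - proj y) / norm (G (proj y))" for y
  define Z where "Z y = (proj y, \<Lambda> y)" for y
  \<comment> \<open>Lagrange multipliers: \<open>(proj y, \<Lambda> y)\<close> solves \<open>F (q, \<lambda>) = (y, 0)\<close>, and convexity makes \<open>DF\<close> injective.\<close>
  define F where "F z = (fst z + snd z *\<^sub>R G (fst z), \<phi> (fst z))" for z
  have eq: "proj y + \<Lambda> y *\<^sub>R G (proj y) = y" "\<phi> (proj y) = 0"
    if y: "y \<notin> closure \<Omega>" "proj y \<in> V" for y
  proof -
    obtain n where n: "outnormal (proj y) n" "y = proj y + norm (y - proj y) *\<^sub>R n"
      using reflect_outer_eq[OF y(1)] by metis
    show "\<phi> (proj y) = 0" using defining_function_zero[OF V(1) \<Omega>V \<phi> y(2)] n(1) by (simp add: outnormal_def)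
    have "G (proj y) = norm (G (proj y)) *\<^sub>R n"
      by (rule outnormal_unique_gradient[OF V(1) \<Omega>V \<phi> y(2) G0[OF y(2)] n(1)])
    then have "\<Lambda> y *\<^sub>R G (proj y) = (\<Lambda> y * norm (G (proj y))) *\<^sub>R n" by (metis scaleR_scaleR)
    also have "\<Lambda> y * norm (G (proj y)) = norm (y - proj y)" using G0[OF y(2)] by (simp add: \<Lambda>_def)
    finally show "proj y + \<Lambda> y *\<^sub>R G (proj y) = y" using n(2) by simp
  qed
  have contp: "isCont proj y" for y
    using continuous_proj[of UNIV] by (simp add: continuous_on_eq_continuous_at)
  have ev: "eventually (\<lambda>y. F (Z y) - F (Z x) = (y - x, 0)) (nhds x)"
  proof -
    have "eventually (\<lambda>y. y \<in> - closure \<Omega>) (nhds x)"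
      using x by (intro eventually_nhds_in_open) auto
    moreover have "eventually (\<lambda>y. proj y \<in> V) (nhds x)"
      using contp[of x] V unfolding isCont_def tendsto_at_iff_tendsto_nhds
      by (auto intro: topological_tendstoD simp: p_def)
    ultimately show ?thesis
      by eventually_elim (use eq x V in \<open>simp add: F_def Z_def p_def\<close>)
  qed
  obtain n where n: "outnormal p n" using reflect_outer_eq[OF x] p_def by metis
  have \<Lambda>: "\<Lambda> x \<ge> 0" by (simp add: \<Lambda>_def)
  define D where "D = (\<lambda>z. (fst z + \<Lambda> x *\<^sub>R H p (fst z) + snd z *\<^sub>R G p, G p \<bullet> fst z))"
  have FD: "(F has_derivative D) (at (Z x))"
  proof -
    have fst': "(fst has_derivative fst) (at (Z x))" and snd': "(snd has_derivative snd) (at (Z x))"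
      by (rule bounded_linear_imp_has_derivative, rule bounded_linear_fst bounded_linear_snd)+
    have "(G has_derivative blinfun_apply (H p)) (at (fst (Z x)))" using G[OF V(2)] by (simp add: Z_def p_def)
    note G' = has_derivative_compose[OF fst' this]
    have "(\<phi> has_derivative (\<lambda>h. G p \<bullet> h)) (at (fst (Z x)))" using \<phi>[OF V(2)] by (simp add: Z_def p_def)
    note \<phi>' = has_derivative_compose[OF fst' this]
    show ?thesis unfolding F_def
      by (rule has_derivative_eq_rhs[OF has_derivative_Pair[OF
            has_derivative_add[OF fst' has_derivative_scaleR[OF snd' G']] \<phi>']])
        (simp add: D_def Z_def p_def fun_eq_iff algebra_simps)
  qed
  have linD: "linear D" using has_derivative_bounded_linear[OF FD] by (rule bounded_linear.linear)
  have injD: "inj D"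
    unfolding linear_injective_0[OF linD]
  proof (intro allI impI)
    fix z assume "D z = 0"
    then obtain h \<mu> where z: "z = (h, \<mu>)" and 1: "h + \<Lambda> x *\<^sub>R H p h + \<mu> *\<^sub>R G p = 0" and 2: "G p \<bullet> h = 0"
      by (cases z) (auto simp: D_def zero_prod_def)
    have "H p h \<bullet> h \<ge> 0"
      by (rule tangential_hessian_nonneg[OF V(1) \<Omega>V \<phi> G[OF V(2)] V(2) G0[OF V(2)] n 2])
    \<comment> \<open>Pairing the first component with the tangential \<open>h\<close> removes the
      multiplier term. Both remaining terms are nonnegative, so \<open>h\<close> vanishes, and then
      so does \<open>\<mu>\<close> because the gradient is nonzero.\<close>
    moreover have "h \<bullet> h + \<Lambda> x * (H p h \<bullet> h) = 0"
      using arg_cong[OF 1, of "\<lambda>v. v \<bullet> h"] 2 by (simp add: inner_add_left)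
    ultimately have "h \<bullet> h \<le> 0" using \<Lambda> by (smt (verit) mult_nonneg_nonneg)
    then have "h = 0" by (metis antisym inner_eq_zero_iff inner_ge_zero)
    moreover have "\<mu> = 0" using 1 G0[OF V(2)] \<open>h = 0\<close> by simp
    ultimately show "z = 0" by (simp add: z zero_prod_def)
  qed
  obtain D' where D': "linear D'" "D' \<circ> D = id"
    using linear_injective_left_inverse[OF linD injD] by blast
  have "(Z has_derivative (\<lambda>h. D' (h, 0))) (at x)"
  proof (rule has_derivative_right_inverse[of F D Z x D' "\<lambda>h. (h, 0)", OF FD])
    show "bounded_linear D'" using D'(1) by (simp add: linear_conv_bounded_linear)
    show "D' (D z) = z" for z using D'(2) by (metis comp_apply id_apply)
    have "isCont G (proj x)" using G[OF V(2)] has_derivative_continuous p_def by blast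
    then have "isCont (\<lambda>y. G (proj y)) x" using isCont_o2[OF contp] by blast
    then show "isCont Z x" unfolding Z_def \<Lambda>_def
      using G0[OF V(2)] by (intro continuous_intros contp) (auto simp: p_def)
    show "bounded_linear (\<lambda>h. (h, 0))" by (intro bounded_linear_intros)
  qed (rule ev)
  from has_derivative_fst[OF this] show ?thesis
    by (auto simp: Z_def differentiable_def)
qed

lemma proj_differentiable':
  assumes "C2_boundary \<Omega>" "x \<notin> frontier \<Omega>"
  shows "proj differentiable (at x)"
proof (cases "x \<in> \<Omega>")
  case True
  have "(proj has_derivative (\<lambda>h. h)) (at x)"
    by (rule has_derivative_transform_within_open[OF has_derivative_ident open_dom True])
      (simp add: proj_self dom_subset_closure)
  then show ?thesis by (auto simp: differentiable_def)
next
  case False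
  then show ?thesis using proj_differentiable assms frontier_dom by auto
qed

end

section \<open>The reflected extension\<close>

text \<open>A sequential limit of difference quotients is Borel measurable for every Borel
  \<open>f\<close>. Where \<open>f\<close> is differentiable it is the directional derivative; where
  the limit fails to exist its value is unspecified.\<close>

definition pd :: "('a::euclidean_space \<Rightarrow> 'b::euclidean_space) \<Rightarrow> 'a \<Rightarrow> 'a \<Rightarrow> 'b" where
  "pd f i x = lim (\<lambda>n. (f (x + (1 / real (Suc n)) *\<^sub>R i) - f x) /\<^sub>R (1 / real (Suc n)))"

lemma pd_tendsto:
  assumes "(f has_derivative f') (at x)"
  shows "(\<lambda>n. (f (x + (1 / real (Suc n)) *\<^sub>R i) - f x) /\<^sub>R (1 / real (Suc n))) \<longlonglongrightarrow> f' i"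
proof -
  have "filterlim (\<lambda>n. 1 / real (Suc n)) (at 0) sequentially"
    using LIMSEQ_inverse_real_of_nat by (auto simp: filterlim_at inverse_eq_divide)
  from filterlim_compose[OF has_derivative_difference_quotient[OF assms] this] show ?thesis .
qed

lemma pd_eq: "(f has_derivative f') (at x) \<Longrightarrow> pd f i x = f' i"
  unfolding pd_def by (rule limI) (rule pd_tendsto)

lemma pd_measurable[measurable]:
  fixes f :: "'a::euclidean_space \<Rightarrow> 'b::euclidean_space"
  assumes [measurable]: "f \<in> borel_measurable borel"
  shows "pd f i \<in> borel_measurable borel"
  unfolding pd_def by measurable

lemma pd_norm_le:
  assumes f': "(f has_derivative f') (at x)" and L: "\<And>y. norm (f y - f x) \<le> L * norm (y - x)"
    and i: "norm i = 1"
  shows "norm (pd f i x) \<le> L"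
proof -
  have "norm (f' i) \<le> L"
  proof (rule tendsto_upperbound[OF tendsto_norm[OF pd_tendsto[OF f']]])
    show "\<forall>\<^sub>F n in sequentially. norm ((f (x + (1 / real (Suc n)) *\<^sub>R i) - f x) /\<^sub>R (1 / real (Suc n))) \<le> L"
    proof (intro always_eventually allI)
      fix n
      define t where "t = 1 / real (Suc n)"
      have t: "t > 0" by (simp add: t_def)
      have "norm (f (x + t *\<^sub>R i) - f x) \<le> L * t"
        using L[of "x + t *\<^sub>R i"] i t by simp
      moreover have "norm ((f (x + t *\<^sub>R i) - f x) /\<^sub>R t) = norm (f (x + t *\<^sub>R i) - f x) / t"
        using t by (simp add: divide_inverse mult.commute)
      ultimately have "norm ((f (x + t *\<^sub>R i) - f x) /\<^sub>R t) \<le> L"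
        using t by (simp only: pos_divide_le_eq)
      then show "norm ((f (x + (1 / real (Suc n)) *\<^sub>R i) - f x) /\<^sub>R (1 / real (Suc n))) \<le> L"
        by (simp only: t_def)
    qed
  qed simp
  then show ?thesis using pd_eq[OF f'] by simp
qed

text \<open>Squaring the positive part removes its kink at 0, so a cutoff built on it is
  differentiable also where it starts to vanish.\<close>

lemma has_real_derivative_pos_part_square:
  "((\<lambda>t. (max 0 t)\<^sup>2) has_real_derivative 2 * max 0 t) (at t)" for t :: real
proof -
  consider "t > 0" | "t < 0" | "t = 0" by linarith
  then show ?thesis
  proof cases
    case 1
    have "((\<lambda>t. t\<^sup>2) has_real_derivative 2 * max 0 t) (at t)"
      using 1 by (auto intro!: derivative_eq_intros)
    then show ?thesis
      by (rule has_field_derivative_transform_within_open[of _ _ _ "{0<..}"]) (use 1 in auto)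
  next
    case 2
    have "((\<lambda>t. 0) has_real_derivative 2 * max 0 t) (at t)" using 2 by simp
    then show ?thesis
      by (rule has_field_derivative_transform_within_open[of _ _ _ "{..<0}"]) (use 2 in auto)
  next
    case 3
    have "((\<lambda>h::real. max 0 h) \<longlongrightarrow> max 0 0) (at 0)" by (intro tendsto_intros)
    moreover have "(\<lambda>h::real. (max 0 h)\<^sup>2 / h) = (\<lambda>h. max 0 h)"
      by (auto simp: fun_eq_iff power2_eq_square max_def)
    ultimately have "((\<lambda>h::real. (max 0 h)\<^sup>2 / h) \<longlongrightarrow> 0) (at 0)" by simp
    then show ?thesis using 3 by (simp add: DERIV_def)
  qed
qed

section \<open>The cutoff, and the derivatives of cutoff and reflection\<close>

context convex_sphere_domain
begin

text \<open>The squared distance enters because it is a polynomial expression in \<open>x\<close>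
  and \<open>proj x\<close>, hence differentiable wherever \<open>proj\<close> is; the outer square
  does the same for the positive part.\<close>

definition cutoff :: "'a \<Rightarrow> real" where
  "cutoff x = (max 0 (1 - ((x - proj x) \<bullet> (x - proj x)) / (r / 2)\<^sup>2))\<^sup>2"

lemma cutoff_range: "0 \<le> cutoff x" "cutoff x \<le> 1"
  by (auto simp: cutoff_def intro!: power_le_one)

lemma cutoff_dom: "x \<in> closure \<Omega> \<Longrightarrow> cutoff x = 1"
  by (simp add: cutoff_def proj_self)

lemma cutoff_zero:
  assumes "r / 2 \<le> norm (x - proj x)" shows "cutoff x = 0"
proof -
  have "(r / 2)\<^sup>2 \<le> (norm (x - proj x))\<^sup>2" using assms r_pos by (intro power_mono) auto
  then show ?thesis using r_pos by (simp add: cutoff_def power2_norm_eq_inner)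
qed

lemma dist_proj_lipschitz: "\<bar>norm (x - proj x) - norm (y - proj y)\<bar> \<le> 2 * norm (x - y)"
proof -
  have "\<bar>norm (x - proj x) - norm (y - proj y)\<bar> \<le> norm ((x - proj x) - (y - proj y))"
    by (rule norm_triangle_ineq3)
  also have "\<dots> = norm ((x - y) - (proj x - proj y))" by (simp add: algebra_simps)
  also have "\<dots> \<le> norm (x - y) + norm (proj x - proj y)" by (rule norm_triangle_ineq4)
  finally show ?thesis using proj_lipschitz[of x y] by linarith
qed

text \<open>The cutoff is a^2 with a = 1 - m^2 / h^2, where \<open>m\<close> is the distance
  truncated at h = r/2, so that all factors are bounded. The distance has constant 2 here, so m^2
  has 4 h, \<open>a\<close> has 4 / h, and a^2 has 8 / h = 16 / r.\<close>

lemma cutoff_lipschitz: "\<bar>cutoff x - cutoff y\<bar> \<le> 16 / r * norm (x - y)"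
proof -
  define h where "h = r / 2"
  have h: "h > 0" using r_pos by (simp add: h_def)
  define m where "m x = min h (norm (x - proj x))" for x
  have m: "0 \<le> m x" "m x \<le> h" for x using h by (auto simp: m_def)
  define a where "a x = 1 - (m x)\<^sup>2 / h\<^sup>2" for x
  have a01: "0 \<le> a x" "a x \<le> 1" for x
    using power_mono[OF m(2,1), of x 2] h by (auto simp: a_def)
  have eq: "cutoff x = (a x)\<^sup>2" for x
  proof (cases "norm (x - proj x) \<le> h")
    case True
    then have "a x = 1 - ((x - proj x) \<bullet> (x - proj x)) / h\<^sup>2"
      by (simp add: a_def m_def power2_norm_eq_inner)
    then show ?thesis using a01(1)[of x] by (simp add: cutoff_def h_def max_def)
  next
    case False
    then show ?thesis using h cutoff_zero[of x] by (simp add: a_def m_def h_def)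
  qed
  have "\<bar>(m x)\<^sup>2 - (m y)\<^sup>2\<bar> = (m x + m y) * \<bar>m x - m y\<bar>"
    using m[of x] m[of y] by (simp add: power2_eq_square square_diff_square_factored abs_mult)
  also have "\<dots> \<le> (2 * h) * (2 * norm (x - y))"
    using m[of x] m[of y] dist_proj_lipschitz[of x y] h by (intro mult_mono) (auto simp: m_def)
  finally have "\<bar>a x - a y\<bar> \<le> 4 * h * norm (x - y) / h\<^sup>2"
    using h by (simp add: a_def abs_minus_commute divide_right_mono flip: diff_divide_distrib)
  then have le: "\<bar>a x - a y\<bar> \<le> 4 / h * norm (x - y)" using h by (simp add: power2_eq_square)
  have "\<bar>(a x)\<^sup>2 - (a y)\<^sup>2\<bar> = (a x + a y) * \<bar>a x - a y\<bar>"
    using a01[of x] a01[of y] by (simp add: power2_eq_square square_diff_square_factored abs_mult)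
  also have "\<dots> \<le> 2 * (4 / h * norm (x - y))"
    using a01[of x] a01[of y] le by (intro mult_mono) auto
  finally show ?thesis by (simp add: eq h_def)
qed

lemma continuous_cutoff: "continuous_on S cutoff"
  by (rule lipschitz_on_continuous_on[of "16 / r"])
     (use r_pos cutoff_lipschitz in \<open>auto simp: lipschitz_on_def dist_norm\<close>)

lemma reflect_cutoff_measurable[measurable]:
  "proj \<in> borel_measurable borel" "reflect \<in> borel_measurable borel" "cutoff \<in> borel_measurable borel"
  using continuous_proj continuous_reflect continuous_cutoff
  by (auto intro: borel_measurable_continuous_onI)

lemma reflect_differentiable:
  assumes "C2_boundary \<Omega>" "x \<notin> frontier \<Omega>"
  shows "reflect differentiable (at x)"
  unfolding reflect_def using proj_differentiable'[OF assms] by (intro derivative_intros) auto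

lemma cutoff_differentiable:
  assumes "C2_boundary \<Omega>" "x \<notin> frontier \<Omega>"
  shows "cutoff differentiable (at x)"
proof -
  obtain p' where p': "(proj has_derivative p') (at x)"
    using proj_differentiable'[OF assms] by (auto simp: differentiable_def)
  have "\<exists>D. ((\<lambda>x. 1 - ((x - proj x) \<bullet> (x - proj x)) / (r / 2)\<^sup>2) has_derivative D) (at x)"
    using r_pos by (intro exI) (auto intro!: derivative_eq_intros p')
  then obtain D where "((\<lambda>x. 1 - ((x - proj x) \<bullet> (x - proj x)) / (r / 2)\<^sup>2) has_derivative D) (at x)" ..
  from has_derivative_compose[OF this has_real_derivative_pos_part_square[unfolded has_field_derivative_def]]
  show ?thesis unfolding cutoff_def differentiable_def by blast
qed

text \<open>The values on the null set \<open>frontier \<Omega>\<close>, where \<open>pd\<close> may be a junk limit, are set to 0 so that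
  the bounds below hold everywhere.\<close>

definition dcutoff :: "'a \<Rightarrow> 'a \<Rightarrow> real" where
  "dcutoff i x = (if x \<in> frontier \<Omega> then 0 else pd cutoff i x)"

definition dreflect :: "'a \<Rightarrow> 'a \<Rightarrow> 'a" where
  "dreflect i x = (if x \<in> frontier \<Omega> then 0 else pd reflect i x)"

lemma dcutoff_measurable[measurable]: "dcutoff i \<in> borel_measurable borel" "dreflect i \<in> borel_measurable borel"
  unfolding dcutoff_def dreflect_def by measurable

lemma dcutoff_bounds:
  assumes C2: "C2_boundary \<Omega>" and i: "i \<in> Basis"
  shows "\<bar>dcutoff i x\<bar> \<le> 16 / r" "norm (dreflect i x) \<le> 3"
    "r / 2 < norm (x - proj x) \<Longrightarrow> dcutoff i x = 0"
proof -
  show "\<bar>dcutoff i x\<bar> \<le> 16 / r"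
  proof (cases "x \<in> frontier \<Omega>")
    case False
    then obtain f' where f': "(cutoff has_derivative f') (at x)"
      using cutoff_differentiable[OF C2] by (auto simp: differentiable_def)
    have "norm (pd cutoff i x) \<le> 16 / r"
      by (rule pd_norm_le[OF f']) (use cutoff_lipschitz i in auto)
    then show ?thesis using False by (simp add: dcutoff_def)
  qed (use r_pos in \<open>simp add: dcutoff_def\<close>)
  show "norm (dreflect i x) \<le> 3"
  proof (cases "x \<in> frontier \<Omega>")
    case False
    then obtain f' where f': "(reflect has_derivative f') (at x)"
      using reflect_differentiable[OF C2] by (auto simp: differentiable_def)
    have "norm (pd reflect i x) \<le> 3"
      by (rule pd_norm_le[OF f']) (use reflect_lipschitz i in auto)
    then show ?thesis using False by (simp add: dreflect_def)
  qed (simp add: dreflect_def)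
  assume far: "r / 2 < norm (x - proj x)"
  \<comment> \<open>The strict inequality gives an open set on which the cutoff vanishes
    identically.\<close>
  have op: "open {y. r / 2 < norm (y - proj y)}"
    by (intro open_Collect_less continuous_intros continuous_proj)
  have "(cutoff has_derivative (\<lambda>h. 0)) (at x)"
    by (rule has_derivative_transform_within_open[OF has_derivative_const op])
      (use far cutoff_zero in auto)
  then show "dcutoff i x = 0" by (simp add: dcutoff_def pd_eq)
qed

section \<open>Integrals of functions composed with the reflection\<close>

definition pull_const :: real where "pull_const = 1 + 90 ^ DIM('a)"

lemma pull_const_pos: "pull_const > 0" by (simp add: pull_const_def add_pos_pos)

text \<open>On the closure of \<Omega> the reflection is the identity, which accounts for the 1 in
  \<open>pull_const\<close>; on the outer strip the constant 9 of
  \<open>reflect_inverse_lipschitz\<close> gives \<open>(10 * 9) ^ DIM('a)\<close>.\<close>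

lemma nn_integral_reflect_le:
  assumes F[measurable]: "F \<in> borel_measurable borel" and F0: "\<And>y. y \<notin> \<Omega> \<Longrightarrow> F y = 0"
  shows "(\<integral>\<^sup>+x. F (reflect x) * indicator {x. norm (x - proj x) \<le> r / 2} x \<partial>lborel)
     \<le> ennreal pull_const * (\<integral>\<^sup>+y. F y \<partial>lborel)"
proof -
  define A where "A = {x. norm (x - proj x) \<le> r / 2} - closure \<Omega>"
  have A[measurable]: "A \<in> sets borel" unfolding A_def by measurable
  have "(\<integral>\<^sup>+x. F (reflect x) * indicator {x. norm (x - proj x) \<le> r / 2} x \<partial>lborel)
     \<le> (\<integral>\<^sup>+x. F x + F (reflect x) * indicator A x \<partial>lborel)"
  proof (rule nn_integral_mono)
    fix x
    show "F (reflect x) * indicator {x. norm (x - proj x) \<le> r / 2} x \<le> F x + F (reflect x) * indicator A x"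
    proof (cases "x \<in> closure \<Omega>")
      case True
      then show ?thesis by (auto simp: reflect_self indicator_def)
    next
      case False
      then show ?thesis by (auto simp: A_def indicator_def)
    qed
  qed
  also have "\<dots> = (\<integral>\<^sup>+x. F x \<partial>lborel) + (\<integral>\<^sup>+x\<in>A. F (reflect x) \<partial>lborel)"
    by (simp add: nn_integral_add)
  also have "(\<integral>\<^sup>+x\<in>A. F (reflect x) \<partial>lborel) \<le> ennreal ((10 * 9) ^ DIM('a)) * (\<integral>\<^sup>+y. F y \<partial>lborel)"
    by (rule nn_integral_expanding_le) (use reflect_inverse_lipschitz in \<open>auto simp: A_def\<close>)
  finally show ?thesis
    by (simp add: pull_const_def distrib_right add_left_mono)
qed

lemma pullback_dominated:
  fixes F f :: "'a \<Rightarrow> real"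
  assumes F: "integrable lborel F" "\<And>y. y \<notin> \<Omega> \<Longrightarrow> F y = 0" "\<And>y. 0 \<le> F y"
    and f: "f \<in> borel_measurable borel" "\<And>x. 0 \<le> f x"
      "\<And>x. norm (x - proj x) \<le> r / 2 \<Longrightarrow> f x \<le> K * F (reflect x)"
      "\<And>x. r / 2 < norm (x - proj x) \<Longrightarrow> f x = 0"
    and K: "0 \<le> K"
  shows "integrable lborel f" "(\<integral>x. f x \<partial>lborel) \<le> K * pull_const * (\<integral>y. F y \<partial>lborel)"
proof -
  have [measurable]: "F \<in> borel_measurable borel" "f \<in> borel_measurable borel" using F f by auto
  let ?S = "{x. norm (x - proj x) \<le> r / 2}"
  have "(\<integral>\<^sup>+x. ennreal (f x) \<partial>lborel) \<le> (\<integral>\<^sup>+x. ennreal K * (ennreal (F (reflect x)) * indicator ?S x) \<partial>lborel)"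
  proof (rule nn_integral_mono)
    fix x
    show "ennreal (f x) \<le> ennreal K * (ennreal (F (reflect x)) * indicator ?S x)"
      using f(3,4)[of x] K by (cases "x \<in> ?S") (auto simp: ennreal_leI simp flip: ennreal_mult')
  qed
  also have "\<dots> = ennreal K * (\<integral>\<^sup>+x. ennreal (F (reflect x)) * indicator ?S x \<partial>lborel)"
    by (rule nn_integral_cmult) measurable
  also have "\<dots> \<le> ennreal K * (ennreal pull_const * (\<integral>\<^sup>+y. ennreal (F y) \<partial>lborel))"
    by (intro mult_left_mono nn_integral_reflect_le) (use F(2) in auto)
  also have "(\<integral>\<^sup>+y. ennreal (F y) \<partial>lborel) = ennreal (\<integral>y. F y \<partial>lborel)"
    using F by (intro nn_integral_eq_integral) auto
  also have "ennreal K * (ennreal pull_const * \<dots>) = ennreal (K * pull_const * (\<integral>y. F y \<partial>lborel))"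
    using K pull_const_pos by (simp add: mult.assoc flip: ennreal_mult')
  finally have *: "(\<integral>\<^sup>+x. ennreal (f x) \<partial>lborel) \<le> ennreal (K * pull_const * (\<integral>y. F y \<partial>lborel))" .
  show int: "integrable lborel f"
    using le_less_trans[OF * ennreal_less_top] f(2) by (intro integrableI_nonneg) auto
  have "0 \<le> K * pull_const * (\<integral>y. F y \<partial>lborel)" using K pull_const_pos F(3) by simp
  then show "(\<integral>x. f x \<partial>lborel) \<le> K * pull_const * (\<integral>y. F y \<partial>lborel)"
    using * nn_integral_eq_integral[OF int] f(2) by (simp add: ennreal_le_iff)
qed

text \<open>The continuity estimate behind the limit argument: reflecting \<open>F\<close> and
  pairing it with a bounded field supported in the strip is continuous in the L^1 norm of
  \<open>F\<close>. The inner product covers scalar and vector fields at once, being multiplication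
  on the reals.\<close>

lemma pullback_integral:
  fixes F k :: "'a \<Rightarrow> 'b::euclidean_space"
  assumes F: "integrable lborel F" "\<And>y. y \<notin> \<Omega> \<Longrightarrow> F y = 0"
    and k: "k \<in> borel_measurable borel" "\<And>x. norm (k x) \<le> K" "\<And>x. r / 2 < norm (x - proj x) \<Longrightarrow> k x = 0"
  shows "integrable lborel (\<lambda>x. k x \<bullet> F (reflect x))"
    and "\<bar>\<integral>x. k x \<bullet> F (reflect x) \<partial>lborel\<bar> \<le> K * pull_const * (\<integral>y. norm (F y) \<partial>lborel)"
proof -
  have [measurable]: "F \<in> borel_measurable borel" "k \<in> borel_measurable borel" using F k by auto
  have K: "K \<ge> 0" using k(2)[of 0] norm_ge_zero order_trans by blast
  have le: "\<bar>k x \<bullet> F (reflect x)\<bar> \<le> K * norm (F (reflect x))" for x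
    using Cauchy_Schwarz_ineq2 mult_right_mono[OF k(2) norm_ge_zero] by (rule order_trans)
  have fm: "(\<lambda>x. \<bar>k x \<bullet> F (reflect x)\<bar>) \<in> borel_measurable borel" by measurable
  have F0: "norm (F y) = 0" if "y \<notin> \<Omega>" for y using F(2)[OF that] by simp
  have k0: "\<bar>k x \<bullet> F (reflect x)\<bar> = 0" if "r / 2 < norm (x - proj x)" for x using k(3)[OF that] by simp
  note pd = pullback_dominated[OF integrable_norm[OF F(1)] F0 norm_ge_zero fm abs_ge_zero le k0 K]
  show "integrable lborel (\<lambda>x. k x \<bullet> F (reflect x))"
    by (rule Bochner_Integration.integrable_bound[OF pd(1)]) auto
  show "\<bar>\<integral>x. k x \<bullet> F (reflect x) \<partial>lborel\<bar> \<le> K * pull_const * (\<integral>y. norm (F y) \<partial>lborel)"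
    by (rule order_trans[OF integral_abs_bound pd(2)])
qed

lemma frontier_null: "frontier \<Omega> \<in> null_sets lborel"
proof -
  have "negligible (frontier \<Omega>)" by (rule negligible_convex_frontier[OF convex_dom])
  then show ?thesis
    by (simp add: negligible_iff_null_sets null_sets_completion_iff)
qed

lemma reflect_near_in_dom:
  assumes "norm (x - proj x) \<le> r / 2" "x \<notin> frontier \<Omega>" shows "reflect x \<in> \<Omega>"
proof (cases "x \<in> closure \<Omega>")
  case True
  then show ?thesis using assms frontier_dom by (auto simp: reflect_self)
next
  case False
  then show ?thesis using reflect_in_dom[OF False] assms r_pos by simp
qed

section \<open>The extension, its candidate gradient, and the case of Lipschitz functions\<close>

definition ext :: "('a \<Rightarrow> real) \<Rightarrow> 'a \<Rightarrow> real" where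
  "ext u x = cutoff x * u (reflect x)"

text \<open>Product and chain rule: off the boundary \<open>dreflect i x\<close> is the derivative
  of the reflection in direction \<open>i\<close>, so its pairing with the reflected gradient is the
  derivative of the composition.\<close>

definition ext_partial :: "('a \<Rightarrow> real) \<Rightarrow> ('a \<Rightarrow> 'a) \<Rightarrow> 'a \<Rightarrow> 'a \<Rightarrow> real" where
  "ext_partial u g i x = dcutoff i x * u (reflect x) + (cutoff x *\<^sub>R dreflect i x) \<bullet> g (reflect x)"

definition ext_grad :: "('a \<Rightarrow> real) \<Rightarrow> ('a \<Rightarrow> 'a) \<Rightarrow> 'a \<Rightarrow> 'a" where
  "ext_grad u g x = (\<Sum>i\<in>Basis. ext_partial u g i x *\<^sub>R i)"

text \<open>A Lipschitz \<open>U\<close>, composed with \<open>reflect\<close> and multiplied by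
  \<open>cutoff\<close>, is Lipschitz on each ball and classically differentiable off the null
  boundary, so the difference quotient argument applies.\<close>

lemma ext_lipschitz_by_parts:
  assumes C2: "C2_boundary \<Omega>" and i: "i \<in> Basis" and test: "test_fun UNIV \<phi>"
    and G[measurable]: "G \<in> borel_measurable borel" and U': "\<And>x. (U has_derivative (\<lambda>h. G x \<bullet> h)) (at x)"
    and L: "L \<ge> 0" "\<And>x y. \<bar>U x - U y\<bar> \<le> L * norm (x - y)"
  shows "(\<integral>x. ext U x * frechet_derivative \<phi> (at x) i \<partial>lborel) = - (\<integral>x. ext_partial U G i x * \<phi> x \<partial>lborel)"
proof (rule integral_by_parts_lipschitz[OF _ i _ frontier_null _ test])
  have "continuous_on UNIV U"
    by (rule continuous_at_imp_continuous_on) (auto intro: has_derivative_continuous[OF U'])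
  then have [measurable]: "U \<in> borel_measurable borel" by (rule borel_measurable_continuous_onI)
  show "ext_partial U G i \<in> borel_measurable borel" unfolding ext_partial_def by measurable
  fix B :: real
  \<comment> \<open>\<open>U\<close> may be unbounded, so the Lipschitz constant of the product
    depends on the ball through this bound on the reflected values.\<close>
  define M where "M = \<bar>U (reflect 0)\<bar> + L * (3 * \<bar>B\<bar>)"
  have M: "M \<ge> 0" using L by (simp add: M_def)
  have UB: "\<bar>U (reflect x)\<bar> \<le> M" if "norm x \<le> B" for x
  proof -
    have "\<bar>U (reflect x) - U (reflect 0)\<bar> \<le> L * norm (reflect x - reflect 0)" by (rule L)
    also have "\<dots> \<le> L * (3 * \<bar>B\<bar>)" using reflect_lipschitz[of x 0] that L by (intro mult_left_mono) auto
    finally show ?thesis by (simp add: M_def)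
  qed
  show "\<exists>L'\<ge>0. \<forall>x\<in>cball 0 B. \<forall>y\<in>cball 0 B. \<bar>ext U x - ext U y\<bar> \<le> L' * norm (x - y)"
  proof (intro exI[of _ "L * 3 + 16 / r * M"] conjI ballI)
    show "0 \<le> L * 3 + 16 / r * M" using L M r_pos by simp
    fix x y :: 'a assume xy: "x \<in> cball 0 B" "y \<in> cball 0 B"
    have "ext U x - ext U y = cutoff x * (U (reflect x) - U (reflect y)) + (cutoff x - cutoff y) * U (reflect y)"
      by (simp add: ext_def algebra_simps)
    also have "\<bar>\<dots>\<bar> \<le> cutoff x * \<bar>U (reflect x) - U (reflect y)\<bar> + \<bar>cutoff x - cutoff y\<bar> * \<bar>U (reflect y)\<bar>"
      by (rule order_trans[OF abs_triangle_ineq]) (simp add: abs_mult cutoff_range)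
    also have "\<dots> \<le> 1 * (L * (3 * norm (x - y))) + (16 / r * norm (x - y)) * M"
    proof (intro add_mono mult_mono cutoff_lipschitz cutoff_range UB)
      show "\<bar>U (reflect x) - U (reflect y)\<bar> \<le> L * (3 * norm (x - y))"
        using L(2)[of "reflect x" "reflect y"] mult_left_mono[OF reflect_lipschitz L(1)] by (rule order_trans)
    qed (use xy r_pos in auto)
    also have "\<dots> = (L * 3 + 16 / r * M) * norm (x - y)" by (simp add: algebra_simps)
    finally show "\<bar>ext U x - ext U y\<bar> \<le> (L * 3 + 16 / r * M) * norm (x - y)" .
  qed
next
  fix x assume x: "x \<notin> frontier \<Omega>"
  obtain c' where c': "(cutoff has_derivative c') (at x)"
    using cutoff_differentiable[OF C2 x] by (auto simp: differentiable_def)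
  obtain R' where R': "(reflect has_derivative R') (at x)"
    using reflect_differentiable[OF C2 x] by (auto simp: differentiable_def)
  have "((\<lambda>x. U (reflect x)) has_derivative (\<lambda>h. G (reflect x) \<bullet> R' h)) (at x)"
    by (rule has_derivative_compose[OF R' U'])
  from has_derivative_mult[OF c' this]
  have "(ext U has_derivative (\<lambda>h. cutoff x * (G (reflect x) \<bullet> R' h) + c' h * U (reflect x))) (at x)"
    by (simp add: ext_def[abs_def])
  from has_derivative_difference_quotient[OF this, of i]
  show "((\<lambda>t. (ext U (x + t *\<^sub>R i) - ext U x) / t) \<longlongrightarrow> ext_partial U G i x) (at 0)"
    using x pd_eq[OF c', of i] pd_eq[OF R', of i]
    by (simp add: ext_partial_def dcutoff_def dreflect_def inner_commute algebra_simps divide_inverse)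
qed

end

section \<open>The Gaussian density and local integrability\<close>

lemma gauss_density_pos: "gauss_density x > 0"
  by (simp add: gauss_density_def)

lemma gauss_density_measurable[measurable]: "gauss_density \<in> borel_measurable borel"
  unfolding gauss_density_def[abs_def] by measurable

text \<open>On a ball the density is bounded below by a positive \<open>m\<close>, and |f| <= 1 +
  |f|^2 replaces the first power by the square plus a constant.\<close>

lemma integrable_of_weighted_L2:
  fixes f :: "'a::euclidean_space \<Rightarrow> 'b::euclidean_space"
  assumes [measurable]: "f \<in> borel_measurable borel"
    and f: "integrable lborel (\<lambda>x. gauss_density x * (norm (f x))\<^sup>2)"
  shows "integrable lborel (\<lambda>x. indicator (ball 0 B) x *\<^sub>R f x)"
proof -
  have [measurable]: "ball (0::'a) B \<in> sets borel" by simp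
  define m where "m = (2 * pi) powr (- real DIM('a) / 2) * exp (- B\<^sup>2 / 2)"
  have m: "m > 0" by (simp add: m_def)
  have ml: "m \<le> gauss_density x" if "x \<in> ball 0 B" for x :: 'a
  proof -
    have "(norm x)\<^sup>2 \<le> B\<^sup>2" using that by (intro power_mono) auto
    then show ?thesis by (simp add: m_def gauss_density_def)
  qed
  show ?thesis
  proof (rule Bochner_Integration.integrable_bound)
    show "integrable lborel (\<lambda>x. indicator (ball 0 B) x + 1 / m * (gauss_density x * (norm (f x))\<^sup>2))"
      by (intro Bochner_Integration.integrable_add integrable_mult_right f integrable_real_indicator emeasure_bounded_finite) auto
    show "AE x in lborel. norm (indicator (ball 0 B) x *\<^sub>R f x) \<le>
      norm (indicator (ball 0 B) x + 1 / m * (gauss_density x * (norm (f x))\<^sup>2))"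
    proof (intro AE_I2)
      fix x :: 'a
      show "norm (indicator (ball 0 B) x *\<^sub>R f x) \<le>
        norm (indicator (ball 0 B) x + 1 / m * (gauss_density x * (norm (f x))\<^sup>2))"
      proof (cases "x \<in> ball 0 B")
        case True
        have "2 * norm (f x) \<le> 1 + (norm (f x))\<^sup>2"
          using zero_le_power2[of "norm (f x) - 1"] by (simp add: power2_diff)
        then have "norm (f x) \<le> 1 + (norm (f x))\<^sup>2" using norm_ge_zero[of "f x"] by linarith
        also have "(norm (f x))\<^sup>2 \<le> 1 / m * (gauss_density x * (norm (f x))\<^sup>2)"
          using mult_right_mono[OF ml[OF True], of "(norm (f x))\<^sup>2"] m by (simp add: pos_le_divide_eq mult.commute)
        finally show ?thesis using True by simp
      qed simp
    qed
  qed measurable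
qed

section \<open>The weak gradient of the extension\<close>

context convex_sphere_domain
begin

text \<open>For a fixed test function both sides are integrals of reflected \<open>u\<close> and
  \<open>g\<close> against bounded fields \<open>k1\<close>, \<open>k2\<close>, \<open>k3\<close>.
  The identity holds for Lipschitz approximants of (u, g) on a bounded convex piece
  \<open>W\<close>, so its defect for (u, g) is at most \<open>Q * c\<close> for every c >
  0.\<close>

theorem ext_weak_gradient:
  assumes C2: "C2_boundary \<Omega>"
    and u[measurable]: "u \<in> borel_measurable borel" and g[measurable]: "g \<in> borel_measurable borel"
    and zero: "\<And>y. y \<notin> \<Omega> \<Longrightarrow> u y = 0" "\<And>y. y \<notin> \<Omega> \<Longrightarrow> g y = 0"
    and loc: "\<And>B. integrable lborel (\<lambda>x. indicator (ball 0 B) x *\<^sub>R u x)"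
      "\<And>B. integrable lborel (\<lambda>x. indicator (ball 0 B) x *\<^sub>R g x)"
    and weak: "\<And>\<phi> i. test_fun \<Omega> \<phi> \<Longrightarrow> i \<in> Basis \<Longrightarrow>
      (\<integral>x. u x * frechet_derivative \<phi> (at x) i \<partial>lborel) = - (\<integral>x. (g x \<bullet> i) * \<phi> x \<partial>lborel)"
    and test: "test_fun UNIV \<phi>" and i: "i \<in> Basis"
  shows "(\<integral>x. ext u x * frechet_derivative \<phi> (at x) i \<partial>lborel) = - (\<integral>x. (ext_grad u g x \<bullet> i) * \<phi> x \<partial>lborel)"
proof -
  let ?\<phi>' = "\<lambda>x. frechet_derivative \<phi> (at x) i"
  have sm: "smooth_fun \<phi>" using test by (simp add: test_fun_def)
  obtain B where B: "B > 0" "\<And>x. norm x \<ge> B \<Longrightarrow> \<phi> x = 0" "\<And>x. norm x \<ge> B \<Longrightarrow> ?\<phi>' x = 0"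
    using test_fun_support[OF test] by blast
  obtain M where M: "M > 0" "\<And>x. \<bar>\<phi> x\<bar> \<le> M" "\<And>x. \<bar>?\<phi>' x\<bar> \<le> M"
    using test_fun_bounds[OF test] i by blast
  have [measurable]: "\<phi> \<in> borel_measurable borel" "?\<phi>' \<in> borel_measurable borel"
    using smooth_funD(2,4)[OF sm] i by (auto intro: borel_measurable_continuous_onI)
  obtain z0 where z0: "z0 \<in> \<Omega>" using nonempty_dom by blast
  \<comment> \<open>Large enough for the 3-Lipschitz reflection to map the ball of radius
    \<open>B\<close> into the one of radius \<open>B'\<close>; the summand |z0| + 1 keeps
    \<open>W\<close> nonempty.\<close>
  define B' where "B' = norm (reflect 0) + 3 * B + norm z0 + 1"
  define W where "W = \<Omega> \<inter> ball 0 B'"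
  have W: "open W" "convex W" "bounded W" "W \<noteq> {}"
  proof -
    show "open W" "convex W" using open_dom convex_dom by (auto simp: W_def intro: convex_Int)
    show "bounded W" unfolding W_def by (rule bounded_subset[OF bounded_ball]) auto
    have "norm z0 < B'" using B(1) by (simp add: B'_def add_pos_pos add_nonneg_pos)
    then show "W \<noteq> {}" using z0 by (auto simp: W_def)
  qed
  have Wm[measurable]: "W \<in> sets borel" using W(1) by simp
  have RB: "norm (reflect x) < B'" if "norm x < B" for x
  proof -
    have "norm (reflect x) \<le> norm (reflect 0) + norm (reflect x - reflect 0)"
      by (rule norm_triangle_sub)
    also have "\<dots> \<le> norm (reflect 0) + 3 * norm x" using reflect_lipschitz[of x 0] by simp
    also have "\<dots> < B'" using that norm_ge_zero[of z0] unfolding B'_def by linarith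
    finally show ?thesis .
  qed
  \<comment> \<open>Truncation makes both functions integrable and does not change the reflected
    values that the test function sees.\<close>
  define u' where "u' x = indicator (ball 0 B') x *\<^sub>R u x" for x
  define g' where "g' x = indicator (ball 0 B') x *\<^sub>R g x" for x
  have u': "integrable lborel u'" "\<And>y. y \<notin> \<Omega> \<Longrightarrow> u' y = 0" using loc(1)[of B'] zero by (auto simp: u'_def[abs_def])
  have g': "integrable lborel g'" "\<And>y. y \<notin> \<Omega> \<Longrightarrow> g' y = 0" using loc(2)[of B'] zero by (auto simp: g'_def[abs_def])
  have [measurable]: "u' \<in> borel_measurable borel" "g' \<in> borel_measurable borel" using u' g' by auto
  have weak': "(\<integral>x. u' x * frechet_derivative \<psi> (at x) j \<partial>lborel) = - (\<integral>x. (g' x \<bullet> j) * \<psi> x \<partial>lborel)"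
    if \<psi>: "test_fun W \<psi>" and j: "j \<in> Basis" for \<psi> j
  proof -
    have sub: "tsupport \<psi> \<subseteq> ball 0 B'" "test_fun \<Omega> \<psi>" using \<psi> by (auto simp: test_fun_def W_def)
    have 1: "u' x * frechet_derivative \<psi> (at x) j = u x * frechet_derivative \<psi> (at x) j"
      and 2: "(g' x \<bullet> j) * \<psi> x = (g x \<bullet> j) * \<psi> x" for x
      using sub(1) zero_off_tsupport[of x \<psi>] by (cases "x \<in> tsupport \<psi>"; auto simp: u'_def g'_def)+
    show ?thesis unfolding 1 2 by (rule weak[OF sub(2) j])
  qed
  define k1 where "k1 x = cutoff x * ?\<phi>' x" for x
  define k2 where "k2 x = dcutoff i x * \<phi> x" for x
  define k3 where "k3 x = (cutoff x * \<phi> x) *\<^sub>R dreflect i x" for x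
  have [measurable]: "k1 \<in> borel_measurable borel" "k2 \<in> borel_measurable borel" "k3 \<in> borel_measurable borel"
    unfolding k1_def k2_def k3_def by measurable
  have c0: "cutoff x = 0" if "r / 2 < norm (x - proj x)" for x using that by (intro cutoff_zero) simp
  have kz: "k1 x = 0" "k2 x = 0" "k3 x = 0" if "r / 2 < norm (x - proj x)" for x
    using that c0 dcutoff_bounds(3)[OF C2 i] by (auto simp: k1_def k2_def k3_def)
  have k1b: "norm (k1 x) \<le> M" for x
    using mult_mono[OF cutoff_range(2) M(3), of x x] by (simp add: k1_def abs_mult cutoff_range)
  have k2b: "norm (k2 x) \<le> 16 / r * M" for x
    using mult_mono[OF dcutoff_bounds(1)[OF C2 i] M(2), of x x] r_pos by (simp add: k2_def abs_mult)
  have k3b: "norm (k3 x) \<le> M * 3" for x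
  proof -
    have "cutoff x * \<bar>\<phi> x\<bar> \<le> 1 * M" using M cutoff_range by (intro mult_mono) auto
    then have "(cutoff x * \<bar>\<phi> x\<bar>) * norm (dreflect i x) \<le> M * 3"
      using M(1) dcutoff_bounds(2)[OF C2 i] cutoff_range by (intro mult_mono) auto
    then show ?thesis by (simp add: k3_def abs_mult cutoff_range)
  qed
  define I1 where "I1 = (\<integral>x. ext u x * ?\<phi>' x \<partial>lborel)"
  define I2 where "I2 = (\<integral>x. ext_partial u g i x * \<phi> x \<partial>lborel)"
  have eq1: "ext u x * ?\<phi>' x = k1 x \<bullet> u' (reflect x)" for x
    using RB[of x] B(3)[of x] by (cases "norm x < B") (auto simp: ext_def k1_def u'_def)
  have eq2: "ext_partial u g i x * \<phi> x = k2 x \<bullet> u' (reflect x) + k3 x \<bullet> g' (reflect x)" for x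
    using RB[of x] B(2)[of x] by (cases "norm x < B") (auto simp: ext_partial_def k2_def k3_def u'_def g'_def algebra_simps)
  \<comment> \<open>The sum of the bounds of \<open>k1\<close>, \<open>k2\<close> and
    \<open>k3\<close>, multiplied by the cost of the change of variables.\<close>
  define Q where "Q = pull_const * (M + 16 / r * M + M * 3)"
  have Q: "Q > 0" using pull_const_pos M(1) r_pos by (simp add: Q_def add_pos_pos)
  have small: "\<bar>I1 + I2\<bar> \<le> Q * c" if c: "c > 0" for c
  proof -
    obtain U G L where G[measurable]: "G \<in> borel_measurable borel"
      and U': "\<And>x. (U has_derivative (\<lambda>h. G x \<bullet> h)) (at x)"
      and L: "L \<ge> 0" "\<And>x y. \<bar>U x - U y\<bar> \<le> L * norm (x - y)"
      and appU: "(\<integral>\<^sup>+y\<in>W. ennreal \<bar>U y - u' y\<bar> \<partial>lborel) \<le> ennreal c"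
      and appG: "(\<integral>\<^sup>+y\<in>W. ennreal (norm (G y - g' y)) \<partial>lborel) \<le> ennreal c"
      using convex_W11_approx[OF W u'(1) g'(1) weak' c] by blast
    have "continuous_on UNIV U"
      by (rule continuous_at_imp_continuous_on) (auto intro: has_derivative_continuous[OF U'])
    then have [measurable]: "U \<in> borel_measurable borel" by (rule borel_measurable_continuous_onI)
    have ap: "integrable lborel (\<lambda>y. indicator W y *\<^sub>R F y)" "(\<integral>y. norm (indicator W y *\<^sub>R F y) \<partial>lborel) \<le> c"
      if [measurable]: "F \<in> borel_measurable borel" and F: "(\<integral>\<^sup>+y\<in>W. ennreal (norm (F y)) \<partial>lborel) \<le> ennreal c"
      for F :: "'a \<Rightarrow> 'b::euclidean_space"
    proof -
      have F': "(\<integral>\<^sup>+y. ennreal (norm (indicator W y *\<^sub>R F y)) \<partial>lborel) \<le> ennreal c"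
      proof -
        have "(\<integral>\<^sup>+y. ennreal (norm (indicator W y *\<^sub>R F y)) \<partial>lborel) = (\<integral>\<^sup>+y\<in>W. ennreal (norm (F y)) \<partial>lborel)"
          by (intro nn_integral_cong) (auto simp: indicator_def)
        then show ?thesis using F by simp
      qed
      show int: "integrable lborel (\<lambda>y. indicator W y *\<^sub>R F y)"
        unfolding integrable_iff_bounded using le_less_trans[OF F' ennreal_less_top] by auto
      have "ennreal (\<integral>y. norm (indicator W y *\<^sub>R F y) \<partial>lborel) \<le> ennreal c"
        using F' nn_integral_eq_integral[OF integrable_norm[OF int]] by simp
      then show "(\<integral>y. norm (indicator W y *\<^sub>R F y) \<partial>lborel) \<le> c" using c by (simp add: ennreal_le_iff)
    qed
    \<comment> \<open>Closeness of the approximants is known only on \<open>W\<close>, so the errors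
      are cut off there before being reflected.\<close>
    define Ud where "Ud y = indicator W y *\<^sub>R (U y - u' y)" for y
    define Gd where "Gd y = indicator W y *\<^sub>R (G y - g' y)" for y
    have Ud: "integrable lborel Ud" "(\<integral>y. norm (Ud y) \<partial>lborel) \<le> c" "\<And>y. y \<notin> \<Omega> \<Longrightarrow> Ud y = 0"
      using ap[of "\<lambda>y. U y - u' y"] appU by (auto simp: Ud_def[abs_def] W_def)
    have Gd: "integrable lborel Gd" "(\<integral>y. norm (Gd y) \<partial>lborel) \<le> c" "\<And>y. y \<notin> \<Omega> \<Longrightarrow> Gd y = 0"
      using ap[of "\<lambda>y. G y - g' y"] appG by (auto simp: Gd_def[abs_def] W_def)
    have [measurable]: "Ud \<in> borel_measurable borel" "Gd \<in> borel_measurable borel" using Ud Gd by auto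
    have [measurable]: "ext U \<in> borel_measurable borel" "ext_partial U G i \<in> borel_measurable borel"
      unfolding ext_def[abs_def] ext_partial_def[abs_def] by measurable
    \<comment> \<open>Off the boundary, inside the strip and the ball, the reflection lands in
      \<open>W\<close>, where approximant minus error is the truncated original; the boundary is a
      null set.\<close>
    have inW: "u' (reflect x) + Ud (reflect x) = U (reflect x)" "g' (reflect x) + Gd (reflect x) = G (reflect x)"
      if "x \<notin> frontier \<Omega>" "norm x < B" "norm (x - proj x) \<le> r / 2" for x
      using reflect_near_in_dom[OF that(3,1)] RB[OF that(2)] by (auto simp: Ud_def Gd_def W_def)
    have AEf: "AE x in lborel. x \<notin> frontier \<Omega>" using frontier_null by (rule AE_not_in)
    note p1 = pullback_integral[OF u' \<open>k1 \<in> _\<close> k1b kz(1)]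
    note p2 = pullback_integral[OF u' \<open>k2 \<in> _\<close> k2b kz(2)]
    note p3 = pullback_integral[OF g' \<open>k3 \<in> _\<close> k3b kz(3)]
    note e1 = pullback_integral[OF Ud(1,3) \<open>k1 \<in> _\<close> k1b kz(1)]
    note e2 = pullback_integral[OF Ud(1,3) \<open>k2 \<in> _\<close> k2b kz(2)]
    note e3 = pullback_integral[OF Gd(1,3) \<open>k3 \<in> _\<close> k3b kz(3)]
    define E1 where "E1 = (\<integral>x. k1 x \<bullet> Ud (reflect x) \<partial>lborel)"
    define E2 where "E2 = (\<integral>x. k2 x \<bullet> Ud (reflect x) \<partial>lborel)"
    define E3 where "E3 = (\<integral>x. k3 x \<bullet> Gd (reflect x) \<partial>lborel)"
    have "(\<integral>x. ext U x * ?\<phi>' x \<partial>lborel) = (\<integral>x. k1 x \<bullet> u' (reflect x) + k1 x \<bullet> Ud (reflect x) \<partial>lborel)"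
    proof (rule integral_cong_AE)
      show "AE x in lborel. ext U x * ?\<phi>' x = k1 x \<bullet> u' (reflect x) + k1 x \<bullet> Ud (reflect x)"
        using AEf
      proof eventually_elim
        case (elim x)
        have "ext U x * ?\<phi>' x = k1 x * (u' (reflect x) + Ud (reflect x))"
        proof (cases "norm x < B \<and> norm (x - proj x) \<le> r / 2")
          case True
          then show ?thesis using inW(1)[OF elim] by (simp add: ext_def k1_def)
        next
          case False
          then show ?thesis using B(3)[of x] c0[of x] by (auto simp: ext_def k1_def not_less not_le)
        qed
        then show ?case by (simp add: algebra_simps)
      qed
    qed measurable
    also have "\<dots> = I1 + E1"
      unfolding I1_def E1_def eq1 by (rule Bochner_Integration.integral_add[OF p1(1) e1(1)])
    finally have J1: "(\<integral>x. ext U x * ?\<phi>' x \<partial>lborel) = I1 + E1" .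
    have "(\<integral>x. ext_partial U G i x * \<phi> x \<partial>lborel) =
      (\<integral>x. (k2 x \<bullet> u' (reflect x) + k3 x \<bullet> g' (reflect x)) + (k2 x \<bullet> Ud (reflect x) + k3 x \<bullet> Gd (reflect x)) \<partial>lborel)"
    proof (rule integral_cong_AE)
      show "AE x in lborel. ext_partial U G i x * \<phi> x =
        (k2 x \<bullet> u' (reflect x) + k3 x \<bullet> g' (reflect x)) + (k2 x \<bullet> Ud (reflect x) + k3 x \<bullet> Gd (reflect x))"
        using AEf
      proof eventually_elim
        case (elim x)
        have "ext_partial U G i x * \<phi> x = k2 x * (u' (reflect x) + Ud (reflect x)) + k3 x \<bullet> (g' (reflect x) + Gd (reflect x))"
        proof (cases "norm x < B \<and> norm (x - proj x) \<le> r / 2")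
          case True
          then show ?thesis using inW[OF elim] by (simp add: ext_partial_def k2_def k3_def algebra_simps)
        next
          case False
          then show ?thesis using B(2)[of x] c0[of x] dcutoff_bounds(3)[OF C2 i, of x]
            by (auto simp: ext_partial_def k2_def k3_def not_less not_le)
        qed
        then show ?case by (simp add: inner_add_right algebra_simps)
      qed
    qed measurable
    also have "\<dots> = (\<integral>x. k2 x \<bullet> u' (reflect x) + k3 x \<bullet> g' (reflect x) \<partial>lborel) + (\<integral>x. k2 x \<bullet> Ud (reflect x) + k3 x \<bullet> Gd (reflect x) \<partial>lborel)"
      by (intro Bochner_Integration.integral_add Bochner_Integration.integrable_add p2(1) p3(1) e2(1) e3(1))
    also have "(\<integral>x. k2 x \<bullet> Ud (reflect x) + k3 x \<bullet> Gd (reflect x) \<partial>lborel) = E2 + E3"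
      unfolding E2_def E3_def by (rule Bochner_Integration.integral_add[OF e2(1) e3(1)])
    also have "(\<integral>x. k2 x \<bullet> u' (reflect x) + k3 x \<bullet> g' (reflect x) \<partial>lborel) = I2"
      unfolding I2_def eq2 ..
    finally have J2: "(\<integral>x. ext_partial U G i x * \<phi> x \<partial>lborel) = I2 + (E2 + E3)" .
    have "I1 + E1 = - (I2 + (E2 + E3))"
      using ext_lipschitz_by_parts[OF C2 i test G U' L] J1 J2 by simp
    then have "\<bar>I1 + I2\<bar> \<le> \<bar>E1\<bar> + \<bar>E2\<bar> + \<bar>E3\<bar>" by linarith
    also have "\<dots> \<le> M * pull_const * c + 16 / r * M * pull_const * c + M * 3 * pull_const * c"
    proof (intro add_mono)
      have le: "K * pull_const * t \<le> K * pull_const * c" if "t \<le> c" "K \<ge> 0" for K t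
        using that pull_const_pos by (intro mult_left_mono) auto
      show "\<bar>E1\<bar> \<le> M * pull_const * c"
        using e1(2) le[OF Ud(2), of M] M(1) unfolding E1_def by linarith
      show "\<bar>E2\<bar> \<le> 16 / r * M * pull_const * c"
        using e2(2) le[OF Ud(2), of "16 / r * M"] M(1) r_pos unfolding E2_def by force
      show "\<bar>E3\<bar> \<le> M * 3 * pull_const * c"
        using e3(2) le[OF Gd(2), of "M * 3"] M(1) unfolding E3_def by linarith
    qed
    also have "\<dots> = Q * c" by (simp add: Q_def algebra_simps)
    finally show ?thesis .
  qed
  have "I1 + I2 = 0"
  proof (rule ccontr)
    assume ne: "I1 + I2 \<noteq> 0"
    then have "\<bar>I1 + I2\<bar> / (2 * Q) > 0" using Q by simp
    from small[OF this] have "\<bar>I1 + I2\<bar> \<le> \<bar>I1 + I2\<bar> / 2" using Q by simp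
    then show False using ne by simp
  qed
  then have "I1 = - I2" by simp
  then show ?thesis unfolding I1_def I2_def ext_grad_def using i by simp
qed

section \<open>Weighted estimates\<close>

lemma gauss_density_reflect:
  assumes "0 \<in> \<Omega> \<or> infdist 0 (frontier \<Omega>) = d0" "norm (x - proj x) \<le> r / 2"
  shows "gauss_density x \<le> exp (r * \<bar>d0\<bar>) * gauss_density (reflect x)"
proof -
  \<comment> \<open>The exponent carries half of the bound 2 r |d0| on the difference of squared
    norms.\<close>
  have "exp (- (norm x)\<^sup>2 / 2) \<le> exp (r * \<bar>d0\<bar> + (- (norm (reflect x))\<^sup>2 / 2))"
    using norm_reflect_le[OF assms] by simp
  also have "\<dots> = exp (r * \<bar>d0\<bar>) * exp (- (norm (reflect x))\<^sup>2 / 2)" by (rule exp_add)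
  finally have "gauss_density x \<le> (2 * pi) powr (- real DIM('a) / 2) * (exp (r * \<bar>d0\<bar>) * exp (- (norm (reflect x))\<^sup>2 / 2))"
    unfolding gauss_density_def by (rule mult_left_mono) simp
  then show ?thesis unfolding gauss_density_def by (simp only: mult.left_commute)
qed

lemma weighted_reflect_le:
  fixes F f :: "'a \<Rightarrow> real"
  assumes d0: "0 \<in> \<Omega> \<or> infdist 0 (frontier \<Omega>) = d0"
    and [measurable]: "F \<in> borel_measurable borel" "f \<in> borel_measurable borel"
    and F0: "\<And>y. y \<notin> \<Omega> \<Longrightarrow> F y = 0" and Fnn: "\<And>y. 0 \<le> F y"
    and Fint: "integrable lborel (\<lambda>y. gauss_density y * F y)"
    and f: "\<And>x. 0 \<le> f x" "\<And>x. norm (x - proj x) \<le> r / 2 \<Longrightarrow> f x \<le> F (reflect x)"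
      "\<And>x. r / 2 < norm (x - proj x) \<Longrightarrow> f x = 0"
  shows "integrable lborel (\<lambda>x. gauss_density x * f x)"
    and "(\<integral>x. gauss_density x * f x \<partial>lborel) \<le> exp (r * \<bar>d0\<bar>) * pull_const * (\<integral>y. gauss_density y * F y \<partial>lborel)"
proof -
  have gp: "0 \<le> gauss_density x" for x :: 'a using gauss_density_pos[of x] by simp
  have le: "gauss_density x * f x \<le> exp (r * \<bar>d0\<bar>) * (gauss_density (reflect x) * F (reflect x))"
    if x: "norm (x - proj x) \<le> r / 2" for x
  proof -
    have "gauss_density x * f x \<le> (exp (r * \<bar>d0\<bar>) * gauss_density (reflect x)) * F (reflect x)"
      using gauss_density_reflect[OF d0 x] f(1)[of x] f(2)[OF x] gp by (intro mult_mono) auto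
    then show ?thesis by (simp only: mult.assoc)
  qed
  note pd = pullback_dominated[of "\<lambda>y. gauss_density y * F y" "\<lambda>x. gauss_density x * f x" "exp (r * \<bar>d0\<bar>)"]
  show "integrable lborel (\<lambda>x. gauss_density x * f x)"
    by (rule pd(1)) (use Fint F0 Fnn gp f le in auto)
  show "(\<integral>x. gauss_density x * f x \<partial>lborel) \<le> exp (r * \<bar>d0\<bar>) * pull_const * (\<integral>y. gauss_density y * F y \<partial>lborel)"
    by (rule pd(2)) (use Fint F0 Fnn gp f le in auto)
qed

lemma ext_square_le:
  "norm (x - proj x) \<le> r / 2 \<Longrightarrow> (ext u x)\<^sup>2 \<le> (u (reflect x))\<^sup>2"
  "r / 2 < norm (x - proj x) \<Longrightarrow> ext u x = 0"
proof -
  have "(cutoff x)\<^sup>2 * (u (reflect x))\<^sup>2 \<le> 1 * (u (reflect x))\<^sup>2"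
    using cutoff_range[of x] by (intro mult_right_mono power_le_one) auto
  then show "(ext u x)\<^sup>2 \<le> (u (reflect x))\<^sup>2" by (simp add: ext_def power_mult_distrib)
qed (simp add: ext_def cutoff_zero)

text \<open>Each of the N partial derivatives is at most (16/r) |u| + 3 |g| at the reflected point,
  by the bounds on \<open>dcutoff\<close> and \<open>dreflect\<close>; then (a + b)^2 <= 2 a^2 + 2
  b^2.\<close>

lemma ext_grad_square_le:
  assumes C2: "C2_boundary \<Omega>"
  shows "(norm (ext_grad u g x))\<^sup>2 \<le>
      2 * (real DIM('a) * (16 / r))\<^sup>2 * (u (reflect x))\<^sup>2 + 2 * (real DIM('a) * 3)\<^sup>2 * (norm (g (reflect x)))\<^sup>2"
    and "r / 2 < norm (x - proj x) \<Longrightarrow> ext_grad u g x = 0"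
proof -
  let ?N = "real DIM('a)"
  define a b where "a = ?N * (16 / r) * \<bar>u (reflect x)\<bar>" and "b = ?N * 3 * norm (g (reflect x))"
  have "norm (ext_grad u g x) \<le> (\<Sum>i\<in>(Basis::'a set). norm (ext_partial u g i x *\<^sub>R i))"
    unfolding ext_grad_def by (rule norm_sum)
  also have "\<dots> \<le> (\<Sum>i\<in>(Basis::'a set). 16 / r * \<bar>u (reflect x)\<bar> + 3 * norm (g (reflect x)))"
  proof (rule sum_mono)
    fix i :: 'a assume i: "i \<in> Basis"
    have "\<bar>(cutoff x *\<^sub>R dreflect i x) \<bullet> g (reflect x)\<bar> \<le> norm (cutoff x *\<^sub>R dreflect i x) * norm (g (reflect x))"
      by (rule Cauchy_Schwarz_ineq2)
    also have "norm (cutoff x *\<^sub>R dreflect i x) \<le> 1 * 3"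
      using cutoff_range[of x] dcutoff_bounds(2)[OF C2 i, of x] by (simp add: mult_mono[of "cutoff x" 1 _ 3, simplified])
    finally have 1: "\<bar>(cutoff x *\<^sub>R dreflect i x) \<bullet> g (reflect x)\<bar> \<le> 3 * norm (g (reflect x))"
      by (simp add: mult_right_mono)
    have 2: "\<bar>dcutoff i x * u (reflect x)\<bar> \<le> 16 / r * \<bar>u (reflect x)\<bar>"
      unfolding abs_mult using dcutoff_bounds(1)[OF C2 i, of x] by (intro mult_right_mono) auto
    have "norm (ext_partial u g i x *\<^sub>R i) = \<bar>ext_partial u g i x\<bar>" using i by simp
    also have "\<dots> \<le> 16 / r * \<bar>u (reflect x)\<bar> + 3 * norm (g (reflect x))"
      unfolding ext_partial_def by (rule order_trans[OF abs_triangle_ineq add_mono[OF 2 1]])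
    finally show "norm (ext_partial u g i x *\<^sub>R i) \<le> 16 / r * \<bar>u (reflect x)\<bar> + 3 * norm (g (reflect x))" .
  qed
  also have "\<dots> = a + b" by (simp add: a_def b_def algebra_simps)
  finally have "(norm (ext_grad u g x))\<^sup>2 \<le> (a + b)\<^sup>2" by (intro power_mono) auto
  also have "\<dots> \<le> 2 * a\<^sup>2 + 2 * b\<^sup>2"
    using zero_le_power2[of "a - b"] by (simp add: power2_sum power2_diff)
  finally show "(norm (ext_grad u g x))\<^sup>2 \<le>
      2 * (?N * (16 / r))\<^sup>2 * (u (reflect x))\<^sup>2 + 2 * (?N * 3)\<^sup>2 * (norm (g (reflect x)))\<^sup>2"
    unfolding a_def b_def power_mult_distrib power2_abs by (simp only: mult.assoc)
  assume "r / 2 < norm (x - proj x)"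
  then show "ext_grad u g x = 0"
    by (simp add: ext_grad_def ext_partial_def cutoff_zero dcutoff_bounds(3)[OF C2])
qed

end

section \<open>Gaussian Sobolev spaces\<close>

text \<open>Membership in the function spaces gives Lebesgue measurability, while composition with
  \<open>reflect\<close> calls for Borel functions. A Borel modification is found coordinate by
  coordinate and cut off outside \<open>U\<close>.\<close>

lemma lebesgue_borel_version:
  fixes f :: "'a::euclidean_space \<Rightarrow> 'b::euclidean_space"
  assumes f: "f \<in> borel_measurable lebesgue" and zero: "\<And>x. x \<notin> U \<Longrightarrow> f x = 0" and U: "open U"
  shows "\<exists>f0\<in>borel_measurable borel. (AE x in lborel. f x = f0 x) \<and> (\<forall>x. x \<notin> U \<longrightarrow> f0 x = 0)"
proof -
  have "\<exists>h\<in>borel_measurable lborel. AE x in lborel. f x \<bullet> i = h x" for i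
    by (rule completion_ex_borel_measurable_real) (use f in measurable)
  then obtain h where h: "\<And>i. h i \<in> borel_measurable lborel" "\<And>i. AE x in lborel. f x \<bullet> i = h i x"
    by metis
  have [measurable]: "h i \<in> borel_measurable borel" for i using h(1)[of i] by simp
  have [measurable]: "U \<in> sets borel" using U by simp
  have "AE x in lborel. \<forall>i\<in>Basis. f x \<bullet> i = h i x"
    by (rule AE_finite_allI) (use h(2) in auto)
  then have "AE x in lborel. f x = indicator U x *\<^sub>R (\<Sum>i\<in>Basis. h i x *\<^sub>R i)"
  proof eventually_elim
    case (elim x)
    have "f x = (\<Sum>i\<in>Basis. (f x \<bullet> i) *\<^sub>R i)" by (simp add: euclidean_representation)
    also have "\<dots> = (\<Sum>i\<in>Basis. h i x *\<^sub>R i)" using elim by (intro sum.cong) auto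
    finally show ?case using zero[of x] by (auto simp: indicator_def)
  qed
  then show ?thesis
    by (intro bexI[of _ "\<lambda>x. indicator U x *\<^sub>R (\<Sum>i\<in>Basis. h i x *\<^sub>R i)"]) auto
qed

lemma L2_gauss_borel_version:
  fixes f :: "'a::euclidean_space \<Rightarrow> real"
  assumes f: "(\<lambda>x. indicator U x *\<^sub>R f x) \<in> borel_measurable lebesgue"
    and [measurable]: "f0 \<in> borel_measurable borel"
    and AE: "AE x in lborel. indicator U x *\<^sub>R f x = f0 x"
  shows "L2_gauss U f \<longleftrightarrow> integrable lborel (\<lambda>x. gauss_density x * (f0 x)\<^sup>2)"
    and "L2_gauss_norm U f = sqrt (\<integral>x. gauss_density x * (f0 x)\<^sup>2 \<partial>lborel)"
proof -
  have AE': "AE x in lebesgue. gauss_density x *\<^sub>R (indicator U x *\<^sub>R (f x)\<^sup>2) = gauss_density x * (f0 x)\<^sup>2"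
    using AE_completion[OF AE] by eventually_elim (auto simp: indicator_def split: if_splits)
  have gm: "gauss_density \<in> borel_measurable (lebesgue :: 'a measure)"
    by (rule measurable_completion) simp
  have "(\<lambda>x. (indicator U x *\<^sub>R f x)\<^sup>2) \<in> borel_measurable lebesgue"
    by (rule borel_measurable_power[OF f])
  moreover have "(\<lambda>x. (indicator U x *\<^sub>R f x)\<^sup>2) = (\<lambda>x. indicator U x *\<^sub>R (f x)\<^sup>2)"
    by (auto simp: indicator_def)
  ultimately have fm: "(\<lambda>x. indicator U x *\<^sub>R (f x)\<^sup>2) \<in> borel_measurable lebesgue" by simp
  have bm: "(\<lambda>x. gauss_density x * (f0 x)\<^sup>2) \<in> borel_measurable lborel" by measurable
  have lm: "(\<lambda>x. gauss_density x * (f0 x)\<^sup>2) \<in> borel_measurable lebesgue"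
    by (rule measurable_completion[OF bm])
  have gf: "(\<lambda>x. gauss_density x *\<^sub>R (indicator U x *\<^sub>R (f x)\<^sup>2)) \<in> borel_measurable lebesgue"
    by (rule borel_measurable_scaleR[OF gm fm])
  have nn: "AE x in lebesgue. 0 \<le> gauss_density (x::'a)"
    using gauss_density_pos less_imp_le by (intro AE_I2) blast
  have "set_integrable gauss_measure U (\<lambda>x. (f x)\<^sup>2) \<longleftrightarrow>
      integrable lebesgue (\<lambda>x. gauss_density x *\<^sub>R (indicator U x *\<^sub>R (f x)\<^sup>2))"
    unfolding set_integrable_def gauss_measure_def by (rule integrable_density[OF fm gm nn])
  also have "\<dots> \<longleftrightarrow> integrable lebesgue (\<lambda>x. gauss_density x * (f0 x)\<^sup>2)"
    by (rule integrable_cong_AE[OF gf lm AE'])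
  also have "\<dots> \<longleftrightarrow> integrable lborel (\<lambda>x. gauss_density x * (f0 x)\<^sup>2)"
    by (rule integrable_completion[OF bm])
  finally have int: "set_integrable gauss_measure U (\<lambda>x. (f x)\<^sup>2) \<longleftrightarrow> integrable lborel (\<lambda>x. gauss_density x * (f0 x)\<^sup>2)" .
  have "set_borel_measurable gauss_measure U f"
    using f by (simp add: set_borel_measurable_def gauss_measure_def)
  then show "L2_gauss U f \<longleftrightarrow> integrable lborel (\<lambda>x. gauss_density x * (f0 x)\<^sup>2)"
    using int by (simp add: L2_gauss_def)
  have "(LINT x:U|gauss_measure. (f x)\<^sup>2) =
      (\<integral>x. gauss_density x *\<^sub>R (indicator U x *\<^sub>R (f x)\<^sup>2) \<partial>lebesgue)"
    unfolding set_lebesgue_integral_def gauss_measure_def by (rule integral_density[OF fm gm nn])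
  also have "\<dots> = (\<integral>x. gauss_density x * (f0 x)\<^sup>2 \<partial>lebesgue)"
    by (rule integral_cong_AE[OF gf lm AE'])
  also have "\<dots> = (\<integral>x. gauss_density x * (f0 x)\<^sup>2 \<partial>lborel)"
    by (rule integral_completion[OF bm])
  finally show "L2_gauss_norm U f = sqrt (\<integral>x. gauss_density x * (f0 x)\<^sup>2 \<partial>lborel)"
    by (simp add: L2_gauss_norm_def)
qed

text \<open>\<open>L2_gauss\<close> sees only the norm of the gradient; measurability of the vector
  field itself comes from its integrability on compact sets that exhaust \<open>U\<close>.\<close>

lemma W11loc_grad_measurable:
  assumes W: "W11loc_grad U u g" and U: "open U"
  shows "(\<lambda>x. indicator U x *\<^sub>R g x) \<in> borel_measurable lebesgue"
proof -
  obtain C where C: "\<And>n. compact (C n)" "\<And>n. C n \<subseteq> U" "\<And>n. C n \<subseteq> interior (C (Suc n))" "\<Union>(range C) = U"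
    by (rule open_Union_compact_subsets[OF U]) (blast intro: that)
  have "C n \<subseteq> C (Suc n)" for n using C(3)[of n] interior_subset[of "C (Suc n)"] by (rule order_trans)
  then have inc: "C n \<subseteq> C m" if "n \<le> m" for n m
    using that by (rule lift_Suc_mono_le)
  show ?thesis
  proof (rule borel_measurable_LIMSEQ_metric)
    fix n
    have "set_integrable lebesgue (C n) g" using W C(1,2)[of n] by (simp add: W11loc_grad_def)
    then show "(\<lambda>x. indicator (C n) x *\<^sub>R g x) \<in> borel_measurable lebesgue"
      unfolding set_integrable_def by (rule borel_measurable_integrable)
  next
    fix x :: 'a
    show "(\<lambda>n. indicator (C n) x *\<^sub>R g x) \<longlonglongrightarrow> indicator U x *\<^sub>R g x"
    proof (cases "x \<in> U")
      case True
      then obtain n where "x \<in> C n" using C(4) by blast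
      then have "x \<in> C m" if "m \<ge> n" for m using inc[OF that] by blast
      then show ?thesis using True
        by (intro tendsto_eventually) (auto simp: eventually_sequentially intro!: exI[of _ n])
    next
      case False
      then have "x \<notin> C n" for n using C(2) by blast
      then show ?thesis using False by simp
    qed
  qed
qed

lemma integral_set_borel_version:
  fixes f f0 :: "'a::euclidean_space \<Rightarrow> real"
  assumes f: "(\<lambda>x. indicator U x *\<^sub>R f x) \<in> borel_measurable lebesgue"
    and f0: "f0 \<in> borel_measurable borel" and AE: "AE x in lborel. indicator U x *\<^sub>R f x = f0 x"
    and \<psi>: "\<psi> \<in> borel_measurable borel"
  shows "(LINT x:U|lebesgue. f x * \<psi> x) = (\<integral>x. f0 x * \<psi> x \<partial>lborel)"
proof -
  have bm: "(\<lambda>x. f0 x * \<psi> x) \<in> borel_measurable lborel" using f0 \<psi> by simp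
  have "(LINT x:U|lebesgue. f x * \<psi> x) = (\<integral>x. (indicator U x *\<^sub>R f x) * \<psi> x \<partial>lebesgue)"
    by (simp add: set_lebesgue_integral_def mult.assoc)
  also have "\<dots> = (\<integral>x. f0 x * \<psi> x \<partial>lebesgue)"
  proof (rule integral_cong_AE)
    show "(\<lambda>x. (indicator U x *\<^sub>R f x) * \<psi> x) \<in> borel_measurable lebesgue"
      by (rule borel_measurable_times[OF f measurable_completion]) (use \<psi> in simp)
    show "(\<lambda>x. f0 x * \<psi> x) \<in> borel_measurable lebesgue" by (rule measurable_completion[OF bm])
    show "AE x in lebesgue. (indicator U x *\<^sub>R f x) * \<psi> x = f0 x * \<psi> x"
      using AE_completion[OF AE] by eventually_elim simp
  qed
  also have "\<dots> = (\<integral>x. f0 x * \<psi> x \<partial>lborel)" by (rule integral_completion[OF bm])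
  finally show ?thesis .
qed

text \<open>Borel versions of \<open>u\<close> and \<open>g\<close>, zero off \<Omega>, are what is
  extended; norms and weak derivatives do not see the change.\<close>

lemma (in convex_sphere_domain) gauss_extension:
  assumes C2: "C2_boundary \<Omega>" and d0: "0 \<in> \<Omega> \<or> infdist 0 (frontier \<Omega>) = d0"
    and H: "H1_gauss_grad \<Omega> u g"
  shows "\<exists>v w. H1_gauss_grad UNIV v w \<and> (\<forall>x\<in>\<Omega>. v x = u x) \<and>
    H1_gauss_norm UNIV v w \<le> (sqrt (exp (r * \<bar>d0\<bar>) * (1 + 90 ^ DIM('a))) *
      (1 + sqrt 2 * (real DIM('a) * (16 / r)) + sqrt 2 * (real DIM('a) * 3))) * H1_gauss_norm \<Omega> u g"
proof -
  have W: "W11loc_grad \<Omega> u g" and L2u: "L2_gauss \<Omega> u" and L2g: "L2_gauss \<Omega> (\<lambda>x. norm (g x))"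
    using H by (auto simp: H1_gauss_grad_def)
  have um: "(\<lambda>x. indicator \<Omega> x *\<^sub>R u x) \<in> borel_measurable lebesgue"
    using L2u by (simp add: L2_gauss_def set_borel_measurable_def gauss_measure_def)
  have gm: "(\<lambda>x. indicator \<Omega> x *\<^sub>R g x) \<in> borel_measurable lebesgue"
    by (rule W11loc_grad_measurable[OF W open_dom])
  have "\<exists>f0\<in>borel_measurable borel. (AE x in lborel. indicator \<Omega> x *\<^sub>R u x = f0 x) \<and> (\<forall>x. x \<notin> \<Omega> \<longrightarrow> f0 x = 0)"
    by (rule lebesgue_borel_version[OF um _ open_dom]) simp
  then obtain u1 where u1[measurable]: "u1 \<in> borel_measurable borel"
    and uAE: "AE x in lborel. indicator \<Omega> x *\<^sub>R u x = u1 x" and u10: "\<And>x. x \<notin> \<Omega> \<Longrightarrow> u1 x = 0" by blast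
  have "\<exists>f0\<in>borel_measurable borel. (AE x in lborel. indicator \<Omega> x *\<^sub>R g x = f0 x) \<and> (\<forall>x. x \<notin> \<Omega> \<longrightarrow> f0 x = 0)"
    by (rule lebesgue_borel_version[OF gm _ open_dom]) simp
  then obtain g1 where g1[measurable]: "g1 \<in> borel_measurable borel"
    and gAE: "AE x in lborel. indicator \<Omega> x *\<^sub>R g x = g1 x" and g10: "\<And>x. x \<notin> \<Omega> \<Longrightarrow> g1 x = 0" by blast
  have ngm: "(\<lambda>x. indicator \<Omega> x *\<^sub>R norm (g x)) \<in> borel_measurable lebesgue"
    using L2g by (simp add: L2_gauss_def set_borel_measurable_def gauss_measure_def)
  have ngAE: "AE x in lborel. indicator \<Omega> x *\<^sub>R norm (g x) = norm (g1 x)"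
    using gAE by eventually_elim (auto simp: indicator_def split: if_splits)
  have [measurable]: "(\<lambda>x. norm (g1 x)) \<in> borel_measurable borel" by measurable
  define Iu where "Iu = (\<integral>x. gauss_density x * (u1 x)\<^sup>2 \<partial>lborel)"
  define Ig where "Ig = (\<integral>x. gauss_density x * (norm (g1 x))\<^sup>2 \<partial>lborel)"
  have intu: "integrable lborel (\<lambda>x. gauss_density x * (u1 x)\<^sup>2)" and nu: "L2_gauss_norm \<Omega> u = sqrt Iu"
    using L2_gauss_borel_version[OF um u1 uAE] L2u by (auto simp: Iu_def)
  have intg: "integrable lborel (\<lambda>x. gauss_density x * (norm (g1 x))\<^sup>2)" and ng: "L2_gauss_norm \<Omega> (\<lambda>x. norm (g x)) = sqrt Ig"
    using L2_gauss_borel_version[OF ngm _ ngAE] L2g by (auto simp: Ig_def)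
  have gp: "0 \<le> gauss_density x" for x :: 'a using gauss_density_pos[of x] by simp
  have I0: "Iu \<ge> 0" "Ig \<ge> 0" unfolding Iu_def Ig_def using gp by (auto intro!: integral_nonneg_AE)
  have loc: "integrable lborel (\<lambda>x. indicator (ball 0 B) x *\<^sub>R u1 x)" "integrable lborel (\<lambda>x. indicator (ball 0 B) x *\<^sub>R g1 x)" for B
    by (rule integrable_of_weighted_L2; use intu intg in simp)+
  have weak: "(\<integral>x. u1 x * frechet_derivative \<phi> (at x) i \<partial>lborel) = - (\<integral>x. (g1 x \<bullet> i) * \<phi> x \<partial>lborel)"
    if \<phi>: "test_fun \<Omega> \<phi>" and i: "i \<in> Basis" for \<phi> i
  proof -
    have sm: "smooth_fun \<phi>" using \<phi> by (simp add: test_fun_def)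
    have [measurable]: "\<phi> \<in> borel_measurable borel" "(\<lambda>x. frechet_derivative \<phi> (at x) i) \<in> borel_measurable borel"
      using smooth_funD(2,4)[OF sm] i by (auto intro: borel_measurable_continuous_onI)
    have gim: "(\<lambda>x. indicator \<Omega> x *\<^sub>R (g x \<bullet> i)) \<in> borel_measurable lebesgue"
      using borel_measurable_inner[OF gm borel_measurable_const[of i]] by simp
    have giAE: "AE x in lborel. indicator \<Omega> x *\<^sub>R (g x \<bullet> i) = g1 x \<bullet> i"
      using gAE by eventually_elim (metis inner_scaleR_left real_scaleR_def)
    have "(LINT x:\<Omega>|lebesgue. u x * frechet_derivative \<phi> (at x) i) = - (LINT x:\<Omega>|lebesgue. (g x \<bullet> i) * \<phi> x)"
      using W \<phi> i unfolding W11loc_grad_def by blast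
    then show ?thesis
      by (subst (asm) integral_set_borel_version[OF um u1 uAE], simp)
        (subst (asm) integral_set_borel_version[OF gim _ giAE]; simp)
  qed
  define E where "E = exp (r * \<bar>d0\<bar>) * pull_const"
  have E: "E > 0" using pull_const_pos by (simp add: E_def)
  define a b where "a = real DIM('a) * (16 / r)" and "b = real DIM('a) * 3"
  have ab: "a \<ge> 0" "b \<ge> 0" using r_pos by (auto simp: a_def b_def)
  define w where "w = ext_grad u1 g1"
  \<comment> \<open>\<open>u\<close> itself, not its Borel version, is used on \<Omega>, so that the
    extension agrees with it at every point there.\<close>
  define v where "v x = (if x \<in> \<Omega> then u x else ext u1 x)" for x
  have em[measurable]: "ext u1 \<in> borel_measurable borel" unfolding ext_def[abs_def] by measurable
  have wm[measurable]: "w \<in> borel_measurable borel"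
    unfolding w_def ext_grad_def[abs_def] ext_partial_def[abs_def] by measurable
  \<comment> \<open>On \<Omega> the cutoff is 1 and the reflection is the identity, so
    \<open>ext u1\<close> is \<open>u1\<close> there.\<close>
  have vAE: "AE x in lborel. v x = ext u1 x"
    using uAE
  proof eventually_elim
    case (elim x)
    then show ?case by (auto simp: v_def ext_def cutoff_dom reflect_self dom_subset_closure)
  qed
  have vm: "v \<in> borel_measurable lebesgue"
  proof -
    have "(\<lambda>x. indicator (- \<Omega>) x * ext u1 x) \<in> borel_measurable lborel"
      using open_dom by measurable
    then have "(\<lambda>x. indicator \<Omega> x *\<^sub>R u x + indicator (- \<Omega>) x * ext u1 x) \<in> borel_measurable lebesgue"
      by (intro borel_measurable_add um measurable_completion)
    also have "(\<lambda>x. indicator \<Omega> x *\<^sub>R u x + indicator (- \<Omega>) x * ext u1 x) = v"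
      by (auto simp: v_def)
    finally show ?thesis .
  qed
  have wl: "w \<in> borel_measurable lebesgue" by (rule measurable_completion) simp
  have v1: "integrable lborel (\<lambda>x. gauss_density x * (ext u1 x)\<^sup>2)"
    "(\<integral>x. gauss_density x * (ext u1 x)\<^sup>2 \<partial>lborel) \<le> E * Iu"
    using weighted_reflect_le[OF d0, of "\<lambda>y. (u1 y)\<^sup>2" "\<lambda>x. (ext u1 x)\<^sup>2"] u10 intu ext_square_le[of _ u1]
    by (auto simp: E_def Iu_def)
  have w1: "integrable lborel (\<lambda>x. gauss_density x * (norm (w x))\<^sup>2)"
    "(\<integral>x. gauss_density x * (norm (w x))\<^sup>2 \<partial>lborel) \<le> E * (2 * a\<^sup>2 * Iu + 2 * b\<^sup>2 * Ig)"
  proof -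
    \<comment> \<open>The majorant of the squared gradient from \<open>ext_grad_square_le\<close>,
      as a function of the reflected point.\<close>
    let ?F = "\<lambda>y. 2 * a\<^sup>2 * (u1 y)\<^sup>2 + 2 * b\<^sup>2 * (norm (g1 y))\<^sup>2"
    have eq: "gauss_density y * ?F y = 2 * a\<^sup>2 * (gauss_density y * (u1 y)\<^sup>2) + 2 * b\<^sup>2 * (gauss_density y * (norm (g1 y))\<^sup>2)" for y
      by (simp add: algebra_simps)
    have intF: "integrable lborel (\<lambda>y. gauss_density y * ?F y)"
      unfolding eq by (intro Bochner_Integration.integrable_add integrable_mult_right intu intg)
    have "(\<integral>y. gauss_density y * ?F y \<partial>lborel) =
       (\<integral>y. 2 * a\<^sup>2 * (gauss_density y * (u1 y)\<^sup>2) \<partial>lborel) + (\<integral>y. 2 * b\<^sup>2 * (gauss_density y * (norm (g1 y))\<^sup>2) \<partial>lborel)"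
      unfolding eq by (intro Bochner_Integration.integral_add integrable_mult_right intu intg)
    also have "\<dots> = 2 * a\<^sup>2 * Iu + 2 * b\<^sup>2 * Ig"
      unfolding Iu_def Ig_def by (simp only: integral_mult_right_zero)
    finally have IF: "(\<integral>y. gauss_density y * ?F y \<partial>lborel) = 2 * a\<^sup>2 * Iu + 2 * b\<^sup>2 * Ig" .
    have Fm: "?F \<in> borel_measurable borel" "(\<lambda>x. (norm (w x))\<^sup>2) \<in> borel_measurable borel" by measurable
    have F0: "?F y = 0" if "y \<notin> \<Omega>" for y using u10[OF that] g10[OF that] by simp
    have Fnn: "0 \<le> ?F y" for y by simp
    have f1: "(norm (w x))\<^sup>2 \<le> ?F (reflect x)" for x
      using ext_grad_square_le(1)[OF C2, of u1 g1 x] by (simp only: w_def a_def b_def)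
    have f2: "(norm (w x))\<^sup>2 = 0" if "r / 2 < norm (x - proj x)" for x
      using ext_grad_square_le(2)[OF C2 that, of u1 g1] by (simp add: w_def)
    note wr = weighted_reflect_le[OF d0 Fm F0 Fnn intF zero_le_power2 f1 f2]
    show "integrable lborel (\<lambda>x. gauss_density x * (norm (w x))\<^sup>2)" by (rule wr(1))
    show "(\<integral>x. gauss_density x * (norm (w x))\<^sup>2 \<partial>lborel) \<le> E * (2 * a\<^sup>2 * Iu + 2 * b\<^sup>2 * Ig)"
      using wr(2) unfolding IF E_def by simp
  qed
  have vm': "(\<lambda>x. indicator UNIV x *\<^sub>R v x) \<in> borel_measurable lebesgue" using vm by simp
  have vAE': "AE x in lborel. indicator UNIV x *\<^sub>R v x = ext u1 x" using vAE by simp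
  have nwm: "(\<lambda>x. indicator UNIV x *\<^sub>R norm (w x)) \<in> borel_measurable lebesgue"
    using measurable_compose[OF wl borel_measurable_norm] by simp
  have L2v: "L2_gauss UNIV v" and nv: "L2_gauss_norm UNIV v = sqrt (\<integral>x. gauss_density x * (ext u1 x)\<^sup>2 \<partial>lborel)"
    using L2_gauss_borel_version[OF vm' em vAE'] v1(1) by auto
  have L2w: "L2_gauss UNIV (\<lambda>x. norm (w x))"
    and nw: "L2_gauss_norm UNIV (\<lambda>x. norm (w x)) = sqrt (\<integral>x. gauss_density x * (norm (w x))\<^sup>2 \<partial>lborel)"
    using L2_gauss_borel_version[OF nwm, of "\<lambda>x. norm (w x)"] w1(1) by auto
  have "W11loc_grad UNIV v w"
    unfolding W11loc_grad_def
  proof (intro conjI allI impI ballI)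
    fix K :: "'a set" assume K: "compact K \<and> K \<subseteq> UNIV"
    then have Ks: "K \<in> sets borel" by (auto intro: borel_compact)
    obtain B where B: "K \<subseteq> ball 0 B"
      using bounded_subset_ballD[of K 0] compact_imp_bounded[of K] K by auto
    have intK: "integrable lebesgue (\<lambda>x. indicator K x *\<^sub>R f x)"
      if [measurable]: "f \<in> borel_measurable borel" and f: "integrable lborel (\<lambda>x. gauss_density x * (norm (f x))\<^sup>2)"
      for f :: "'a \<Rightarrow> 'b::euclidean_space"
    proof -
      have [measurable]: "K \<in> sets borel" by (rule Ks)
      have "integrable lborel (\<lambda>x. indicator K x *\<^sub>R (indicator (ball 0 B) x *\<^sub>R f x))"
        by (rule integrable_mult_indicator[OF _ integrable_of_weighted_L2[OF that]]) simp
      moreover have "(\<lambda>x. indicator K x *\<^sub>R (indicator (ball 0 B) x *\<^sub>R f x)) = (\<lambda>x. indicator K x *\<^sub>R f x)"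
        using B by (auto simp: indicator_def fun_eq_iff)
      ultimately show ?thesis
        by (subst integrable_completion) auto
    qed
    show "set_integrable lebesgue K w" unfolding set_integrable_def by (rule intK[OF wm w1(1)])
    have iv: "integrable lebesgue (\<lambda>x. indicator K x *\<^sub>R ext u1 x)" by (rule intK[OF em]) (use v1(1) in simp)
    have "integrable lebesgue (\<lambda>x. indicator K x *\<^sub>R v x) \<longleftrightarrow> integrable lebesgue (\<lambda>x. indicator K x *\<^sub>R ext u1 x)"
    proof (rule integrable_cong_AE)
      show "(\<lambda>x. indicator K x *\<^sub>R v x) \<in> borel_measurable lebesgue"
        using Ks by (intro borel_measurable_scaleR borel_measurable_indicator vm) simp
      show "AE x in lebesgue. indicator K x *\<^sub>R v x = indicator K x *\<^sub>R ext u1 x"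
        using AE_completion[OF vAE] by eventually_elim simp
    qed (use iv in auto)
    then show "set_integrable lebesgue K v" using iv by (simp add: set_integrable_def)
  next
    fix \<phi> :: "'a \<Rightarrow> real" and i :: 'a assume \<phi>: "test_fun UNIV \<phi>" and i: "i \<in> Basis"
    have sm: "smooth_fun \<phi>" using \<phi> by (simp add: test_fun_def)
    have \<phi>m: "\<phi> \<in> borel_measurable borel" "(\<lambda>x. frechet_derivative \<phi> (at x) i) \<in> borel_measurable borel"
      using smooth_funD(2,4)[OF sm] i by (auto intro: borel_measurable_continuous_onI)
    have wim: "(\<lambda>x. indicator UNIV x *\<^sub>R (w x \<bullet> i)) \<in> borel_measurable lebesgue"
      using borel_measurable_inner[OF wl borel_measurable_const[of i]] by simp
    have "(LINT x:UNIV|lebesgue. v x * frechet_derivative \<phi> (at x) i) = (\<integral>x. ext u1 x * frechet_derivative \<phi> (at x) i \<partial>lborel)"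
      by (rule integral_set_borel_version[OF vm' em vAE' \<phi>m(2)])
    also have "\<dots> = - (\<integral>x. (w x \<bullet> i) * \<phi> x \<partial>lborel)"
      unfolding w_def by (rule ext_weak_gradient[OF C2 u1 g1 u10 g10 loc weak \<phi> i])
    also have "(\<integral>x. (w x \<bullet> i) * \<phi> x \<partial>lborel) = (LINT x:UNIV|lebesgue. (w x \<bullet> i) * \<phi> x)"
      by (rule integral_set_borel_version[OF wim _ _ \<phi>m(1), symmetric]) auto
    finally show "(LINT x:UNIV|lebesgue. v x * frechet_derivative \<phi> (at x) i) = - (LINT x:UNIV|lebesgue. (w x \<bullet> i) * \<phi> x)" .
  qed
  then have HV: "H1_gauss_grad UNIV v w" using L2v L2w by (simp add: H1_gauss_grad_def)
  \<comment> \<open>The H^1 norm adds two L^2 norms, so the square root is split by subadditivity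
    and both coefficients are enlarged to a common \<open>?k\<close>.\<close>
  let ?k = "1 + sqrt 2 * a + sqrt 2 * b"
  have "sqrt (2 * a\<^sup>2 * Iu + 2 * b\<^sup>2 * Ig) \<le> sqrt (2 * a\<^sup>2 * Iu) + sqrt (2 * b\<^sup>2 * Ig)"
    using I0 by (intro sqrt_add_le_add_sqrt) auto
  also have "\<dots> = sqrt 2 * a * sqrt Iu + sqrt 2 * b * sqrt Ig"
    using ab by (simp add: real_sqrt_mult)
  finally have "sqrt Iu + sqrt (2 * a\<^sup>2 * Iu + 2 * b\<^sup>2 * Ig) \<le> (1 + sqrt 2 * a) * sqrt Iu + (sqrt 2 * b) * sqrt Ig"
    by (simp add: algebra_simps)
  also have "\<dots> \<le> ?k * sqrt Iu + ?k * sqrt Ig"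
  proof -
    have "sqrt 2 * a \<ge> 0" "sqrt 2 * b \<ge> 0" using ab by auto
    then have "1 + sqrt 2 * a \<le> ?k" "sqrt 2 * b \<le> ?k" by linarith+
    from this[THEN mult_right_mono] show ?thesis using I0 by (intro add_mono) auto
  qed
  finally have le: "sqrt Iu + sqrt (2 * a\<^sup>2 * Iu + 2 * b\<^sup>2 * Ig) \<le> ?k * sqrt Iu + ?k * sqrt Ig" .
  have "H1_gauss_norm UNIV v w \<le> sqrt (E * Iu) + sqrt (E * (2 * a\<^sup>2 * Iu + 2 * b\<^sup>2 * Ig))"
    unfolding H1_gauss_norm_def nv nw using v1(2) w1(2) by (intro add_mono) auto
  also have "\<dots> = sqrt E * (sqrt Iu + sqrt (2 * a\<^sup>2 * Iu + 2 * b\<^sup>2 * Ig))"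
    unfolding real_sqrt_mult[of E] by (rule distrib_left[symmetric])
  also have "\<dots> \<le> sqrt E * (?k * sqrt Iu + ?k * sqrt Ig)"
    using le E by (intro mult_left_mono) auto
  also have "\<dots> = (sqrt E * ?k) * H1_gauss_norm \<Omega> u g"
    unfolding H1_gauss_norm_def nu ng by (simp add: algebra_simps)
  finally have "H1_gauss_norm UNIV v w \<le> (sqrt E * (1 + sqrt 2 * a + sqrt 2 * b)) * H1_gauss_norm \<Omega> u g" .
  then show ?thesis using HV
    by (intro exI[of _ v] exI[of _ w]) (auto simp: v_def E_def pull_const_def a_def b_def)
qed

text \<open>The constant is fixed before \<Omega>, \<open>u\<close> and \<open>g\<close>. For 0 in
  \<Omega> the value of \<open>d0\<close> is not tied to the domain, so the instance d0 = 0 yields a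
  constant in terms of rbar and N only.\<close>

theorem theorem2p1:
  fixes rbar d0 :: real
  assumes "DIM('a::euclidean_space) \<ge> 2" and "rbar > 0"
  shows "\<exists>C::real. \<forall>(\<Omega>::'a set) (u::'a \<Rightarrow> real) (g::'a \<Rightarrow> 'a).
     open \<Omega> \<and> connected \<Omega> \<and> \<Omega> \<noteq> {} \<and> convex \<Omega> \<and> C2_boundary \<Omega> \<and> interior_sphere \<Omega> rbar \<and>
     (0 \<in> \<Omega> \<or> infdist 0 (frontier \<Omega>) = d0) \<and> H1_gauss_grad \<Omega> u g
     \<longrightarrow> (\<exists>v w. H1_gauss_grad UNIV v w \<and> (\<forall>x\<in>\<Omega>. v x = u x) \<and>
              H1_gauss_norm UNIV v w \<le> C * H1_gauss_norm \<Omega> u g)"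
proof (rule exI[of _ "sqrt (exp (rbar * \<bar>d0\<bar>) * (1 + 90 ^ DIM('a))) *
      (1 + sqrt 2 * (real DIM('a) * (16 / rbar)) + sqrt 2 * (real DIM('a) * 3))"], intro allI impI, elim conjE)
  fix \<Omega> :: "'a set" and u :: "'a \<Rightarrow> real" and g :: "'a \<Rightarrow> 'a"
  assume \<Omega>: "open \<Omega>" "\<Omega> \<noteq> {}" "convex \<Omega>" "interior_sphere \<Omega> rbar"
    and C2: "C2_boundary \<Omega>" and d0: "0 \<in> \<Omega> \<or> infdist 0 (frontier \<Omega>) = d0"
    and H: "H1_gauss_grad \<Omega> u g"
  interpret convex_sphere_domain \<Omega> rbar
    using \<Omega> assms(2) by unfold_locales
  show "\<exists>v w. H1_gauss_grad UNIV v w \<and> (\<forall>x\<in>\<Omega>. v x = u x) \<and>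
    H1_gauss_norm UNIV v w \<le> (sqrt (exp (rbar * \<bar>d0\<bar>) * (1 + 90 ^ DIM('a))) *
      (1 + sqrt 2 * (real DIM('a) * (16 / rbar)) + sqrt 2 * (real DIM('a) * 3))) * H1_gauss_norm \<Omega> u g"
    by (rule gauss_extension[OF C2 d0 H])
qed

end
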